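(* Let $\Sigma$ be a signature, let $\mathcal{R}$ be any rewriting system on the PROP $\mathbf{S}_\Sigma+\mathbf{Frob}$, and let $d,e\colon n\to m$ be arrows of $\mathbf{S}_\Sigma+\mathbf{Frob}$. Then $$d\Rightarrow_{\mathcal{R}} e \quad\text{ if and only if }\quad \Phi(\ulcorner d\urcorner)\rightsquigarrow_{\Phi(\ulcorner\mathcal{R}\urcorner)}\Phi(\ulcorner e\urcorner).$$
   Context: Composition is written in diagrammatic order: $f;g$ is first $f$, then $g$. PROPs. A PROP is a symmetric strict monoidal category whose objects are the natural numbers, with monoidal product $\oplus$ given on objects by addition; $\sigma_{n,m}\colon n+m\to m+n$ are the symmetries. Morphisms of PROPs are identity-on-objects strict symmetric monoidal functors. A signature $\Sigma$ is a set of generators $o\colon n\to m$ with arity $n$ and coarity $m$ in $\mathbb{N}$. $\mathbf{S}_\Sigma$ is the PROP freely generated by $\Sigma$ with no equations. $\mathbf{Frob}$ is the PROP freely generated by $\mu\colon 2\to 1$, $\eta\colon 0\to 1$, $\delta\colon 1\to 2$, $\varepsilon\colon 1\to 0$ subject to: $(\mu,\eta)$ is a commutative monoid, $(\delta,\varepsilon)$ is a cocommutative comonoid, $(\delta\oplus \mathrm{id}_1);(\mathrm{id}_1\oplus\mu)=\mu;\delta=(\mathrm{id}_1\oplus\delta);(\mu\oplus\mathrm{id}_1)$, and $\delta;\mu=\mathrm{id}_1$. $\mathbf{S}_\Sigma+\mathbf{Frob}$ is the coproduct in the category of PROPs (presented by the union of the two sets of generators and equations). Rewriting in a PROP $\mathbf{X}$.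 A rewriting rule of type $(i,j)$ is a pair $\langle l,r\rangle$ of arrows $l,r\colon i\to j$ of $\mathbf{X}$; a rewriting system $\mathcal{R}$ is a set of rules. For $d,e\colon n\to m$, $d\Rightarrow_{\mathcal{R}}e$ iff there are $\langle l,r\rangle\colon(i,j)$ in $\mathcal{R}$, $k\in\mathbb{N}$, $c_1\colon n\to k+i$ and $c_2\colon k+j\to m$ with $d=c_1;(\mathrm{id}_k\oplus l);c_2$ and $e=c_1;(\mathrm{id}_k\oplus r);c_2$. Bending. Caps $\mathrm{cap}_n\colon 0\to n+n$ are defined by $\mathrm{cap}_0=\mathrm{id}_0$, $\mathrm{cap}_1=\eta;\delta$, $\mathrm{cap}_{n+1}=(\mathrm{cap}_1\oplus\mathrm{cap}_n);(\mathrm{id}_1\oplus\sigma_{1,n}\oplus\mathrm{id}_n)$. For $d\colon n\to m$, $\ulcorner d\urcorner=\mathrm{cap}_n;(\mathrm{id}_n\oplus d)\colon 0\to n+m$, and $\ulcorner\mathcal{R}\urcorner=\{\langle\ulcorner l\urcorner,\ulcorner r\urcorner\rangle\mid\langle l,r\rangle\in\mathcal{R}\}$. Hypergraphs. A (finite directed) hypergraph has a finite set of nodes and a finite set of hyperedges, each hyperedge having an ordered list of $k$ source nodes and an ordered list of $l$ target nodes for some $k,l\in\mathbb{N}$. A $\Sigma$-hypergraph is a hypergraph in which each hyperedge with $k$ sources and $l$ targets is labelled by a generator $k\to l$ of $\Sigma$; $\mathbf{Hyp}_\Sigma$ is the category of $\Sigma$-hypergraphs and homomorphisms (preserving ordered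 sources, targets and labels); pushouts are computed pointwise. $n\in\mathbb{N}$ is identified with the discrete hypergraph (no hyperedges) with node set $\{0,\dots,n-1\}$. $\mathbf{FTerm}_\Sigma$ is the PROP whose arrows $n\to m$ are isomorphism classes of cospans $n\to G\leftarrow m$ in $\mathbf{Hyp}_\Sigma$, with composition by pushout and $\oplus$ disjoint union. The isomorphism $\Phi$. $\Phi\colon\mathbf{S}_\Sigma+\mathbf{Frob}\to\mathbf{FTerm}_\Sigma$ is the PROP isomorphism which sends a generator $o\colon n\to m$ of $\Sigma$ to the cospan $n\to G_o\leftarrow m$, where $G_o$ has $n+m$ distinct nodes and a single hyperedge labelled $o$ whose ordered sources are the first $n$ nodes (the image of the left leg, in order) and whose ordered targets are the last $m$ nodes (the image of the right leg, in order), and which sends $\mu,\eta,\delta,\varepsilon$ to the discrete cospans $2\to1\leftarrow1$, $0\to1\leftarrow1$, $1\to1\leftarrow2$, $1\to1\leftarrow0$ respectively. $\Phi(\ulcorner\mathcal{R}\urcorner)=\{\langle\Phi(\ulcorner l\urcorner),\Phi(\ulcorner r\urcorner)\rangle\mid\langle l,r\rangle\in\mathcal{R}\}$. DPO rewriting. A DPO rule is a span $L\leftarrow j\to R$ in $\mathbf{Hyp}_\Sigma$ with $j$ discrete. A pair of cospans $\langle 0\to L\leftarrow j,\;0\to R\leftarrow j\rangle$ is identified with the DPO rule $L\leftarrow j\to R$; in this way $\Phi(\ulcorner\mathcal{R}\urcorner)$ is regarded as a DPO rewriting system (set of DPO rules). For a DPO rewriting system $\mathcal{S}$ and $d=(0\to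 G\xleftarrow{p}m)$, $e=(0\to H\xleftarrow{q}m)$ in $\mathbf{FTerm}_\Sigma$, $d\rightsquigarrow_{\mathcal{S}}e$ iff there are a rule $L\leftarrow j\to R$ in $\mathcal{S}$, a cospan $j\to C\leftarrow m$, and arrows $L\to G\leftarrow C$ and $C\to H\leftarrow R$ in $\mathbf{Hyp}_\Sigma$ such that the squares $(j\to L\to G)=(j\to C\to G)$ and $(j\to R\to H)=(j\to C\to H)$ are pushouts, and $m\to C\to G$ equals $p$ and $m\to C\to H$ equals $q$. *)

theory Defs
  imports Main
begin

section \<open>PROPs presented by generators and equations\<close>

record 'g signature =
  gens :: "'g set"
  ar :: "'g \<Rightarrow> nat"
  coar :: "'g \<Rightarrow> nat"

text \<open>The data of a PROP. Composition \<open>\<Zcomp>\<close> is diagrammatic; \<open>Idn n\<close> is the identity on \<open>n\<close>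
  and \<open>Symm n m : n + m \<rightarrow> m + n\<close> the symmetry.\<close>

record 'a prop_data =
  Hom :: "nat \<Rightarrow> nat \<Rightarrow> 'a set"
  seq :: "'a \<Rightarrow> 'a \<Rightarrow> 'a"  (infixl "\<Zcomp>\<index>" 60)
  ten :: "'a \<Rightarrow> 'a \<Rightarrow> 'a"  (infixl "\<oplus>\<index>" 65)
  Idn :: "nat \<Rightarrow> 'a"
  Symm :: "nat \<Rightarrow> nat \<Rightarrow> 'a"

datatype 'g tm =
    Gen 'g
  | TId nat
  | TSym nat nat
  | TSeq "'g tm" "'g tm"  (infixl ";;" 60)
  | TTen "'g tm" "'g tm"  (infixl "||" 65)

inductive typed :: "'g signature \<Rightarrow> 'g tm \<Rightarrow> nat \<Rightarrow> nat \<Rightarrow> bool" for S where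
  "g \<in> gens S \<Longrightarrow> typed S (Gen g) (ar S g) (coar S g)"
| "typed S (TId n) n n"
| "typed S (TSym n m) (n + m) (m + n)"
| "typed S s n k \<Longrightarrow> typed S t k m \<Longrightarrow> typed S (s ;; t) n m"
| "typed S s n m \<Longrightarrow> typed S t n' m' \<Longrightarrow> typed S (s || t) (n + n') (m + m')"

text \<open>\<open>tm_eq S E n m\<close>: the least congruence on terms of type \<open>n \<rightarrow> m\<close> over \<open>S\<close> that contains \<open>E\<close>
  and the laws of symmetric strict monoidal categories.\<close>

inductive tm_eq ::
    "'g signature \<Rightarrow> ('g tm \<times> 'g tm) set \<Rightarrow> nat \<Rightarrow> nat \<Rightarrow> 'g tm \<Rightarrow> 'g tm \<Rightarrow> bool"
  for S E where
  axiom: "(s, t) \<in> E \<Longrightarrow> typed S s n m \<Longrightarrow> typed S t n m \<Longrightarrow> tm_eq S E n m s t"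
| refl: "typed S t n m \<Longrightarrow> tm_eq S E n m t t"
| sym: "tm_eq S E n m s t \<Longrightarrow> tm_eq S E n m t s"
| trans: "tm_eq S E n m s t \<Longrightarrow> tm_eq S E n m t u \<Longrightarrow> tm_eq S E n m s u"
| seq_cong: "tm_eq S E n k s s' \<Longrightarrow> tm_eq S E k m t t' \<Longrightarrow> tm_eq S E n m (s ;; t) (s' ;; t')"
| ten_cong: "tm_eq S E n m s s' \<Longrightarrow> tm_eq S E n' m' t t' \<Longrightarrow>
    tm_eq S E (n + n') (m + m') (s || t) (s' || t')"
| seq_assoc: "typed S s n k \<Longrightarrow> typed S t k l \<Longrightarrow> typed S u l m \<Longrightarrow>
    tm_eq S E n m ((s ;; t) ;; u) (s ;; (t ;; u))"
| seq_id_left: "typed S t n m \<Longrightarrow> tm_eq S E n m (TId n ;; t) t"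
| seq_id_right: "typed S t n m \<Longrightarrow> tm_eq S E n m (t ;; TId m) t"
| ten_assoc: "typed S s n m \<Longrightarrow> typed S t n' m' \<Longrightarrow> typed S u n'' m'' \<Longrightarrow>
    tm_eq S E (n + n' + n'') (m + m' + m'') ((s || t) || u) (s || (t || u))"
| ten_unit_left: "typed S t n m \<Longrightarrow> tm_eq S E n m (TId 0 || t) t"
| ten_unit_right: "typed S t n m \<Longrightarrow> tm_eq S E n m (t || TId 0) t"
| interchange: "typed S s n k \<Longrightarrow> typed S t k m \<Longrightarrow> typed S s' n' k' \<Longrightarrow> typed S t' k' m' \<Longrightarrow>
    tm_eq S E (n + n') (m + m') ((s ;; t) || (s' ;; t')) ((s || s') ;; (t || t'))"
| ten_id: "tm_eq S E (n + m) (n + m) (TId n || TId m) (TId (n + m))"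
| sym_natural: "typed S s n m \<Longrightarrow> typed S t n' m' \<Longrightarrow>
    tm_eq S E (n + n') (m' + m) ((s || t) ;; TSym m m') (TSym n n' ;; (t || s))"
| sym_inverse: "tm_eq S E (n + m) (n + m) (TSym n m ;; TSym m n) (TId (n + m))"
| sym_unit: "tm_eq S E n n (TSym n 0) (TId n)"
| sym_hexagon: "tm_eq S E (n + m + k) (m + k + n)
    (TSym n (m + k)) ((TSym n m || TId k) ;; (TId m || TSym n k))"

text \<open>The PROP freely generated by \<open>S\<close> subject to \<open>E\<close>. Arrows are equivalence classes of terms.\<close>

definition tm_class :: "'g signature \<Rightarrow> ('g tm \<times> 'g tm) set \<Rightarrow> 'g tm \<Rightarrow> 'g tm set" where
  "tm_class S E t = {u. \<exists>n m. tm_eq S E n m t u}"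

definition presented_prop :: "'g signature \<Rightarrow> ('g tm \<times> 'g tm) set \<Rightarrow> 'g tm set prop_data" where
  "presented_prop S E = \<lparr>
     Hom = (\<lambda>n m. {tm_class S E t | t. typed S t n m}),
     seq = (\<lambda>A B. \<Union>s\<in>A. \<Union>t\<in>B. tm_class S E (s ;; t)),
     ten = (\<lambda>A B. \<Union>s\<in>A. \<Union>t\<in>B. tm_class S E (s || t)),
     Idn = (\<lambda>n. tm_class S E (TId n)),
     Symm = (\<lambda>n m. tm_class S E (TSym n m)) \<rparr>"

text \<open>Evaluation of terms in a PROP \<open>X\<close>, given the values of the generators.\<close>

primrec eval :: "'a prop_data \<Rightarrow> ('g \<Rightarrow> 'a) \<Rightarrow> 'g tm \<Rightarrow> 'a" where
  "eval X I (Gen g) = I g"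
| "eval X I (TId n) = Idn X n"
| "eval X I (TSym n m) = Symm X n m"
| "eval X I (s ;; t) = eval X I s \<Zcomp>\<^bsub>X\<^esub> eval X I t"
| "eval X I (s || t) = eval X I s \<oplus>\<^bsub>X\<^esub> eval X I t"


section \<open>The PROPs Frob and S + Frob\<close>

datatype frob = Mu | Eta | Delta | Eps

definition frob_sig :: "frob signature" where
  "frob_sig = \<lparr> gens = UNIV,
     ar = (\<lambda>g. case g of Mu \<Rightarrow> 2 | Eta \<Rightarrow> 0 | Delta \<Rightarrow> 1 | Eps \<Rightarrow> 1),
     coar = (\<lambda>g. case g of Mu \<Rightarrow> 1 | Eta \<Rightarrow> 1 | Delta \<Rightarrow> 2 | Eps \<Rightarrow> 0) \<rparr>"

definition frob_eqs :: "(frob tm \<times> frob tm) set" where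
  "frob_eqs = {
     \<comment> \<open>commutative monoid\<close>
     ((Gen Mu || TId 1) ;; Gen Mu, (TId 1 || Gen Mu) ;; Gen Mu),
     ((Gen Eta || TId 1) ;; Gen Mu, TId 1),
     ((TId 1 || Gen Eta) ;; Gen Mu, TId 1),
     (TSym 1 1 ;; Gen Mu, Gen Mu),
     \<comment> \<open>cocommutative comonoid\<close>
     (Gen Delta ;; (Gen Delta || TId 1), Gen Delta ;; (TId 1 || Gen Delta)),
     (Gen Delta ;; (Gen Eps || TId 1), TId 1),
     (Gen Delta ;; (TId 1 || Gen Eps), TId 1),
     (Gen Delta ;; TSym 1 1, Gen Delta),
     \<comment> \<open>Frobenius law and special law\<close>
     ((Gen Delta || TId 1) ;; (TId 1 || Gen Mu), Gen Mu ;; Gen Delta),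
     ((TId 1 || Gen Delta) ;; (Gen Mu || TId 1), Gen Mu ;; Gen Delta),
     (Gen Delta ;; Gen Mu, TId 1) }"

text \<open>The coproduct of two presented PROPs is presented by the disjoint union of the generators and
  the union of the equations.\<close>

definition sum_sig :: "'g signature \<Rightarrow> 'h signature \<Rightarrow> ('g + 'h) signature" where
  "sum_sig S T = \<lparr> gens = gens S <+> gens T,
     ar = case_sum (ar S) (ar T), coar = case_sum (coar S) (coar T) \<rparr>"

definition sum_eqs ::
    "('g tm \<times> 'g tm) set \<Rightarrow> ('h tm \<times> 'h tm) set \<Rightarrow> (('g + 'h) tm \<times> ('g + 'h) tm) set" where
  "sum_eqs E F = map_prod (map_tm Inl) (map_tm Inl) ` E \<union> map_prod (map_tm Inr) (map_tm Inr) ` F"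

type_synonym 'g sfrob_arrow = "('g + frob) tm set"

definition SFrob :: "'g signature \<Rightarrow> 'g sfrob_arrow prop_data" where
  "SFrob S = presented_prop (sum_sig S frob_sig) (sum_eqs {} frob_eqs)"

definition frob_arrow :: "'g signature \<Rightarrow> frob \<Rightarrow> 'g sfrob_arrow" where
  "frob_arrow S x = tm_class (sum_sig S frob_sig) (sum_eqs {} frob_eqs) (Gen (Inr x))"


section \<open>Rewriting in a PROP\<close>

definition rewriting_system :: "'a prop_data \<Rightarrow> ('a \<times> 'a) set \<Rightarrow> bool" where
  "rewriting_system X \<R> \<longleftrightarrow> (\<forall>(l, r) \<in> \<R>. \<exists>i j. l \<in> Hom X i j \<and> r \<in> Hom X i j)"

definition rewrite_step ::
    "'a prop_data \<Rightarrow> ('a \<times> 'a) set \<Rightarrow> nat \<Rightarrow> nat \<Rightarrow> 'a \<Rightarrow> 'a \<Rightarrow> bool" where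
  "rewrite_step X \<R> n m d e \<longleftrightarrow>
     (\<exists>l r i j k c\<^sub>1 c\<^sub>2. (l, r) \<in> \<R> \<and> l \<in> Hom X i j \<and> r \<in> Hom X i j \<and>
        c\<^sub>1 \<in> Hom X n (k + i) \<and> c\<^sub>2 \<in> Hom X (k + j) m \<and>
        d = c\<^sub>1 \<Zcomp>\<^bsub>X\<^esub> (Idn X k \<oplus>\<^bsub>X\<^esub> l) \<Zcomp>\<^bsub>X\<^esub> c\<^sub>2 \<and>
        e = c\<^sub>1 \<Zcomp>\<^bsub>X\<^esub> (Idn X k \<oplus>\<^bsub>X\<^esub> r) \<Zcomp>\<^bsub>X\<^esub> c\<^sub>2)"


section \<open>Bending\<close>

fun cap :: "'g signature \<Rightarrow> nat \<Rightarrow> 'g sfrob_arrow" where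
  "cap S 0 = Idn (SFrob S) 0"
| "cap S (Suc 0) = frob_arrow S Eta \<Zcomp>\<^bsub>SFrob S\<^esub> frob_arrow S Delta"
| "cap S (Suc (Suc n)) =
     (cap S 1 \<oplus>\<^bsub>SFrob S\<^esub> cap S (Suc n)) \<Zcomp>\<^bsub>SFrob S\<^esub>
     (Idn (SFrob S) 1 \<oplus>\<^bsub>SFrob S\<^esub> Symm (SFrob S) 1 (Suc n) \<oplus>\<^bsub>SFrob S\<^esub> Idn (SFrob S) (Suc n))"

text \<open>\<open>bend S n d\<close> is the bending of an arrow \<open>d\<close> with domain \<open>n\<close>.\<close>

definition bend :: "'g signature \<Rightarrow> nat \<Rightarrow> 'g sfrob_arrow \<Rightarrow> 'g sfrob_arrow" where
  "bend S n d = cap S n \<Zcomp>\<^bsub>SFrob S\<^esub> (Idn (SFrob S) n \<oplus>\<^bsub>SFrob S\<^esub> d)"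

definition bend_system ::
    "'g signature \<Rightarrow> ('g sfrob_arrow \<times> 'g sfrob_arrow) set \<Rightarrow>
     ('g sfrob_arrow \<times> 'g sfrob_arrow) set" where
  "bend_system S \<R> = {(bend S i l, bend S i r) | l r i j.
     (l, r) \<in> \<R> \<and> l \<in> Hom (SFrob S) i j \<and> r \<in> Hom (SFrob S) i j}"


section \<open>Hypergraphs\<close>

text \<open>Nodes and hyperedges are drawn from \<open>nat\<close>. Hypergraphs being finite, every isomorphism class
  is represented, so this is a full subcategory equivalent to that of all finite hypergraphs.\<close>

record 'g hypergraph =
  nodes :: "nat set"
  edges :: "nat set"
  srcs :: "nat \<Rightarrow> nat list"
  tgts :: "nat \<Rightarrow> nat list"
  lab :: "nat \<Rightarrow> 'g"

definition hypergraph :: "'g signature \<Rightarrow> 'g hypergraph \<Rightarrow> bool" where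
  "hypergraph S G \<longleftrightarrow> finite (nodes G) \<and> finite (edges G) \<and>
     (\<forall>x \<in> edges G. set (srcs G x) \<subseteq> nodes G \<and> set (tgts G x) \<subseteq> nodes G \<and> lab G x \<in> gens S \<and>
        length (srcs G x) = ar S (lab G x) \<and> length (tgts G x) = coar S (lab G x))"

record mor =
  vmap :: "nat \<Rightarrow> nat"
  emap :: "nat \<Rightarrow> nat"

definition hom :: "'g signature \<Rightarrow> 'g hypergraph \<Rightarrow> 'g hypergraph \<Rightarrow> mor \<Rightarrow> bool" where
  "hom S G H f \<longleftrightarrow> hypergraph S G \<and> hypergraph S H \<and>
     vmap f ` nodes G \<subseteq> nodes H \<and> emap f ` edges G \<subseteq> edges H \<and>
     (\<forall>x \<in> edges G. srcs H (emap f x) = map (vmap f) (srcs G x) \<and>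
        tgts H (emap f x) = map (vmap f) (tgts G x) \<and> lab H (emap f x) = lab G x)"

text \<open>The maps in a \<open>mor\<close> are total functions; two of them are the same homomorphism out of \<open>G\<close> if
  they agree on the nodes and hyperedges of \<open>G\<close>.\<close>

definition mor_eq :: "'g hypergraph \<Rightarrow> mor \<Rightarrow> mor \<Rightarrow> bool" where
  "mor_eq G f g \<longleftrightarrow> (\<forall>v \<in> nodes G. vmap f v = vmap g v) \<and> (\<forall>x \<in> edges G. emap f x = emap g x)"

definition mor_id :: mor where
  "mor_id = \<lparr> vmap = id, emap = id \<rparr>"

definition mor_seq :: "mor \<Rightarrow> mor \<Rightarrow> mor"  (infixl "\<then>" 70) where
  "f \<then> g = \<lparr> vmap = vmap g \<circ> vmap f, emap = emap g \<circ> emap f \<rparr>"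

definition iso :: "'g signature \<Rightarrow> 'g hypergraph \<Rightarrow> 'g hypergraph \<Rightarrow> mor \<Rightarrow> bool" where
  "iso S G H f \<longleftrightarrow> hom S G H f \<and>
     (\<exists>g. hom S H G g \<and> mor_eq G (f \<then> g) mor_id \<and> mor_eq H (g \<then> f) mor_id)"

definition discrete :: "nat \<Rightarrow> 'g hypergraph" where
  "discrete n = \<lparr> nodes = {..<n}, edges = {}, srcs = (\<lambda>_. []), tgts = (\<lambda>_. []), lab = undefined \<rparr>"

text \<open>Equality of homomorphisms out of \<open>discrete n\<close>.\<close>

definition leg_eq :: "nat \<Rightarrow> mor \<Rightarrow> mor \<Rightarrow> bool" where
  "leg_eq n f g \<longleftrightarrow> (\<forall>i<n. vmap f i = vmap g i)"

definition node_mor :: "(nat \<Rightarrow> nat) \<Rightarrow> mor" where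
  "node_mor f = \<lparr> vmap = f, emap = id \<rparr>"

text \<open>\<open>pushout S A B C f g P h k\<close>: the square formed by \<open>f : A \<rightarrow> B\<close>, \<open>g : A \<rightarrow> C\<close>, \<open>h : B \<rightarrow> P\<close> and
  \<open>k : C \<rightarrow> P\<close> is a pushout.\<close>

definition pushout ::
    "'g signature \<Rightarrow> 'g hypergraph \<Rightarrow> 'g hypergraph \<Rightarrow> 'g hypergraph \<Rightarrow> mor \<Rightarrow> mor \<Rightarrow>
     'g hypergraph \<Rightarrow> mor \<Rightarrow> mor \<Rightarrow> bool" where
  "pushout S A B C f g P h k \<longleftrightarrow>
     hom S A B f \<and> hom S A C g \<and> hom S B P h \<and> hom S C P k \<and> mor_eq A (f \<then> h) (g \<then> k) \<and>
     (\<forall>Q u v. hom S B Q u \<and> hom S C Q v \<and> mor_eq A (f \<then> u) (g \<then> v) \<longrightarrow>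
        (\<exists>w. hom S P Q w \<and> mor_eq B (h \<then> w) u \<and> mor_eq C (k \<then> w) v \<and>
           (\<forall>w'. hom S P Q w' \<and> mor_eq B (h \<then> w') u \<and> mor_eq C (k \<then> w') v \<longrightarrow> mor_eq P w' w)))"

text \<open>\<open>G\<close> and \<open>H\<close> are included in \<open>P\<close> by \<open>h\<close> and \<open>k\<close> as complementary parts.\<close>

definition disjoint_union ::
    "'g signature \<Rightarrow> 'g hypergraph \<Rightarrow> 'g hypergraph \<Rightarrow> 'g hypergraph \<Rightarrow> mor \<Rightarrow> mor \<Rightarrow> bool" where
  "disjoint_union S G H P h k \<longleftrightarrow> hom S G P h \<and> hom S H P k \<and>
     inj_on (vmap h) (nodes G) \<and> inj_on (vmap k) (nodes H) \<and>
     vmap h ` nodes G \<inter> vmap k ` nodes H = {} \<and> vmap h ` nodes G \<union> vmap k ` nodes H = nodes P \<and>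
     inj_on (emap h) (edges G) \<and> inj_on (emap k) (edges H) \<and>
     emap h ` edges G \<inter> emap k ` edges H = {} \<and> emap h ` edges G \<union> emap k ` edges H = edges P"


section \<open>The PROP of cospans of hypergraphs\<close>

text \<open>\<open>Cospan n l G r m\<close> is \<open>n \<rightarrow> G \<leftarrow> m\<close> with legs \<open>l\<close> and \<open>r\<close>.\<close>

datatype 'g cospan = Cospan nat mor "'g hypergraph" mor nat

fun cospan_iso :: "'g signature \<Rightarrow> 'g cospan \<Rightarrow> 'g cospan \<Rightarrow> bool" where
  "cospan_iso S (Cospan n l G r m) (Cospan n' l' G' r' m') \<longleftrightarrow> n = n' \<and> m = m' \<and>
     hom S (discrete n) G l \<and> hom S (discrete m) G r \<and>
     hom S (discrete n) G' l' \<and> hom S (discrete m) G' r' \<and>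
     (\<exists>f. iso S G G' f \<and> leg_eq n (l \<then> f) l' \<and> leg_eq m (r \<then> f) r')"

definition cospan_class :: "'g signature \<Rightarrow> 'g cospan \<Rightarrow> 'g cospan set" where
  "cospan_class S c = {c'. cospan_iso S c c'}"

text \<open>The copairing of \<open>f : n \<rightarrow> P\<close> and \<open>g : n' \<rightarrow> P\<close>, a morphism \<open>n + n' \<rightarrow> P\<close>.\<close>

definition copair :: "nat \<Rightarrow> mor \<Rightarrow> mor \<Rightarrow> mor" where
  "copair n f g = node_mor (\<lambda>i. if i < n then vmap f i else vmap g (i - n))"

text \<open>Pushouts and disjoint unions are determined only up to isomorphism. The composite and the sum of
  two classes collect the cospans obtained from all representatives and from all such choices.\<close>

definition FTerm :: "'g signature \<Rightarrow> 'g cospan set prop_data" where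
  "FTerm S = \<lparr>
     Hom = (\<lambda>n m. {cospan_class S (Cospan n l G r m) | l G r.
              hom S (discrete n) G l \<and> hom S (discrete m) G r}),
     seq = (\<lambda>A B. \<Union>{cospan_class S (Cospan n (l \<then> h) P (r' \<then> k) m') | n l G r m l' G' r' m' P h k.
              Cospan n l G r m \<in> A \<and> Cospan m l' G' r' m' \<in> B \<and>
              pushout S (discrete m) G G' r l' P h k}),
     ten = (\<lambda>A B. \<Union>{cospan_class S
              (Cospan (n + n') (copair n (l \<then> h) (l' \<then> k)) P (copair m (r \<then> h) (r' \<then> k)) (m + m'))
              | n l G r m n' l' G' r' m' P h k.
              Cospan n l G r m \<in> A \<and> Cospan n' l' G' r' m' \<in> B \<and> disjoint_union S G G' P h k}),
     Idn = (\<lambda>n. cospan_class S (Cospan n mor_id (discrete n) mor_id n)),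
     Symm = (\<lambda>n m. cospan_class S (Cospan (n + m) mor_id (discrete (n + m))
              (copair m (node_mor (\<lambda>i. n + i)) mor_id) (m + n))) \<rparr>"


section \<open>The isomorphism from S + Frob to FTerm\<close>

definition gen_graph :: "'g signature \<Rightarrow> 'g \<Rightarrow> 'g hypergraph" where
  "gen_graph S g = \<lparr> nodes = {..<ar S g + coar S g}, edges = {0},
     srcs = (\<lambda>_. [0..<ar S g]), tgts = (\<lambda>_. [ar S g..<ar S g + coar S g]), lab = (\<lambda>_. g) \<rparr>"

definition gen_cospan :: "'g signature \<Rightarrow> 'g \<Rightarrow> 'g cospan" where
  "gen_cospan S g =
     Cospan (ar S g) mor_id (gen_graph S g) (node_mor (\<lambda>i. ar S g + i)) (coar S g)"

definition frob_cospan :: "frob \<Rightarrow> 'g cospan" where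
  "frob_cospan x = Cospan (ar frob_sig x) (node_mor (\<lambda>_. 0)) (discrete 1)
     (node_mor (\<lambda>_. 0)) (coar frob_sig x)"

text \<open>The PROP morphism with the given values on generators: since its domain is presented by
  generators and equations, it maps the class of a term to the value of that term in \<open>FTerm S\<close>.\<close>

definition Phi :: "'g signature \<Rightarrow> 'g sfrob_arrow \<Rightarrow> 'g cospan set" where
  "Phi S d = the_elem
     (eval (FTerm S) (\<lambda>x. cospan_class S (case_sum (gen_cospan S) frob_cospan x)) ` d)"


section \<open>Double-pushout rewriting\<close>

text \<open>\<open>DPO_Rule L a j b R\<close> is the span \<open>L \<leftarrow> j \<rightarrow> R\<close> with legs \<open>a\<close> and \<open>b\<close>.\<close>

datatype 'g dpo_rule = DPO_Rule "'g hypergraph" mor nat mor "'g hypergraph"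

text \<open>Pairs of arrows \<open>0 \<rightarrow> j\<close> of \<open>FTerm S\<close> as spans: every choice of representatives is a rule.\<close>

definition dpo_rules :: "('g cospan set \<times> 'g cospan set) set \<Rightarrow> 'g dpo_rule set" where
  "dpo_rules \<S> = {DPO_Rule L a j b R | L a j b R A B u v.
     (A, B) \<in> \<S> \<and> Cospan 0 u L a j \<in> A \<and> Cospan 0 v R b j \<in> B}"

definition dpo_step ::
    "'g signature \<Rightarrow> 'g dpo_rule set \<Rightarrow> 'g cospan set \<Rightarrow> 'g cospan set \<Rightarrow> bool" where
  "dpo_step S \<S> D E \<longleftrightarrow>
     (\<exists>u G p v H q m L a j b R C c s f g h k.
        Cospan 0 u G p m \<in> D \<and> Cospan 0 v H q m \<in> E \<and> DPO_Rule L a j b R \<in> \<S> \<and>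
        hom S (discrete j) C c \<and> hom S (discrete m) C s \<and>
        pushout S (discrete j) L C a c G f g \<and>
        pushout S (discrete j) R C b c H h k \<and>
        leg_eq m (s \<then> g) p \<and> leg_eq m (s \<then> k) q)"

end

(* For a hypergraph K, interpret an arrow n -> m as the matrix whose (a,b) entry, for a in K^n and b in
K^m, is the number of homomorphisms from its hypergraph to K that send the legs to a and b.
Composition becomes the matrix product and the monoidal product the Kronecker product, so that these
matrices can be computed on terms, and the laws of PROPs and of Frob hold in them. By Lovasz's theorem
the matrices for all K determine a cospan up to isomorphism; hence Phi d consists of exactly the
cospans with the matrices of d.

Conversely the matrices determine an arrow of S + Frob. Using cups, every arrow is bent to a state
0 -> m, and every state has a normal form: create the nodes, copy them to the ports of the hyperedges
and to the outputs, and plug the bent generators into the ports. Copying is governed by the maps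
dup x v : v -> 1 + v, which put a copy of wire x in front; they commute up to a symmetry, so that the
normal form depends only on the isomorphism class of the hypergraph.

Hence equations between arrows, in particular those of bending, can be checked on matrices. A rewriting
context (c1, c2) for d corresponds to an arrow c with bend d = bend l ; c, and since composition of
cospans is a pushout, to the pushout complement of a double-pushout step. *)
theory Submission
  imports Defs "HOL-Library.FuncSet" "HOL-Library.Multiset" "HOL-Combinatorics.Permutations"
begin

section \<open>Matrix semantics of terms\<close>

text \<open>Two facts carry the counting argument. A homomorphism from a pushout to \<open>K\<close>
  is a pair of homomorphisms that agree on the interface, so every choice of pushout yields the same
  matrix product, and no PROP law has to be checked on cospans. And the counts determine a cospan
  because every homomorphism is a surjection onto its image: induction on \<open>K\<close> extracts
  the numbers of surjections, and finite hypergraphs that map onto each other are isomorphic. The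
  obstacle is the way back, from equal matrices to an equation derivable from the presentation. The
  normal form serves this purpose: two states with equal matrices have isomorphic hypergraphs, and
  renaming nodes and reordering hyperedges do not change the arrow. For rewriting it matters that
  \<open>c\<close> is independent of the side of the rule: the two squares of a double-pushout step
  share one complement, so one \<open>c\<close> must serve \<open>l\<close> and \<open>r\<close>
  alike. The way back from \<open>c\<close> to a context takes \<open>k = n + i\<close>:
  \<open>n\<close> wires carry the input of \<open>d\<close> to the closing cups, and
  \<open>i\<close> wires carry a copy of the input of \<open>l\<close> to \<open>c\<close>.\<close>

definition vec :: "'g hypergraph \<Rightarrow> nat \<Rightarrow> nat list set" where
  "vec K n = {a. length a = n \<and> set a \<subseteq> nodes K}"

lemma vec_0 [simp]: "vec K 0 = {[]}"
  by (auto simp: vec_def)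

lemma vec_length: "a \<in> vec K n \<Longrightarrow> length a = n"
  by (simp add: vec_def)

lemma Cons_in_vec [simp]: "x # a \<in> vec K n \<longleftrightarrow> x \<in> nodes K \<and> (\<exists>k. n = Suc k \<and> a \<in> vec K k)"
  by (auto simp: vec_def)

lemma Nil_in_vec [simp]: "[] \<in> vec K n \<longleftrightarrow> n = 0"
  by (auto simp: vec_def)

lemma in_vec_Suc: "a \<in> vec K (Suc n) \<longleftrightarrow> (\<exists>x b. a = x # b \<and> x \<in> nodes K \<and> b \<in> vec K n)"
  by (cases a) auto

lemma append_in_vec [simp]: "length a = n \<Longrightarrow> a @ b \<in> vec K (n + m) \<longleftrightarrow> a \<in> vec K n \<and> b \<in> vec K m"
  by (auto simp: vec_def)

lemma in_vec_add: "a \<in> vec K (n + m) \<longleftrightarrow> (\<exists>b c. a = b @ c \<and> b \<in> vec K n \<and> c \<in> vec K m)"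
proof
  assume "a \<in> vec K (n + m)"
  then have "a = take n a @ drop n a" "take n a \<in> vec K n" "drop n a \<in> vec K m"
    by (auto simp: vec_def dest: in_set_takeD in_set_dropD)
  then show "\<exists>b c. a = b @ c \<and> b \<in> vec K n \<and> c \<in> vec K m" by blast
qed (auto simp: vec_def)

lemma finite_vec [simp]: "finite (nodes K) \<Longrightarrow> finite (vec K n)"
  using finite_lists_length_eq[of "nodes K" n] by (simp add: vec_def conj_commute)

lemma sum_vec_Suc:
  "(\<Sum>c\<in>vec K (Suc n). f c) = (\<Sum>x\<in>nodes K. \<Sum>c\<in>vec K n. f (x # c))"
proof -
  have "vec K (Suc n) = (\<lambda>(x, c). x # c) ` (nodes K \<times> vec K n)"
    by (auto simp: in_vec_Suc)
  then have "(\<Sum>c\<in>vec K (Suc n). f c) = (\<Sum>(x, c)\<in>nodes K \<times> vec K n. f (x # c))"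
    by (simp add: sum.reindex inj_on_def case_prod_unfold)
  then show ?thesis by (simp add: sum.cartesian_product)
qed

lemma sum_vec_add:
  "(\<Sum>c\<in>vec K (n + m). f c) = (\<Sum>a\<in>vec K n. \<Sum>b\<in>vec K m. f (a @ b))"
proof (induction n arbitrary: f)
  case (Suc n)
  then show ?case by (simp add: sum_vec_Suc)
qed simp

text \<open>Summation against a Kronecker delta in its four orientations. The factor
  \<open>of_bool (x \<in> A)\<close> stands in for a membership premise, so that finiteness is the
  only condition of these rewrite rules.\<close>

lemma sum_of_bool_eq_mult:
  fixes f :: "'a \<Rightarrow> nat"
  assumes "finite A"
  shows "(\<Sum>c\<in>A. of_bool (c = x) * f c) = of_bool (x \<in> A) * f x"
    and "(\<Sum>c\<in>A. f c * of_bool (c = x)) = of_bool (x \<in> A) * f x"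
    and "(\<Sum>c\<in>A. of_bool (x = c) * f c) = of_bool (x \<in> A) * f x"
    and "(\<Sum>c\<in>A. f c * of_bool (x = c)) = of_bool (x \<in> A) * f x"
  using assms by (simp_all add: of_bool_def if_distrib[of "\<lambda>x. x * _"] if_distrib[of "\<lambda>x. _ * x"]
    sum.delta sum.delta' cong: if_cong)

section \<open>Types and matrices of terms\<close>

primrec tdom :: "'g signature \<Rightarrow> 'g tm \<Rightarrow> nat" where
  "tdom S (Gen g) = ar S g"
| "tdom S (TId n) = n"
| "tdom S (TSym n m) = n + m"
| "tdom S (s ;; t) = tdom S s"
| "tdom S (s || t) = tdom S s + tdom S t"

primrec tcod :: "'g signature \<Rightarrow> 'g tm \<Rightarrow> nat" where
  "tcod S (Gen g) = coar S g"
| "tcod S (TId n) = n"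
| "tcod S (TSym n m) = m + n"
| "tcod S (s ;; t) = tcod S t"
| "tcod S (s || t) = tcod S s + tcod S t"

text \<open>Types are unique, so they can be computed by total functions; this allows the matrix of
  a term to be defined by recursion on the term alone.\<close>

lemma typed_tdom_tcod: "typed S t n m \<Longrightarrow> tdom S t = n \<and> tcod S t = m"
  by (induction rule: typed.induct) auto

abbreviation fsig :: "'g signature \<Rightarrow> ('g + frob) signature" where
  "fsig S \<equiv> sum_sig S frob_sig"

abbreviation feqs :: "(('g + frob) tm \<times> ('g + frob) tm) set" where
  "feqs \<equiv> sum_eqs {} frob_eqs"

lemma tm_eq_typed: "tm_eq S E n m s t \<Longrightarrow> typed S s n m \<and> typed S t n m"
proof (induction rule: tm_eq.induct)
  case (ten_assoc s n m t n' m' u n'' m'')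
  then show ?case using typed.intros by (metis add.assoc)
next
  case (ten_unit_left t n m)
  then show ?case using typed.intros by (metis add_0)
next
  case (ten_unit_right t n m)
  then show ?case using typed.intros by (metis add_0_right)
next
  case (sym_inverse n m)
  then show ?case using typed.intros by metis
next
  case (sym_unit n)
  then show ?case using typed.intros(2)[of S n] typed.intros(3)[of S n 0] by simp
next
  case (sym_hexagon n m k)
  have "typed S (TSym n m || TId k) (n + m + k) (m + n + k)" "typed S (TId m || TSym n k) (m + (n +
      k)) (m + (k + n))"
    by (intro typed.intros)+
  then show ?case using typed.intros(3)[of S n "m + k"] typed.intros(4) by (metis add.assoc)
qed (auto intro: typed.intros)

text \<open>A matrix index is a map from a discrete hypergraph to \<open>K\<close>, written as a
  list. The hypergraph of a Frobenius generator is a single node; its image \<open>z\<close> is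
  determined by the indices because each of these generators has at least one leg, so the count is 0
  or 1.\<close>

primrec wgt :: "'g signature \<Rightarrow> 'g hypergraph \<Rightarrow> ('g + frob) tm \<Rightarrow> nat list \<Rightarrow> nat list \<Rightarrow> nat" where
  "wgt S K (Gen x) a b = (case x of
      Inl g \<Rightarrow> card {y \<in> edges K. lab K y = g \<and> srcs K y = a \<and> tgts K y = b}
    | Inr f \<Rightarrow> of_bool (\<exists>z. a = replicate (ar frob_sig f) z \<and> b = replicate (coar frob_sig f) z))"
| "wgt S K (TId n) a b = of_bool (a = b)"
| "wgt S K (TSym n m) a b = of_bool (b = drop n a @ take n a)"
| "wgt S K (s ;; t) a b = (\<Sum>c\<in>vec K (tcod (fsig S) s). wgt S K s a c * wgt S K t c b)"
| "wgt S K (s || t) a b =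
     wgt S K s (take (tdom (fsig S) s) a) (take (tcod (fsig S) s) b) *
     wgt S K t (drop (tdom (fsig S) s) a) (drop (tcod (fsig S) s) b)"

lemma wgt_frob_gens:
  "wgt S K (Gen (Inr Mu)) [x, y] [z] = (if x = y then if z = y then 1 else 0 else 0)"
  "wgt S K (Gen (Inr Eta)) [] [z] = 1"
  "wgt S K (Gen (Inr Delta)) [z] [x, y] = (if x = z then if y = z then 1 else 0 else 0)"
  "wgt S K (Gen (Inr Eps)) [z] [] = 1"
  by (auto simp: frob_sig_def numeral_2_eq_2)

lemma if_nat_simps:
  "(if P then k else 0) * l = (if P then k * l else (0 :: nat))"
  "l * (if P then k else 0) = (if P then l * k else (0 :: nat))"
  "(if P \<and> Q then k else 0) = (if P then if Q then k else 0 else (0 :: nat))"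
  by auto

lemma sum_if_const: "(\<Sum>x\<in>A. if P then f x else 0) = (if P then sum f A else (0 :: nat))"
  by auto

lemma wgt_frob_eqs:
  assumes "(s, t) \<in> feqs" "typed (fsig S) s n m" "finite (nodes K)" "a \<in> vec K n" "b \<in> vec K m"
  shows "wgt S K s a b = wgt S K t a b"
proof -
  \<comment> \<open>Once the equation is fixed, \<open>tdom\<close> and \<open>tcod\<close> evaluate
    to numerals, and the vectors become explicit lists of nodes.\<close>
  have nm: "n = tdom (fsig S) s" "m = tcod (fsig S) s"
    using typed_tdom_tcod[OF assms(2)] by auto
  note dels = wgt.simps(1) sum_of_bool_eq sum_mult_of_bool_eq sum_of_bool_mult_eq
  show ?thesis
    using assms(1,3-5) unfolding nm
    by (simp add: sum_eqs_def frob_eqs_def del: wgt.simps(1), elim disjE conjE;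
        simp add: sum_sig_def frob_sig_def numeral_2_eq_2 numeral_3_eq_3 in_vec_Suc del: dels;
        elim exE conjE;
        simp add: sum_vec_Suc wgt_frob_gens of_bool_def del: dels;
        simp add: if_nat_simps sum_if_const sum.delta sum.delta' cong: if_cong;
        auto simp: if_nat_simps sum_if_const frob_sig_def numeral_2_eq_2 split: if_splits cong: if_cong)
qed

text \<open>Makes the matrix a function of the arrow instead of the term. Each law is a law of
  matrices; interchange, for instance, is the mixed-product rule of Kronecker products.\<close>

theorem wgt_sound:
  assumes "tm_eq (fsig S) feqs n m s t" "finite (nodes K)" "a \<in> vec K n" "b \<in> vec K m"
  shows "wgt S K s a b = wgt S K t a b"
  using assms(1,3,4)
proof (induction arbitrary: a b rule: tm_eq.induct)
  case (axiom s t n m)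
  then show ?case using wgt_frob_eqs assms(2) by blast
next
  case (seq_cong n k s s' m t t')
  then have "tcod (fsig S) s = k" "tcod (fsig S) s' = k"
    using tm_eq_typed typed_tdom_tcod by metis+
  with seq_cong show ?case by simp
next
  case (ten_cong n m s s' n' m' t t')
  then have "tdom (fsig S) s = n" "tdom (fsig S) s' = n" "tcod (fsig S) s = m" "tcod (fsig S) s' = m"
    using tm_eq_typed typed_tdom_tcod by metis+
  with ten_cong show ?case by (auto simp: in_vec_add vec_length)
next
  case (seq_assoc s n k t l u m)
  have [simp]: "tcod (fsig S) s = k" "tcod (fsig S) t = l"
    using seq_assoc typed_tdom_tcod by metis+
  show ?case
    by (simp add: sum_distrib_left sum_distrib_right mult.assoc) (rule sum.swap)
next
  case (seq_id_left t n m)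
  with assms(2) show ?case by (simp add: sum_of_bool_eq_mult)
next
  case (seq_id_right t n m)
  then have "tcod (fsig S) t = m"
    using typed_tdom_tcod by metis
  with seq_id_right assms(2) show ?case by (simp add: sum_of_bool_eq_mult)
next
  case (ten_assoc s n m t n' m' u n'' m'')
  then have "tdom (fsig S) s = n" "tdom (fsig S) t = n'" "tcod (fsig S) s = m" "tcod (fsig S) t = m'"
    using typed_tdom_tcod by metis+
  with ten_assoc show ?case
    by (simp add: add.commute min.absorb1 take_drop)
next
  case (ten_unit_right t n m)
  then have "tdom (fsig S) t = n" "tcod (fsig S) t = m"
    using typed_tdom_tcod by metis+
  with ten_unit_right show ?case by (simp add: vec_length)
next
  case (interchange s n k t m s' n' k' t' m')
  then have "tdom (fsig S) s = n" "tdom (fsig S) s' = n'" "tcod (fsig S) s = k" "tcod (fsig S) s' = k'"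
     "tdom (fsig S) t = k" "tdom (fsig S) t' = k'" "tcod (fsig S) t = m" "tcod (fsig S) t' = m'"
    using typed_tdom_tcod by metis+
  with interchange show ?case
    by (auto simp: in_vec_add vec_length sum_vec_add sum_product intro!: sum.cong)
next
  case (ten_id n m)
  then show ?case by (auto simp: in_vec_add vec_length)
next
  case (sym_natural s n m t n' m')
  then have "tdom (fsig S) s = n" "tdom (fsig S) t = n'" "tcod (fsig S) s = m" "tcod (fsig S) t = m'"
    using typed_tdom_tcod by metis+
  note [simp] = this
  obtain x y where a: "a = x @ y" "x \<in> vec K n" "y \<in> vec K n'"
    using sym_natural by (auto simp: in_vec_add)
  obtain u v where b: "b = v @ u" "u \<in> vec K m" "v \<in> vec K m'"
    using sym_natural by (auto simp: in_vec_add)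
  \<comment> \<open>The symmetry admits exactly one intermediate vector,
    \<open>u @ v\<close>.\<close>
  have "(v @ u = drop m c @ take m c) = (c = u @ v)" if "c \<in> vec K (m + m')" for c
    using that b by (auto simp: in_vec_add vec_length)
  then have "wgt S K ((s || t) ;; TSym m m') a b =
    (\<Sum>c\<in>vec K (m + m'). wgt S K s x (take m c) * wgt S K t y (drop m c) * of_bool (c = u @ v))"
    using a b by (auto intro!: sum.cong simp: vec_length)
  also have "\<dots> = wgt S K s x u * wgt S K t y v"
    using assms(2) a b by (simp add: sum_of_bool_eq_mult vec_length)
  finally show ?case
    using assms(2) a b by (simp add: sum_of_bool_eq_mult vec_length mult.commute)
next
  case (sym_inverse n m)
  then show ?case using assms(2)
    by (auto simp: in_vec_add[of _ _ n m] vec_length sum_of_bool_eq_mult Int_insert_right)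
next
  case (sym_unit n)
  then show ?case by (auto simp: vec_length)
next
  case (sym_hexagon n m k)
  then obtain x y z where a: "a = x @ y @ z" "x \<in> vec K n" "y \<in> vec K m" "z \<in> vec K k"
    by (auto simp: in_vec_add)
  obtain u v w where b: "b = u @ v @ w" "u \<in> vec K m" "v \<in> vec K k" "w \<in> vec K n"
    using sym_hexagon by (auto simp: in_vec_add)
  show ?case
    using assms(2) a b
    by (simp add: sum_vec_add vec_length sum_of_bool_eq_mult of_bool_conj mult.assoc
        sum_distrib_left[symmetric])
qed auto

section \<open>Homomorphism counts of cospans\<close>

lemma mor_seq_simps [simp]: "vmap (f \<then> g) x = vmap g (vmap f x)" "emap (f \<then> g) x = emap g (emap f x)"
  by (simp_all add: mor_seq_def)

lemma mor_id_simps [simp]: "vmap mor_id x = x" "emap mor_id x = x"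
  by (simp_all add: mor_id_def)

lemma node_mor_simps [simp]: "vmap (node_mor f) = f"
  by (simp add: node_mor_def)

lemma discrete_simps [simp]: "nodes (discrete n) = {..<n}" "edges (discrete n) = {}"
  by (simp_all add: discrete_def)

lemma hypergraph_discrete [simp]: "hypergraph S (discrete n)"
  by (simp add: hypergraph_def)

lemma hom_discrete: "hom S (discrete n) G f \<longleftrightarrow> hypergraph S G \<and> (\<forall>i<n. vmap f i \<in> nodes G)"
  by (auto simp: hom_def)

lemma hom_seq [intro]: "hom S G H f \<Longrightarrow> hom S H K g \<Longrightarrow> hom S G K (f \<then> g)"
  unfolding hom_def by (auto simp: image_subset_iff)

lemma hom_id: "hypergraph S G \<Longrightarrow> hom S G G mor_id"
  by (auto simp: hom_def mor_id_def)

lemma hom_mor_eq: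
  assumes "hom S G H f" "mor_eq G f g"
  shows "hom S G H g"
proof -
  have "map (vmap g) xs = map (vmap f) xs" if "set xs \<subseteq> nodes G" for xs
    using that assms(2) by (auto simp: mor_eq_def)
  moreover have "vmap g ` nodes G = vmap f ` nodes G" "emap g ` edges G = emap f ` edges G"
    using assms(2) by (auto simp: mor_eq_def image_iff)
  ultimately show ?thesis
    using assms unfolding hom_def mor_eq_def hypergraph_def by auto
qed

text \<open>The maps of a \<open>mor\<close> are total, so one homomorphism has many
  representations. Restriction picks one of them, which makes homomorphism sets finite and their
  cardinalities meaningful.\<close>

definition restr :: "'g hypergraph \<Rightarrow> mor \<Rightarrow> mor" where
  "restr G f = \<lparr> vmap = restrict (vmap f) (nodes G), emap = restrict (emap f) (edges G) \<rparr>"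

definition ext_homs :: "'g signature \<Rightarrow> 'g hypergraph \<Rightarrow> 'g hypergraph \<Rightarrow> mor set" where
  "ext_homs S G H = {f. hom S G H f \<and> vmap f \<in> extensional (nodes G) \<and> emap f \<in> extensional (edges G)}"

lemma mor_eq_restr [simp]: "mor_eq G (restr G f) g \<longleftrightarrow> mor_eq G f g" "mor_eq G g (restr G f) \<longleftrightarrow> mor_eq
    G g f"
  by (auto simp: mor_eq_def restr_def)

lemma restr_simps [simp]: "x \<in> nodes G \<Longrightarrow> vmap (restr G f) x = vmap f x"
  "x \<in> edges G \<Longrightarrow> emap (restr G f) x = emap f x"
  by (auto simp: restr_def)

lemma mor_eq_refl [simp]: "mor_eq G f f"
  by (simp add: mor_eq_def)

lemma restr_ext_homs: "hom S G H f \<Longrightarrow> restr G f \<in> ext_homs S G H"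
  by (auto simp: ext_homs_def intro: hom_mor_eq) (auto simp: restr_def)

lemma ehomD: "f \<in> ext_homs S G H \<Longrightarrow> hom S G H f"
  by (simp add: ext_homs_def)

lemma ext_homs_eqI: "f \<in> ext_homs S G H \<Longrightarrow> g \<in> ext_homs S G H \<Longrightarrow> mor_eq G f g \<Longrightarrow> f = g"
  by (cases f; cases g) (auto simp: ext_homs_def mor_eq_def intro: extensionalityI)

lemma finite_ext_homs: "finite (ext_homs S G H)"
proof (cases "hypergraph S G \<and> hypergraph S H")
  case True
  then have "finite ((nodes G \<rightarrow>\<^sub>E nodes H) \<times> (edges G \<rightarrow>\<^sub>E edges H))"
    by (intro finite_cartesian_product finite_PiE) (auto simp: hypergraph_def)
  moreover have "(\<lambda>f. (vmap f, emap f)) ` ext_homs S G H \<subseteq> (nodes G \<rightarrow>\<^sub>E nodes H) \<times> (edges G \<rightarrow>\<^sub>E edges H)"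
    by (auto simp: ext_homs_def hom_def PiE_def)
  moreover have "inj_on (\<lambda>f. (vmap f, emap f)) (ext_homs S G H)"
    by (rule inj_onI) (metis (full_types) mor.equality prod.inject unit.exhaust)
  ultimately show ?thesis
    by (meson finite_subset inj_on_finite)
next
  case False
  then have "ext_homs S G H = {}" by (auto simp: ext_homs_def hom_def)
  then show ?thesis by simp
qed

abbreviation leg :: "mor \<Rightarrow> mor \<Rightarrow> nat \<Rightarrow> nat list" where
  "leg l f n \<equiv> map (vmap (l \<then> f)) [0..<n]"

fun homs :: "'g signature \<Rightarrow> 'g hypergraph \<Rightarrow> 'g cospan \<Rightarrow> nat list \<Rightarrow> nat list \<Rightarrow> mor set" where
  "homs S K (Cospan n l G r m) a b = {f \<in> ext_homs S G K. leg l f n = a \<and> leg r f m = b}"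

definition is_cospan :: "'g signature \<Rightarrow> nat \<Rightarrow> nat \<Rightarrow> 'g cospan \<Rightarrow> bool" where
  "is_cospan S n m c \<longleftrightarrow> (\<exists>l G r. c = Cospan n l G r m \<and> hom S (discrete n) G l \<and> hom S (discrete m) G r)"

lemma finite_homs [simp]: "finite (homs S K c a b)"
  by (cases c) (simp add: finite_ext_homs)

lemma leg_in_vec:
  assumes "hom S (discrete n) G l" "hom S G K f"
  shows "leg l f n \<in> vec K n"
  using assms unfolding vec_def hom_discrete by (auto simp: hom_def)

lemma leg_restr:
  assumes "hom S (discrete n) G l"
  shows "leg l (restr G f) n = leg l f n"
  using assms by (auto simp: hom_discrete)

subsection \<open>Homomorphism counts determine a cospan\<close>

definition surj_homs :: "'g signature \<Rightarrow> 'g hypergraph \<Rightarrow> 'g cospan \<Rightarrow> nat list \<Rightarrow> nat list \<Rightarrow> mor set" where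
  "surj_homs S K c a b = {f \<in> homs S K c a b. case c of Cospan n l G r m \<Rightarrow>
      vmap f ` nodes G = nodes K \<and> emap f ` edges G = edges K}"

abbreviation subgraph :: "'g hypergraph \<Rightarrow> nat set \<Rightarrow> nat set \<Rightarrow> 'g hypergraph" where
  "subgraph K V E \<equiv> K \<lparr> nodes := V, edges := E \<rparr>"

text \<open>A homomorphism is a surjection onto its image, so by induction on \<open>K\<close> the numbers of all
  homomorphisms determine the numbers of the surjective ones.\<close>

lemma homs_decomp:
  assumes "hypergraph S K"
  shows "homs S K c a b = (\<Union>(V, E)\<in>Pow (nodes K) \<times> Pow (edges K). surj_homs S (subgraph K V E) c a b)"
proof (cases c)
  case (Cospan n l G r m)
  have "f \<in> ext_homs S G (subgraph K (vmap f ` nodes G) (emap f ` edges G))" if "f \<in> ext_homs S G K"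
      for f
  proof -
    have f: "hom S G K f" using that by (simp add: ext_homs_def)
    then have "set (srcs G x) \<subseteq> nodes G" "set (tgts G x) \<subseteq> nodes G" if "x \<in> edges G" for x
      using that by (auto simp: hom_def hypergraph_def)
    then have "hypergraph S (subgraph K (vmap f ` nodes G) (emap f ` edges G))"
      using f unfolding hom_def hypergraph_def by (auto intro!: imageI)
    then show ?thesis using that unfolding ext_homs_def hom_def by auto
  qed
  moreover have "f \<in> ext_homs S G K" if "V \<subseteq> nodes K" "E \<subseteq> edges K" "f \<in> ext_homs S G (subgraph K V
      E)" for f V E
    using that assms unfolding ext_homs_def hom_def by fastforce
  moreover have "vmap f ` nodes G \<subseteq> nodes K" "emap f ` edges G \<subseteq> edges K" if "f \<in> ext_homs S G K" for f
    using that unfolding ext_homs_def hom_def by auto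
  ultimately show ?thesis
    unfolding Cospan surj_homs_def by (auto simp: Bex_def)
qed

lemma card_homs_decomp:
  assumes "hypergraph S K"
  shows "card (homs S K c a b) = (\<Sum>(V, E)\<in>Pow (nodes K) \<times> Pow (edges K). card (surj_homs S (subgraph
      K V E) c a b))"
proof -
  have "finite (nodes K)" "finite (edges K)"
    using assms by (auto simp: hypergraph_def)
  \<comment> \<open>\<open>V\<close> and \<open>E\<close> are the images of the homomorphism, so the
    union is disjoint.\<close>
  moreover have "\<forall>x\<in>Pow (nodes K) \<times> Pow (edges K). \<forall>y\<in>Pow (nodes K) \<times> Pow (edges K). x \<noteq> y \<longrightarrow>
      (case x of (V, E) \<Rightarrow> surj_homs S (subgraph K V E) c a b) \<inter> (case y of (V, E) \<Rightarrow> surj_homs S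
          (subgraph K V E) c a b) = {}"
    by (cases c) (auto simp: surj_homs_def)
  ultimately show ?thesis
    unfolding homs_decomp[OF assms]
    by (subst card_UN_disjoint) (auto simp: surj_homs_def case_prod_unfold)
qed

text \<open>The summand of \<open>K\<close> itself is isolated in \<open>card_homs_decomp\<close>;
  all others concern properly smaller subgraphs. A subgraph that lacks an end of one of its
  hyperedges is no hypergraph and receives no homomorphism, so the induction may range over all
  \<open>K\<close>.\<close>

lemma card_surj_homs_eq:
  assumes "\<And>K. hypergraph S K \<Longrightarrow> card (homs S K c a b) = card (homs S K c' a b)"
  shows "card (surj_homs S K c a b) = card (surj_homs S K c' a b)"
proof (induction "card (nodes K) + card (edges K)" arbitrary: K rule: less_induct)
  case less
  show ?case
  proof (cases "hypergraph S K")
    case True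
    then have fin: "finite (nodes K)" "finite (edges K)" by (auto simp: hypergraph_def)
    let ?I = "Pow (nodes K) \<times> Pow (edges K) - {(nodes K, edges K)}"
    have split: "card (homs S K d a b) = card (surj_homs S K d a b) + (\<Sum>(V, E)\<in>?I. card (surj_homs S
        (subgraph K V E) d a b))"
      for d
      unfolding card_homs_decomp[OF True] using fin
      by (subst sum.remove[of _ "(nodes K, edges K)"]) auto
    have "card V + card E < card (nodes K) + card (edges K)" if "(V, E) \<in> ?I" for V E
    proof -
      have "V \<subset> nodes K \<and> E \<subseteq> edges K \<or> V \<subseteq> nodes K \<and> E \<subset> edges K" using that by auto
      then show ?thesis
        using fin by (meson add_le_less_mono add_less_le_mono card_mono psubset_card_mono)
    qed
    then have IH: "card (surj_homs S (subgraph K V E) c a b) = card (surj_homs S (subgraph K V E) c'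
        a b)" if "(V, E) \<in> ?I" for V E
      using less[of "subgraph K V E"] that by simp
    have "(\<Sum>(V, E)\<in>?I. card (surj_homs S (subgraph K V E) c a b)) = (\<Sum>(V, E)\<in>?I. card (surj_homs S
        (subgraph K V E) c' a b))"
    proof (rule sum.cong[OF HOL.refl])
      fix p assume p: "p \<in> ?I"
      obtain V E where "p = (V, E)" by (cases p)
      with IH[of V E] p show "(case p of (V, E) \<Rightarrow> card (surj_homs S (subgraph K V E) c a b)) =
          (case p of (V, E) \<Rightarrow> card (surj_homs S (subgraph K V E) c' a b))" by simp
    qed
    then show ?thesis using split[of c] split[of c'] assms[OF True] by simp
  next
    case False
    then have "surj_homs S K d a b = {}" for d
      by (cases d) (auto simp: surj_homs_def ext_homs_def hom_def)
    then show ?thesis by simp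
  qed
qed

text \<open>Test with \<open>K = G\<close> and with the legs of \<open>G\<close> as indices: the
  identity is a surjection on one side, so there must be one on the other.\<close>

lemma surj_hom_exists:
  assumes "is_cospan S n m (Cospan n l G r m)" "is_cospan S n m (Cospan n l' G' r' m)"
    and "\<And>K a b. hypergraph S K \<Longrightarrow> card (homs S K (Cospan n l G r m) a b) = card (homs S K (Cospan n
        l' G' r' m) a b)"
  obtains f where "hom S G' G f" "leg_eq n (l' \<then> f) l" "leg_eq m (r' \<then> f) r"
    "vmap f ` nodes G' = nodes G" "emap f ` edges G' = edges G"
proof -
  let ?a = "leg l mor_id n" and ?b = "leg r mor_id m"
  have G: "hom S (discrete n) G l" "hom S (discrete m) G r" "hypergraph S G"
    using assms(1) by (auto simp: is_cospan_def hom_def)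
  have "restr G mor_id \<in> surj_homs S G (Cospan n l G r m) ?a ?b"
    using G leg_restr[of S n G l mor_id] leg_restr[of S m G r mor_id]
    by (auto simp: surj_homs_def restr_ext_homs hom_id)
  moreover have "finite (surj_homs S G (Cospan n l G r m) ?a ?b)"
    by (rule finite_subset[OF _ finite_homs[of S G "Cospan n l G r m" ?a ?b]]) (auto simp: surj_homs_def)
  ultimately have "card (surj_homs S G (Cospan n l G r m) ?a ?b) > 0"
    using card_gt_0_iff by blast
  then have "card (surj_homs S G (Cospan n l' G' r' m) ?a ?b) > 0"
    using card_surj_homs_eq[of S "Cospan n l G r m" ?a ?b "Cospan n l' G' r' m" G, OF assms(3)] by simp
  then obtain f where "f \<in> surj_homs S G (Cospan n l' G' r' m) ?a ?b"
    by (metis card.empty ex_in_conv less_irrefl)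
  then show ?thesis
    by (intro that[of f]) (auto simp: surj_homs_def ext_homs_def leg_eq_def)
qed

lemma surj_image_card_inj:
  assumes "f ` A = B" "finite A" "card A \<le> card B"
  shows "inj_on f A"
  using assms by (metis card_image_le eq_card_imp_inj_on le_antisym)

text \<open>The inverse needs no condition of its own, since sources, targets and labels are
  functions of the hyperedge.\<close>

lemma bij_hom_iso:
  assumes f: "hom S G H f"
    and "inj_on (vmap f) (nodes G)" "inj_on (emap f) (edges G)"
    and sf: "vmap f ` nodes G = nodes H" "emap f ` edges G = edges H"
  shows "iso S G H f"
proof -
  let ?g = "\<lparr> vmap = the_inv_into (nodes G) (vmap f), emap = the_inv_into (edges G) (emap f) \<rparr>"
  have [simp]: "the_inv_into (nodes G) (vmap f) (vmap f x) = x" if "x \<in> nodes G" for x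
    using that assms by (simp add: the_inv_into_f_f)
  have [simp]: "the_inv_into (edges G) (emap f) (emap f x) = x" if "x \<in> edges G" for x
    using that assms by (simp add: the_inv_into_f_f)
  have [simp]: "map (the_inv_into (nodes G) (vmap f) \<circ> vmap f) xs = xs" if "set xs \<subseteq> nodes G" for xs
    using that by (auto intro!: map_idI)
  have "hom S H G ?g"
    using f unfolding hom_def hypergraph_def sf[symmetric] by auto
  moreover have "mor_eq G (f \<then> ?g) mor_id" "mor_eq H (?g \<then> f) mor_id"
    by (auto simp: mor_eq_def sf[symmetric])
  ultimately show ?thesis using f by (auto simp: iso_def)
qed

text \<open>Lovasz's theorem relative to the legs. Surjections in both directions between finite
  sets force equal cardinalities, so the surjection that respects the legs is bijective.\<close>

lemma cospan_iso_of_card_eq: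
  assumes "is_cospan S n m c" "is_cospan S n m c'"
    and "\<And>K a b. hypergraph S K \<Longrightarrow> card (homs S K c a b) = card (homs S K c' a b)"
  shows "cospan_iso S c c'"
proof -
  obtain l G r l' G' r' where c: "c = Cospan n l G r m" "c' = Cospan n l' G' r' m"
    using assms by (auto simp: is_cospan_def)
  obtain f where f: "hom S G' G f" "vmap f ` nodes G' = nodes G" "emap f ` edges G' = edges G"
    using surj_hom_exists[of S n m l G r l' G' r'] assms unfolding c by metis
  obtain g where g: "hom S G G' g" "leg_eq n (l \<then> g) l'" "leg_eq m (r \<then> g) r'"
    "vmap g ` nodes G = nodes G'" "emap g ` edges G = edges G'"
    using surj_hom_exists[of S n m l' G' r' l G r] assms unfolding c by metis
  have fin: "finite (nodes G)" "finite (edges G)" "finite (nodes G')" "finite (edges G')"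
    using f(1) by (auto simp: hom_def hypergraph_def)
  have "inj_on (vmap g) (nodes G)" "inj_on (emap g) (edges G)"
    using f g fin by (metis surj_image_card_inj card_image_le)+
  then have "iso S G G' g" using g by (intro bij_hom_iso)
  then show ?thesis using assms(1,2) g unfolding c by (auto simp: is_cospan_def)
qed

text \<open>Precomposition with an isomorphism is injective. Applied to the inverse as well, this
  yields the equality in \<open>card_homs_iso\<close>.\<close>

lemma card_homs_le_of_iso:
  assumes "is_cospan S n m (Cospan n l G r m)" "iso S G G' f" "leg_eq n (l \<then> f) l'" "leg_eq m (r \<then> f) r'"
  shows "card (homs S K (Cospan n l' G' r' m) a b) \<le> card (homs S K (Cospan n l G r m) a b)"
proof (rule card_inj_on_le)
  obtain g where g: "hom S G' G g" "mor_eq G' (g \<then> f) mor_id"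
    using assms(2) by (auto simp: iso_def)
  have f: "hom S G G' f" using assms(2) by (simp add: iso_def)
  show "inj_on (\<lambda>w. restr G (f \<then> w)) (homs S K (Cospan n l' G' r' m) a b)"
  proof (rule inj_onI)
    fix u v
    assume u: "u \<in> homs S K (Cospan n l' G' r' m) a b" and v: "v \<in> homs S K (Cospan n l' G' r' m) a b"
      and eq: "restr G (f \<then> u) = restr G (f \<then> v)"
    from eq have "mor_eq G (f \<then> u) (f \<then> v)"
      by (metis mor_eq_refl mor_eq_restr)
    then have "mor_eq G' u v"
      using g unfolding mor_eq_def hom_def by (auto simp: image_subset_iff) metis+
    then show "u = v" using u v by (auto intro: ext_homs_eqI)
  qed
  show "(\<lambda>w. restr G (f \<then> w)) ` homs S K (Cospan n l' G' r' m) a b \<subseteq> homs S K (Cospan n l G r m) a b"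
    using assms f by (auto simp: is_cospan_def leg_restr leg_eq_def intro!: restr_ext_homs dest: ehomD)
qed (rule finite_homs)

lemma card_homs_iso:
  assumes "cospan_iso S c c'"
  shows "card (homs S K c a b) = card (homs S K c' a b)"
proof -
  obtain n l G r m l' G' r' f where c: "c = Cospan n l G r m" "c' = Cospan n l' G' r' m"
    and v: "is_cospan S n m c" "is_cospan S n m c'"
    and f: "iso S G G' f" "leg_eq n (l \<then> f) l'" "leg_eq m (r \<then> f) r'"
    using assms by (cases c; cases c') (auto simp: is_cospan_def)
  obtain g where g: "hom S G' G g" "mor_eq G' (g \<then> f) mor_id" "mor_eq G (f \<then> g) mor_id"
    using f(1) by (auto simp: iso_def)
  have "iso S G' G g" using g f(1) by (auto simp: iso_def)
  moreover have "leg_eq n (l' \<then> g) l" "leg_eq m (r' \<then> g) r"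
    using v f g by (simp_all add: c is_cospan_def leg_eq_def mor_eq_def hom_discrete) metis+
  ultimately show ?thesis
    using card_homs_le_of_iso[of S n m l G r G' f l' r' K a b] card_homs_le_of_iso[of S n m l' G' r'
        G g l r K a b] v f
    unfolding c by (intro le_antisym) auto
qed

text \<open>By \<open>cospan_class_Sem\<close> this set is either empty or one isomorphism class,
  and it serves as a description of an arrow of \<open>FTerm\<close> free of representatives. Only
  indices in \<open>vec\<close> are compared; for all others the counts vanish by
  \<open>homs_empty\<close>.\<close>

definition Sem :: "'g signature \<Rightarrow> nat \<Rightarrow> nat \<Rightarrow> ('g hypergraph \<Rightarrow> nat list \<Rightarrow> nat list \<Rightarrow> nat) \<Rightarrow> 'g
    cospan set" where
  "Sem S n m F = {c. is_cospan S n m c \<and> (\<forall>K. hypergraph S K \<longrightarrow>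
     (\<forall>a\<in>vec K n. \<forall>b\<in>vec K m. card (homs S K c a b) = F K a b))}"

lemma homs_empty:
  assumes "is_cospan S n m c" "a \<notin> vec K n \<or> b \<notin> vec K m"
  shows "homs S K c a b = {}"
proof -
  obtain l G r where c: "c = Cospan n l G r m" "hom S (discrete n) G l" "hom S (discrete m) G r"
    using assms by (auto simp: is_cospan_def)
  then show ?thesis
    using leg_in_vec[OF c(2)] leg_in_vec[OF c(3)] assms(2) by (auto dest: ehomD)
qed

text \<open>One inclusion is the invariance of counts under isomorphism, the other is Lovasz's
  theorem.\<close>

theorem cospan_class_Sem:
  assumes "c \<in> Sem S n m F"
  shows "cospan_class S c = Sem S n m F"
proof (intro set_eqI iffI)
  fix c' assume "c' \<in> cospan_class S c"
  then have i: "cospan_iso S c c'" by (simp add: cospan_class_def)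
  then have "is_cospan S n m c'" using assms by (cases c; cases c') (auto simp: Sem_def is_cospan_def)
  then show "c' \<in> Sem S n m F" using assms card_homs_iso[OF i] by (auto simp: Sem_def)
next
  fix c' assume c': "c' \<in> Sem S n m F"
  have "card (homs S K c a b) = card (homs S K c' a b)" if "hypergraph S K" for K a b
  proof (cases "a \<in> vec K n \<and> b \<in> vec K m")
    case True
    then show ?thesis using assms c' that by (auto simp: Sem_def)
  next
    case False
    then show ?thesis using assms c' homs_empty[of S n m _ a K b] by (auto simp: Sem_def)
  qed
  then show "c' \<in> cospan_class S c"
    using assms c' cospan_iso_of_card_eq[of S n m c c'] by (auto simp: Sem_def cospan_class_def)
qed

subsection \<open>Pushouts and disjoint unions\<close>

definition compatible_pairs ::
    "'g signature \<Rightarrow> 'g hypergraph \<Rightarrow> 'g hypergraph \<Rightarrow> 'g hypergraph \<Rightarrow> mor \<Rightarrow> mor \<Rightarrow>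
     'g hypergraph \<Rightarrow> (mor \<times> mor) set" where
  "compatible_pairs S A B C f g K = {(u, v). u \<in> ext_homs S B K \<and> v \<in> ext_homs S C K \<and> mor_eq A (f \<then>
      u) (g \<then> v)}"

lemma mor_eq_seq_restr [simp]:
  assumes "hom S A B f"
  shows "mor_eq A (f \<then> restr B u) v \<longleftrightarrow> mor_eq A (f \<then> u) v" "mor_eq A v (f \<then> restr B u) \<longleftrightarrow> mor_eq A v
      (f \<then> u)"
  using assms by (auto simp: mor_eq_def hom_def image_subset_iff)

lemma mor_eq_sym: "mor_eq G f g \<Longrightarrow> mor_eq G g f"
  by (simp add: mor_eq_def)

lemma mor_eq_trans: "mor_eq G f g \<Longrightarrow> mor_eq G g h \<Longrightarrow> mor_eq G f h"
  by (simp add: mor_eq_def)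

lemma mor_eq_seq_right: "mor_eq G f g \<Longrightarrow> mor_eq G (f \<then> h) (g \<then> h)"
  by (simp add: mor_eq_def)

lemma restr_eq_iff: "restr G f = restr G g \<longleftrightarrow> mor_eq G f g"
proof
  show "restr G f = restr G g \<Longrightarrow> mor_eq G f g"
    by (metis mor_eq_refl mor_eq_restr)
qed (auto simp: restr_def mor_eq_def restrict_def)

text \<open>The universal property tested against \<open>K\<close>. Passing to restrictions turns
  uniqueness up to \<open>mor_eq\<close> into equality, as counting requires.\<close>

lemma pushout_bij:
  assumes po: "pushout S A B C f g P h k"
  shows "bij_betw (\<lambda>w. (restr B (h \<then> w), restr C (k \<then> w))) (ext_homs S P K) (compatible_pairs S A B
      C f g K)"
proof -
  have hom: "hom S A B f" "hom S A C g" "hom S B P h" "hom S C P k" "mor_eq A (f \<then> h) (g \<then> k)"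
    using po by (auto simp: pushout_def)
  have univ: "\<exists>w. hom S P K w \<and> mor_eq B (h \<then> w) u \<and> mor_eq C (k \<then> w) v \<and>
      (\<forall>w'. hom S P K w' \<and> mor_eq B (h \<then> w') u \<and> mor_eq C (k \<then> w') v \<longrightarrow> mor_eq P w' w)"
    if "hom S B K u" "hom S C K v" "mor_eq A (f \<then> u) (g \<then> v)" for u v
    using po that by (auto simp: pushout_def)
  have comp: "mor_eq A (f \<then> (h \<then> w)) (g \<then> (k \<then> w))" for w
    using mor_eq_seq_right[OF hom(5), of w] by (simp add: mor_eq_def)
  show ?thesis
  proof (rule bij_betwI')
    fix w w' assume w: "w \<in> ext_homs S P K" "w' \<in> ext_homs S P K"
    show "((restr B (h \<then> w), restr C (k \<then> w)) = (restr B (h \<then> w'), restr C (k \<then> w'))) = (w = w')"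
    proof
      assume "(restr B (h \<then> w), restr C (k \<then> w)) = (restr B (h \<then> w'), restr C (k \<then> w'))"
      then have "mor_eq B (h \<then> w) (h \<then> w')" "mor_eq C (k \<then> w) (k \<then> w')"
        by (auto simp: restr_eq_iff)
      then have "mor_eq P w w'"
        using univ[of "h \<then> w'" "k \<then> w'"] hom w comp
        by (metis (no_types, lifting) ehomD hom_seq mor_eq_refl mor_eq_sym mor_eq_trans)
      then show "w = w'" using w by (rule_tac ext_homs_eqI)
    qed simp
  next
    fix w assume "w \<in> ext_homs S P K"
    then show "(restr B (h \<then> w), restr C (k \<then> w)) \<in> compatible_pairs S A B C f g K"
      using hom comp by (auto simp: compatible_pairs_def intro!: restr_ext_homs dest: ehomD)
  next
    fix uv assume uv: "uv \<in> compatible_pairs S A B C f g K"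
    then obtain u v where uv_eq: "uv = (u, v)" and u: "u \<in> ext_homs S B K" and v: "v \<in> ext_homs S C K"
      and m: "mor_eq A (f \<then> u) (g \<then> v)"
      by (auto simp: compatible_pairs_def)
    obtain w where w: "hom S P K w" "mor_eq B (h \<then> w) u" "mor_eq C (k \<then> w) v"
      using univ[OF ehomD[OF u] ehomD[OF v] m] by auto
    have "mor_eq B (h \<then> restr P w) u" "mor_eq C (k \<then> restr P w) v"
      using w hom by auto
    then have "u = restr B (h \<then> restr P w)" "v = restr C (k \<then> restr P w)"
      using u v w hom by (auto intro!: ext_homs_eqI restr_ext_homs intro: mor_eq_sym ehomD)
    then show "\<exists>w\<in>ext_homs S P K. uv = (restr B (h \<then> w), restr C (k \<then> w))"
      using uv_eq restr_ext_homs[OF w(1)] by blast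
  qed
qed

lemma leg_assoc: "leg (l \<then> h) w n = leg l (h \<then> w) n"
  by simp

lemma mor_eq_discrete: "mor_eq (discrete m) f g \<longleftrightarrow> map (vmap f) [0..<m] = map (vmap g) [0..<m]"
  by (auto simp: mor_eq_def)

lemma bij_betw_Collect:
  assumes "bij_betw f A B" "\<And>x. x \<in> A \<Longrightarrow> P x \<longleftrightarrow> Q (f x)"
  shows "bij_betw f {x \<in> A. P x} {y \<in> B. Q y}"
  using assms by (auto simp: bij_betw_def intro: inj_on_subset)

text \<open>Composition of cospans becomes the matrix product: compatible pairs are sorted by the
  image \<open>c\<close> of the interface, and the outer legs each concern one component of the
  pair.\<close>

lemma card_homs_pushout:
  assumes po: "pushout S (discrete m) G G' r l' P h k"
    and l: "hom S (discrete n) G l" and r': "hom S (discrete m') G' r'"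
    and K: "finite (nodes K)"
  shows "card (homs S K (Cospan n (l \<then> h) P (r' \<then> k) m') a b) =
    (\<Sum>c\<in>vec K m. card (homs S K (Cospan n l G r m) a c) * card (homs S K (Cospan m l' G' r' m') c b))"
proof -
  have r: "hom S (discrete m) G r" and l': "hom S (discrete m) G' l'"
    using po by (auto simp: pushout_def)
  let ?\<phi> = "\<lambda>w. (restr G (h \<then> w), restr G' (k \<then> w))"
  let ?A = "{w \<in> ext_homs S P K. leg (l \<then> h) w n = a \<and> leg (r' \<then> k) w m' = b}"
  let ?B = "{p \<in> compatible_pairs S (discrete m) G G' r l' K. leg l (fst p) n = a \<and> leg r' (snd p)
      m' = b}"
  let ?\<psi> = "\<lambda>(c, u, v). (u :: mor, v :: mor)"
  let ?C = "SIGMA c : vec K m. homs S K (Cospan n l G r m) a c \<times> homs S K (Cospan m l' G' r' m') c b"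
  note bij = pushout_bij[OF po, of K]
  have "bij_betw ?\<phi> ?A ?B"
    unfolding leg_assoc by (rule bij_betw_Collect[OF bij]) (simp only: fst_conv snd_conv
        leg_restr[OF l] leg_restr[OF r'])
  then have "card ?A = card ?B"
    by (rule bij_betw_same_card)
  \<comment> \<open>The image of the interface is determined by the pair, so recording it adds no
    new elements.\<close>
  also have "?B = ?\<psi> ` ?C"
  proof -
    have "(u, v) \<in> ?\<psi> ` ?C" if "(u, v) \<in> ?B" for u v
    proof -
      have "(leg r u m, u, v) \<in> ?C"
        using that leg_in_vec[OF r, of K u] by (auto simp: compatible_pairs_def mor_eq_discrete
            dest: ehomD)
      then show ?thesis by force
    qed
    then show ?thesis by (auto simp: compatible_pairs_def mor_eq_discrete)
  qed
  also have "card (?\<psi> ` ?C) = card ?C"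
    by (rule card_image) (auto simp: inj_on_def)
  also have "\<dots> = (\<Sum>c\<in>vec K m. card (homs S K (Cospan n l G r m) a c) * card (homs S K (Cospan m l'
      G' r' m') c b))"
    using K by (subst card_SigmaI) (auto simp: card_cartesian_product finite_ext_homs simp del:
        homs.simps)
  finally show ?thesis by (simp only: homs.simps)
qed

text \<open>A sum is a pushout over the empty interface, so \<open>pushout_bij\<close> serves for
  the monoidal product too.\<close>

lemma disjoint_union_pushout:
  assumes du: "disjoint_union S G H P h k"
  shows "pushout S (discrete 0) G H mor_id mor_id P h k"
proof -
  have hom: "hom S G P h" "hom S H P k" using du by (auto simp: disjoint_union_def)
  then have hyp: "hypergraph S G" "hypergraph S H" "hypergraph S P" by (auto simp: hom_def)
  show ?thesis
    unfolding pushout_def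
  proof (intro conjI allI impI hom)
    show "hom S (discrete 0) G mor_id" "hom S (discrete 0) H mor_id"
      using hyp by (auto simp: hom_discrete)
    show "mor_eq (discrete 0) (mor_id \<then> h) (mor_id \<then> k)"
      by (simp add: mor_eq_def)
    fix Q u v
    assume "hom S G Q u \<and> hom S H Q v \<and> mor_eq (discrete 0) (mor_id \<then> u) (mor_id \<then> v)"
    then have u: "hom S G Q u" and v: "hom S H Q v" by auto
    define w where "w = \<lparr> vmap = (\<lambda>x. if x \<in> vmap h ` nodes G then vmap u (the_inv_into (nodes G)
        (vmap h) x)
          else vmap v (the_inv_into (nodes H) (vmap k) x)),
        emap = (\<lambda>x. if x \<in> emap h ` edges G then emap u (the_inv_into (edges G) (emap h) x)
          else emap v (the_inv_into (edges H) (emap k) x)) \<rparr>"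
    have wv: "vmap w (vmap h x) = vmap u x" if "x \<in> nodes G" for x
      using du that by (auto simp: w_def disjoint_union_def the_inv_into_f_f)
    have wv': "vmap w (vmap k x) = vmap v x" if "x \<in> nodes H" for x
      using du that by (auto simp: w_def disjoint_union_def the_inv_into_f_f)
    have we: "emap w (emap h x) = emap u x" if "x \<in> edges G" for x
      using du that by (auto simp: w_def disjoint_union_def the_inv_into_f_f)
    have we': "emap w (emap k x) = emap v x" if "x \<in> edges H" for x
      using du that by (auto simp: w_def disjoint_union_def the_inv_into_f_f)
    have nP: "nodes P = vmap h ` nodes G \<union> vmap k ` nodes H" and eP: "edges P = emap h ` edges G \<union>
        emap k ` edges H"
      using du by (auto simp: disjoint_union_def)
    have wm: "map (vmap w \<circ> vmap h) xs = map (vmap u) xs" if "set xs \<subseteq> nodes G" for xs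
      using that wv by auto
    have wm': "map (vmap w \<circ> vmap k) xs = map (vmap v) xs" if "set xs \<subseteq> nodes H" for xs
      using that wv' by auto
    have "hom S P Q w"
      using u v hom wv wv' we we' wm wm' unfolding hom_def nP eP hypergraph_def
      by (auto simp: image_subset_iff)
    moreover have "mor_eq G (h \<then> w) u" "mor_eq H (k \<then> w) v"
      using wv wv' we we' by (auto simp: mor_eq_def)
    moreover have "mor_eq P w' w" if "mor_eq G (h \<then> w') u" "mor_eq H (k \<then> w') v" for w'
      using that wv wv' we we' unfolding mor_eq_def nP eP by auto
    ultimately show "\<exists>w. hom S P Q w \<and> mor_eq G (h \<then> w) u \<and> mor_eq H (k \<then> w) v \<and>
        (\<forall>w'. hom S P Q w' \<and> mor_eq G (h \<then> w') u \<and> mor_eq H (k \<then> w') v \<longrightarrow> mor_eq P w' w)"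
      by blast
  qed
qed

lemma leg_copair:
  "leg (copair n f g) w (n + m) = leg f w n @ leg g w m"
  by (rule nth_equalityI) (auto simp: copair_def nth_append)

text \<open>Over the empty interface every pair is compatible; the counts multiply as in a Kronecker
  product.\<close>

lemma card_homs_disjoint_union:
  assumes du: "disjoint_union S G G' P h k"
    and l: "hom S (discrete n) G l" "hom S (discrete m) G r"
    and l': "hom S (discrete n') G' l'" "hom S (discrete m') G' r'"
    and "length a = n" "length b = m"
  shows "card (homs S K (Cospan (n + n') (copair n (l \<then> h) (l' \<then> k)) P (copair m (r \<then> h) (r' \<then> k))
      (m + m'))
      (a @ a') (b @ b')) =
    card (homs S K (Cospan n l G r m) a b) * card (homs S K (Cospan n' l' G' r' m') a' b')"
proof -
  let ?\<phi> = "\<lambda>w. (restr G (h \<then> w), restr G' (k \<then> w))"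
  let ?A = "{w \<in> ext_homs S P K. leg (l \<then> h) w n = a \<and> leg (r \<then> h) w m = b \<and>
    leg (l' \<then> k) w n' = a' \<and> leg (r' \<then> k) w m' = b'}"
  let ?B = "{p \<in> ext_homs S G K \<times> ext_homs S G' K. leg l (fst p) n = a \<and> leg r (fst p) m = b \<and>
    leg l' (snd p) n' = a' \<and> leg r' (snd p) m' = b'}"
  note bij = pushout_bij[OF disjoint_union_pushout[OF du], of K]
  have A: "homs S K (Cospan (n + n') (copair n (l \<then> h) (l' \<then> k)) P (copair m (r \<then> h) (r' \<then> k)) (m + m'))
      (a @ a') (b @ b') = ?A"
    using assms(6,7) unfolding homs.simps leg_copair by auto
  have compatible_pairs: "compatible_pairs S (discrete 0) G G' mor_id mor_id K = ext_homs S G K \<times>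
      ext_homs S G' K"
    by (auto simp: compatible_pairs_def mor_eq_def)
  have "bij_betw ?\<phi> ?A ?B"
    unfolding leg_assoc
    by (rule bij_betw_Collect[OF bij[unfolded compatible_pairs]])
       (simp only: fst_conv snd_conv leg_restr[OF l(1)] leg_restr[OF l(2)] leg_restr[OF l'(1)]
           leg_restr[OF l'(2)])
  then have "card ?A = card ?B"
    by (rule bij_betw_same_card)
  also have "?B = homs S K (Cospan n l G r m) a b \<times> homs S K (Cospan n' l' G' r' m') a' b'"
    by auto
  finally show ?thesis unfolding A by (simp only: card_cartesian_product)
qed

text \<open>The disjoint union of two hypergraphs, on even and odd numbers, with its nodes replaced by
  representatives under \<open>\<rho>\<close>: a pushout if \<open>\<rho>\<close> selects representatives of the generated equivalence.\<close>

definition glue :: "(nat \<Rightarrow> nat) \<Rightarrow> 'g hypergraph \<Rightarrow> 'g hypergraph \<Rightarrow> 'g hypergraph" where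
  "glue \<rho> G H = \<lparr> nodes = \<rho> ` ((\<lambda>x. 2 * x) ` nodes G \<union> (\<lambda>x. 2 * x + 1) ` nodes H),
     edges = (\<lambda>x. 2 * x) ` edges G \<union> (\<lambda>x. 2 * x + 1) ` edges H,
     srcs = (\<lambda>x. if even x then map (\<lambda>y. \<rho> (2 * y)) (srcs G (x div 2)) else map (\<lambda>y. \<rho> (2 * y + 1))
         (srcs H (x div 2))),
     tgts = (\<lambda>x. if even x then map (\<lambda>y. \<rho> (2 * y)) (tgts G (x div 2)) else map (\<lambda>y. \<rho> (2 * y + 1))
         (tgts H (x div 2))),
     lab = (\<lambda>x. if even x then lab G (x div 2) else lab H (x div 2)) \<rparr>"

abbreviation glue_left :: "(nat \<Rightarrow> nat) \<Rightarrow> mor" where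
  "glue_left \<rho> \<equiv> \<lparr> vmap = (\<lambda>x. \<rho> (2 * x)), emap = (\<lambda>x. 2 * x) \<rparr>"

abbreviation glue_right :: "(nat \<Rightarrow> nat) \<Rightarrow> mor" where
  "glue_right \<rho> \<equiv> \<lparr> vmap = (\<lambda>x. \<rho> (2 * x + 1)), emap = (\<lambda>x. 2 * x + 1) \<rparr>"

lemma glue_hom:
  assumes "hypergraph S G" "hypergraph S H"
  shows "hypergraph S (glue \<rho> G H)" "hom S G (glue \<rho> G H) (glue_left \<rho>)" "hom S H (glue \<rho> G H)
      (glue_right \<rho>)"
proof -
  show *: "hypergraph S (glue \<rho> G H)"
    using assms unfolding hypergraph_def glue_def by (auto simp: subset_iff)
  show "hom S G (glue \<rho> G H) (glue_left \<rho>)" "hom S H (glue \<rho> G H) (glue_right \<rho>)"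
    using * assms unfolding hom_def by (auto simp: glue_def)
qed

lemma disjoint_union_exists:
  assumes "hypergraph S G" "hypergraph S H"
  shows "disjoint_union S G H (glue id G H) (glue_left id) (glue_right id)"
proof -
  have "2 * x \<noteq> Suc (2 * y)" for x y :: nat by presburger
  then show ?thesis
    using glue_hom[OF assms, of id] unfolding disjoint_union_def
    by (auto simp: inj_on_def glue_def)
qed

lemma pushout_exists:
  assumes f: "hom S (discrete m) G f" and g: "hom S (discrete m) H g"
  obtains P h k where "pushout S (discrete m) G H f g P h k"
proof -
  define R where "R = (\<Union>i<m. {(2 * vmap f i, 2 * vmap g i + 1), (2 * vmap g i + 1, 2 * vmap f i)})"
  define \<rho> where "\<rho> x = (SOME y. (x, y) \<in> R\<^sup>*)" for x
  have \<rho>: "(x, \<rho> x) \<in> R\<^sup>*" for x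
    unfolding \<rho>_def by (rule someI[of _ x]) simp
  have "sym R" by (auto simp: R_def sym_def)
  \<comment> \<open>As \<open>R\<close> is symmetric, its closure is an equivalence; related
    elements have the same class and hence the same chosen representative.\<close>
  then have "{y. (x, y) \<in> R\<^sup>*} = {z. (y, z) \<in> R\<^sup>*}" if "(x, y) \<in> R" for x y
    using that by (auto intro: converse_rtrancl_into_rtrancl dest: symD)
  then have \<rho>R: "\<rho> x = \<rho> y" if "(x, y) \<in> R" for x y
    using that unfolding \<rho>_def by (simp add: set_eq_iff)
  have hyp: "hypergraph S G" "hypergraph S H"
    using f g by (auto simp: hom_def)
  have "pushout S (discrete m) G H f g (glue \<rho> G H) (glue_left \<rho>) (glue_right \<rho>)"
    unfolding pushout_def
  proof (intro conjI allI impI f g glue_hom hyp)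
    show "mor_eq (discrete m) (f \<then> glue_left \<rho>) (g \<then> glue_right \<rho>)"
      using \<rho>R by (auto simp: mor_eq_def R_def)
    fix Q u v
    assume uv: "hom S G Q u \<and> hom S H Q v \<and> mor_eq (discrete m) (f \<then> u) (g \<then> v)"
    \<comment> \<open>The two given morphisms are combined on the tagged union. The combination is
      constant on the classes of \<open>R\<close>, so it takes the same value at an element and at
      its representative.\<close>
    define w where "w = \<lparr> vmap = (\<lambda>x. if even x then vmap u (x div 2) else vmap v (x div 2)),
      emap = (\<lambda>x. if even x then emap u (x div 2) else emap v (x div 2)) \<rparr>"
    have wR: "vmap w x = vmap w y" if "(x, y) \<in> R" for x y
      using that uv by (auto simp: R_def mor_eq_def w_def)
    have "vmap w x = vmap w y" if "(x, y) \<in> R\<^sup>*" for x y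
      using that by (induction rule: rtrancl_induct) (auto dest: wR)
    then have w\<rho>: "vmap w (\<rho> x) = vmap w x" for x using \<rho> by metis
    have w2: "vmap w (2 * x) = vmap u x" "vmap w (Suc (2 * x)) = vmap v x"
        "emap w (2 * x) = emap u x" "emap w (Suc (2 * x)) = emap v x" for x
      by (simp_all add: w_def)
    have "hom S (glue \<rho> G H) Q w"
      using uv glue_hom[OF hyp, of \<rho>] unfolding hom_def
      by (auto simp: glue_def w\<rho> w2)
    moreover have "mor_eq G (glue_left \<rho> \<then> w) u" "mor_eq H (glue_right \<rho> \<then> w) v"
      by (auto simp: mor_eq_def w\<rho> w2)
    moreover have "mor_eq (glue \<rho> G H) w' w" if "mor_eq G (glue_left \<rho> \<then> w') u" "mor_eq H
        (glue_right \<rho> \<then> w') v" for w'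
      using that unfolding mor_eq_def by (auto simp: glue_def w\<rho> w2)
    ultimately show "\<exists>w. hom S (glue \<rho> G H) Q w \<and> mor_eq G (glue_left \<rho> \<then> w) u \<and> mor_eq H
        (glue_right \<rho> \<then> w) v \<and>
        (\<forall>w'. hom S (glue \<rho> G H) Q w' \<and> mor_eq G (glue_left \<rho> \<then> w') u \<and> mor_eq H (glue_right \<rho> \<then> w') v \<longrightarrow>
           mor_eq (glue \<rho> G H) w' w)"
      by blast
  qed
  then show ?thesis by (rule that)
qed

section \<open>The matrices of the image of a term\<close>

text \<open>A homomorphism consists of the images \<phi> of the nodes and, independently for each
  hyperedge, an edge of \<open>K\<close> with the prescribed label and ends; hence a sum over \<phi>
  of products over the hyperedges.\<close>

lemma card_homs_standard:
  assumes G: "nodes G = {..<v}" "edges G = {..<q}"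
    and l: "hom S (discrete n) G l" and r: "hom S (discrete m) G r"
    and K: "hypergraph S K"
  shows "card (homs S K (Cospan n l G r m) a b) =
    (\<Sum>\<phi>\<in>vec K v. of_bool (map (\<lambda>i. \<phi> ! vmap l i) [0..<n] = a \<and> map (\<lambda>i. \<phi> ! vmap r i) [0..<m] = b) *
       (\<Prod>i<q. card {y \<in> edges K. lab K y = lab G i \<and> srcs K y = map ((!) \<phi>) (srcs G i) \<and>
         tgts K y = map ((!) \<phi>) (tgts G i)}))"
proof -
  let ?P = "\<lambda>\<phi>. map (\<lambda>i. \<phi> ! vmap l i) [0..<n] = a \<and> map (\<lambda>i. \<phi> ! vmap r i) [0..<m] = b"
  let ?E = "\<lambda>\<phi> i. {y \<in> edges K. lab K y = lab G i \<and> srcs K y = map ((!) \<phi>) (srcs G i) \<and>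
         tgts K y = map ((!) \<phi>) (tgts G i)}"
  let ?Q = "SIGMA \<phi> : {\<phi> \<in> vec K v. ?P \<phi>}. PiE {..<q} (?E \<phi>)"
  let ?f = "\<lambda>f. (map (vmap f) [0..<v], emap f)"
  let ?g = "\<lambda>(\<phi>, e). \<lparr> vmap = restrict ((!) \<phi>) {..<v}, emap = e \<rparr>"
  have hG: "hypergraph S G" using l by (simp add: hom_def)
  have K': "finite (nodes K)" "finite (edges K)" using K by (auto simp: hypergraph_def)
  have lv: "vmap l i < v" if "i < n" for i using that l G by (auto simp: hom_discrete)
  have rv: "vmap r i < v" if "i < m" for i using that r G by (auto simp: hom_discrete)
  have nth: "map ((!) (map (vmap f) [0..<v])) xs = map (vmap f) xs" if "set xs \<subseteq> {..<v}" for f xs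
    using that by auto
  have sv: "set (srcs G i) \<subseteq> {..<v}" "set (tgts G i) \<subseteq> {..<v}" if "i < q" for i
    using that hG G by (auto simp: hypergraph_def)
  have "bij_betw ?f (homs S K (Cospan n l G r m) a b) ?Q"
  proof (rule bij_betw_byWitness[where f' = ?g])
    show "\<forall>f\<in>homs S K (Cospan n l G r m) a b. ?g (?f f) = f"
      by (auto simp: ext_homs_def G extensional_def intro!: mor.equality)
    show "\<forall>p\<in>?Q. ?f (?g p) = p"
      by (auto simp: vec_def intro!: nth_equalityI)
    show "?f ` homs S K (Cospan n l G r m) a b \<subseteq> ?Q"
    proof (rule image_subsetI)
      fix f assume "f \<in> homs S K (Cospan n l G r m) a b"
      then have f: "hom S G K f" "emap f \<in> extensional {..<q}" "leg l f n = a" "leg r f m = b"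
        by (auto simp: ext_homs_def G)
      have "map (vmap f) [0..<v] \<in> vec K v"
        using f(1) by (auto simp: vec_def hom_def G)
      moreover have "?P (map (vmap f) [0..<v])"
        using f lv rv by auto
      moreover have "emap f \<in> PiE {..<q} (?E (map (vmap f) [0..<v]))"
        using f(1,2) by (auto simp: PiE_def hom_def G nth[OF sv(1)] nth[OF sv(2)] simp del: map_eq_conv)
      ultimately show "?f f \<in> ?Q" by simp
    qed
    show "?g ` ?Q \<subseteq> homs S K (Cospan n l G r m) a b"
    proof (rule image_subsetI)
      fix p assume "p \<in> ?Q"
      then obtain \<phi> e where p: "p = (\<phi>, e)" and \<phi>: "\<phi> \<in> vec K v" "?P \<phi>" and e: "e \<in> PiE {..<q} (?E \<phi>)"
        by auto
      have res: "map (restrict ((!) \<phi>) {..<v}) xs = map ((!) \<phi>) xs" if "set xs \<subseteq> {..<v}" for xs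
        using that by auto
      have "restrict ((!) \<phi>) {..<v} ` nodes G \<subseteq> nodes K"
        using \<phi>(1) by (auto simp: G vec_def)
      then have "hom S G K (?g p)"
        using hG K e unfolding hom_def p
        by (auto simp: G PiE_iff res[OF sv(1)] res[OF sv(2)] simp del: map_eq_conv)
      then show "?g p \<in> homs S K (Cospan n l G r m) a b"
        using \<phi>(2) e lv rv by (auto simp: p ext_homs_def G PiE_def)
    qed
  qed
  then have "card (homs S K (Cospan n l G r m) a b) = card ?Q"
    by (rule bij_betw_same_card)
  also have "\<dots> = (\<Sum>\<phi>\<in>{\<phi> \<in> vec K v. ?P \<phi>}. \<Prod>i<q. card (?E \<phi> i))"
    using K' by (subst card_SigmaI) (auto simp: card_PiE intro!: finite_PiE)
  also have "\<dots> = (\<Sum>\<phi>\<in>vec K v. of_bool (?P \<phi>) * (\<Prod>i<q. card (?E \<phi> i)))"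
    using K' by (intro sum.mono_neutral_cong_left) auto
  finally show ?thesis .
qed

lemma SemI:
  assumes "hom S (discrete n) G l" "hom S (discrete m) G r"
    and "\<And>K a b. hypergraph S K \<Longrightarrow> a \<in> vec K n \<Longrightarrow> b \<in> vec K m \<Longrightarrow>
      card (homs S K (Cospan n l G r m) a b) = F K a b"
  shows "Cospan n l G r m \<in> Sem S n m F"
  using assms by (auto simp: Sem_def is_cospan_def simp del: homs.simps)

section \<open>Matrices of identities, symmetries and generators\<close>

lemma Id_in_Sem: "Cospan n mor_id (discrete n) mor_id n \<in> Sem S n n (\<lambda>K. wgt S K (TId n))"
proof (rule SemI)
  fix K a b assume K: "hypergraph S K" "a \<in> vec K n" "b \<in> vec K n"
  then have "finite (nodes K)" by (simp add: hypergraph_def)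
  moreover have "map ((!) \<phi>) [0..<n] = \<phi>" if "\<phi> \<in> vec K n" for \<phi>
    using that map_nth[of \<phi>] by (simp add: vec_def)
  ultimately show "card (homs S K (Cospan n mor_id (discrete n) mor_id n) a b) = wgt S K (TId n) a b"
    using K by (subst card_homs_standard[of _ n 0])
      (auto simp: hom_discrete of_bool_conj sum_of_bool_eq_mult simp del: homs.simps sum_of_bool_eq
          sum_mult_of_bool_eq
         sum_of_bool_mult_eq cong: sum.cong)
qed (auto simp: hom_discrete)

lemma Sym_in_Sem:
  "Cospan (n + m) mor_id (discrete (n + m)) (copair m (node_mor (\<lambda>i. n + i)) mor_id) (m + n) \<in>
    Sem S (n + m) (m + n) (\<lambda>K. wgt S K (TSym n m))"
proof (rule SemI)
  show hom: "hom S (discrete (n + m)) (discrete (n + m)) mor_id"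
    "hom S (discrete (m + n)) (discrete (n + m)) (copair m (node_mor (\<lambda>i. n + i)) mor_id)"
    by (auto simp: hom_discrete copair_def)
  fix K a b assume K: "hypergraph S K" "a \<in> vec K (n + m)" "b \<in> vec K (m + n)"
  then have fin: "finite (nodes K)" by (simp add: hypergraph_def)
  have 1: "map ((!) \<phi>) [0..<n + m] = \<phi>" if "\<phi> \<in> vec K (n + m)" for \<phi>
    using that map_nth[of \<phi>] by (simp add: vec_def)
  have 2: "map (\<lambda>i. \<phi> ! vmap (copair m (node_mor (\<lambda>i. n + i)) mor_id) i) [0..<m + n] = drop n \<phi> @
      take n \<phi>"
    if "\<phi> \<in> vec K (n + m)" for \<phi>
    using that by (intro nth_equalityI) (auto simp: vec_def copair_def nth_append)
  have "card (homs S K (Cospan (n + m) mor_id (discrete (n + m))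
          (copair m (node_mor (\<lambda>i. n + i)) mor_id) (m + n)) a b) =
        (\<Sum>\<phi>\<in>vec K (n + m). of_bool (\<phi> = a) * of_bool (b = drop n \<phi> @ take n \<phi>))"
    using K hom 1 2 by (subst card_homs_standard[of _ "n + m" 0])
      (auto simp: of_bool_conj simp del: homs.simps intro!: sum.cong)
  then show "card (homs S K (Cospan (n + m) mor_id (discrete (n + m))
          (copair m (node_mor (\<lambda>i. n + i)) mor_id) (m + n)) a b) = wgt S K (TSym n m) a b"
    using K fin by (simp add: sum_of_bool_eq_mult del: homs.simps)
qed

lemma gen_in_Sem:
  assumes "g \<in> gens S"
  shows "gen_cospan S g \<in> Sem S (ar S g) (coar S g) (\<lambda>K. wgt S K (Gen (Inl g)))"
  unfolding gen_cospan_def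
proof (rule SemI)
  have "hypergraph S (gen_graph S g)"
    using assms by (auto simp: hypergraph_def gen_graph_def)
  then show hom: "hom S (discrete (ar S g)) (gen_graph S g) mor_id"
    "hom S (discrete (coar S g)) (gen_graph S g) (node_mor (\<lambda>i. ar S g + i))"
    by (auto simp: hom_discrete gen_graph_def)
  fix K a b assume K: "hypergraph S K" "a \<in> vec K (ar S g)" "b \<in> vec K (coar S g)"
  then have fin: "finite (nodes K)" by (simp add: hypergraph_def)
  have 1: "map ((!) \<phi>) [0..<ar S g] = take (ar S g) \<phi>"
    "map ((!) \<phi>) [ar S g..<ar S g + coar S g] = drop (ar S g) \<phi>"
    "map (\<lambda>i. \<phi> ! (ar S g + i)) [0..<coar S g] = drop (ar S g) \<phi>"
    if "\<phi> \<in> vec K (ar S g + coar S g)" for \<phi>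
    using that by (auto simp: vec_def intro!: nth_equalityI)
  have "card (homs S K (Cospan (ar S g) mor_id (gen_graph S g) (node_mor (\<lambda>i. ar S g + i)) (coar S
      g)) a b) =
      (\<Sum>\<phi>\<in>vec K (ar S g + coar S g). of_bool (\<phi> = a @ b) * card {y \<in> edges K. lab K y = g \<and> srcs K y
          = a \<and> tgts K y = b})"
    using K hom 1 by (subst card_homs_standard[of _ "ar S g + coar S g" 1])
      (auto simp: gen_graph_def in_vec_add vec_length simp del: homs.simps intro!: sum.cong)
  then show "card (homs S K (Cospan (ar S g) mor_id (gen_graph S g) (node_mor (\<lambda>i. ar S g + i))
      (coar S g)) a b) =
      wgt S K (Gen (Inl g)) a b"
    using K fin by (simp add: sum_of_bool_eq_mult vec_length del: homs.simps)
qed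

lemma frob_in_Sem:
  "frob_cospan x \<in> Sem S (ar frob_sig x) (coar frob_sig x) (\<lambda>K. wgt S K (Gen (Inr x)))"
  unfolding frob_cospan_def
proof (rule SemI)
  let ?n = "ar frob_sig x" and ?m = "coar frob_sig x"
  show hom: "hom S (discrete ?n) (discrete 1) (node_mor (\<lambda>_. 0))"
    "hom S (discrete ?m) (discrete 1) (node_mor (\<lambda>_. 0))"
    by (auto simp: hom_discrete)
  fix K a b assume K: "hypergraph S K" "a \<in> vec K ?n" "b \<in> vec K ?m"
  then have fin: "finite (nodes K)" by (simp add: hypergraph_def)
  \<comment> \<open>Some leg is present, so the image of the single node can be read off from the
    indices and at most one \<open>z\<close> contributes.\<close>
  have pos: "?n \<noteq> 0 \<or> ?m \<noteq> 0" by (cases x) (auto simp: frob_sig_def)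
  have "card (homs S K (Cospan ?n (node_mor (\<lambda>_. 0)) (discrete 1) (node_mor (\<lambda>_. 0)) ?m) a b) =
      (\<Sum>z\<in>nodes K. of_bool (a = replicate ?n z \<and> b = replicate ?m z))"
    using K hom by (subst card_homs_standard[of _ "Suc 0" 0])
      (auto simp: sum_vec_Suc map_replicate_const simp del: homs.simps sum_of_bool_eq intro!: sum.cong)
  also have "\<dots> = of_bool (\<exists>z. a = replicate ?n z \<and> b = replicate ?m z)"
  proof (cases "\<exists>z. a = replicate ?n z \<and> b = replicate ?m z")
    case True
    then obtain z where z: "a = replicate ?n z" "b = replicate ?m z" by blast
    then have "z \<in> nodes K" using K pos by (auto simp: vec_def)
    moreover have "a = replicate ?n y \<and> b = replicate ?m y \<longleftrightarrow> y = z" for y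
      using z pos by (auto simp: replicate_eq_replicate)
    ultimately show ?thesis using True fin by simp
  qed (auto intro!: sum.neutral simp del: sum_of_bool_eq)
  finally show "card (homs S K (Cospan ?n (node_mor (\<lambda>_. 0)) (discrete 1) (node_mor (\<lambda>_. 0)) ?m) a b) =
      wgt S K (Gen (Inr x)) a b"
    by simp
qed

section \<open>Matrices of composites and sums, and the values of Phi\<close>

lemma seq_in_Sem:
  assumes "Cospan n l G r k \<in> Sem S n k (\<lambda>K. wgt S K s)" "Cospan k l' G' r' m \<in> Sem S k m (\<lambda>K. wgt S
      K t)"
    and po: "pushout S (discrete k) G G' r l' P h i" and k: "tcod (fsig S) s = k"
  shows "Cospan n (l \<then> h) P (r' \<then> i) m \<in> Sem S n m (\<lambda>K. wgt S K (s ;; t))"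
proof (rule SemI)
  have hom: "hom S (discrete n) G l" "hom S (discrete m) G' r'" "hom S G P h" "hom S G' P i"
    using assms(1,2) po by (auto simp: Sem_def is_cospan_def pushout_def)
  then show "hom S (discrete n) P (l \<then> h)" "hom S (discrete m) P (r' \<then> i)" by blast+
  fix K a b assume K: "hypergraph S K" "a \<in> vec K n" "b \<in> vec K m"
  then have fin: "finite (nodes K)" by (simp add: hypergraph_def)
  show "card (homs S K (Cospan n (l \<then> h) P (r' \<then> i) m) a b) = wgt S K (s ;; t) a b"
    unfolding card_homs_pushout[OF po hom(1,2) fin] wgt.simps k
    using assms(1,2) K by (intro sum.cong) (auto simp: Sem_def simp del: homs.simps)
qed

lemma ten_in_Sem:
  assumes "Cospan n l G r m \<in> Sem S n m (\<lambda>K. wgt S K s)" "Cospan n' l' G' r' m' \<in> Sem S n' m' (\<lambda>K.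
      wgt S K t)"
    and du: "disjoint_union S G G' P h k" and s: "tdom (fsig S) s = n" "tcod (fsig S) s = m"
  shows "Cospan (n + n') (copair n (l \<then> h) (l' \<then> k)) P (copair m (r \<then> h) (r' \<then> k)) (m + m')
    \<in> Sem S (n + n') (m + m') (\<lambda>K. wgt S K (s || t))"
proof (rule SemI)
  have hom: "hom S (discrete n) G l" "hom S (discrete m) G r" "hom S (discrete n') G' l'"
      "hom S (discrete m') G' r'" "hom S G P h" "hom S G' P k"
    using assms(1,2) du by (auto simp: Sem_def is_cospan_def disjoint_union_def)
  have "hom S (discrete n) P (l \<then> h)" "hom S (discrete m) P (r \<then> h)"
     "hom S (discrete n') P (l' \<then> k)" "hom S (discrete m') P (r' \<then> k)"
    using hom by blast+
  then show "hom S (discrete (n + n')) P (copair n (l \<then> h) (l' \<then> k))"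
    "hom S (discrete (m + m')) P (copair m (r \<then> h) (r' \<then> k))"
    by (auto simp: hom_discrete copair_def)
  fix K a b assume K: "hypergraph S K" "a \<in> vec K (n + n')" "b \<in> vec K (m + m')"
  then obtain c c' d d' where "a = c @ c'" "b = d @ d'" "c \<in> vec K n" "c' \<in> vec K n'" "d \<in> vec K m"
      "d' \<in> vec K m'"
    by (auto simp: in_vec_add)
  then show "card (homs S K (Cospan (n + n') (copair n (l \<then> h) (l' \<then> k)) P (copair m (r \<then> h) (r' \<then>
      k)) (m + m')) a b)
      = wgt S K (s || t) a b"
    using card_homs_disjoint_union[OF du hom(1-4), of c d K c' d'] assms(1,2) K s
    by (auto simp: Sem_def vec_length simp del: homs.simps)
qed

lemma image_constant':
  assumes "\<And>u. u \<in> A \<Longrightarrow> f u = c" "t \<in> A"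
  shows "f ` A = {c}"
  using assms by auto

text \<open>Composites and sums in \<open>FTerm\<close> are unions over all choices. They are
  computed by showing that every choice gives the same set and that a choice exists.\<close>

lemma Union_constant:
  assumes "\<And>x. x \<in> X \<Longrightarrow> x = c" "X \<noteq> {}"
  shows "\<Union>X = c"
proof -
  have "X = {c}" using assms by auto
  then show ?thesis by simp
qed

lemma SemD_Cospan:
  assumes "c \<in> Sem S n m F"
  obtains l G r where "c = Cospan n l G r m" "hom S (discrete n) G l" "hom S (discrete m) G r"
  using assms by (auto simp: Sem_def is_cospan_def)

lemma Sem_Cospan_iff: "Cospan n' l G r m' \<in> Sem S n m F \<Longrightarrow> n' = n \<and> m' = m"
  by (auto simp: Sem_def is_cospan_def)

abbreviation phi_eval :: "'g signature \<Rightarrow> ('g + frob) tm \<Rightarrow> 'g cospan set" where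
  "phi_eval S \<equiv> eval (FTerm S) (\<lambda>x. cospan_class S (case_sum (gen_cospan S) frob_cospan x))"

text \<open>Nonemptiness is carried through the induction because, without representatives of both
  factors, the union that defines a composite would be empty.\<close>

theorem phi_eval_Sem:
  assumes "typed (fsig S) t n m"
  shows "Sem S n m (\<lambda>K. wgt S K t) \<noteq> {} \<and> phi_eval S t = Sem S n m (\<lambda>K. wgt S K t)"
  using assms
proof (induction rule: typed.induct)
  case (1 x)
  show ?case
  proof (cases x)
    case (Inl g)
    with 1 have "g \<in> gens S" by (auto simp: sum_sig_def)
    from gen_in_Sem[OF this] cospan_class_Sem[OF gen_in_Sem[OF this]] show ?thesis
      by (auto simp: Inl sum_sig_def simp del: wgt.simps)
  next
    case (Inr f)
    from frob_in_Sem[of f S] cospan_class_Sem[OF frob_in_Sem[of f S]] show ?thesis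
      by (auto simp: Inr sum_sig_def simp del: wgt.simps)
  qed
next
  case (2 n)
  from Id_in_Sem[of n S] cospan_class_Sem[OF Id_in_Sem[of n S]] show ?case
    by (auto simp: FTerm_def simp del: wgt.simps)
next
  case (3 n m)
  from Sym_in_Sem[of n m S] cospan_class_Sem[OF Sym_in_Sem[of n m S]] show ?case
    by (auto simp: FTerm_def simp del: wgt.simps)
next
  case (4 s n k t m)
  have k: "tcod (fsig S) s = k" using 4 typed_tdom_tcod by metis
  let ?X = "{cospan_class S (Cospan n' (l \<then> h) P (r' \<then> i) m') | n' l G r k' l' G' r' m' P h i.
     Cospan n' l G r k' \<in> Sem S n k (\<lambda>K. wgt S K s) \<and> Cospan k' l' G' r' m' \<in> Sem S k m (\<lambda>K. wgt S K t) \<and>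
     pushout S (discrete k') G G' r l' P h i}"
  have X: "x = Sem S n m (\<lambda>K. wgt S K (s ;; t))" if "x \<in> ?X" for x
  proof -
    from that obtain n' l G r k' l' G' r' m' P h i where x: "x = cospan_class S (Cospan n' (l \<then> h) P
        (r' \<then> i) m')"
      and s: "Cospan n' l G r k' \<in> Sem S n k (\<lambda>K. wgt S K s)" and t: "Cospan k' l' G' r' m' \<in> Sem S
          k m (\<lambda>K. wgt S K t)"
      and po: "pushout S (discrete k') G G' r l' P h i" by blast
    have "n' = n" "k' = k" "m' = m" using Sem_Cospan_iff[OF s] Sem_Cospan_iff[OF t] by auto
    with s t po have "Cospan n' (l \<then> h) P (r' \<then> i) m' \<in> Sem S n m (\<lambda>K. wgt S K (s ;; t))"
      using seq_in_Sem[OF _ _ _ k] by blast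
    from cospan_class_Sem[OF this] show ?thesis by (simp only: x)
  qed
  obtain l G r where s: "Cospan n l G r k \<in> Sem S n k (\<lambda>K. wgt S K s)" "hom S (discrete k) G r"
    using 4 by (metis (no_types, lifting) SemD_Cospan all_not_in_conv)
  obtain l' G' r' where t: "Cospan k l' G' r' m \<in> Sem S k m (\<lambda>K. wgt S K t)" "hom S (discrete k) G' l'"
    using 4 by (metis (no_types, lifting) SemD_Cospan all_not_in_conv)
  obtain P h i where po: "pushout S (discrete k) G G' r l' P h i"
    using pushout_exists[OF s(2) t(2)] .
  have ne: "?X \<noteq> {}" using s(1) t(1) po by blast
  have seq_in: "Sem S n m (\<lambda>K. wgt S K (s ;; t)) \<noteq> {}"
    using seq_in_Sem[OF s(1) t(1) po k] by blast
  have "phi_eval S (s ;; t) = \<Union>?X"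
    using 4 by (simp add: FTerm_def del: wgt.simps)
  then show ?case using Union_constant[OF X ne] seq_in by (simp del: wgt.simps)
next
  case (5 s n m t n' m')
  have s: "tdom (fsig S) s = n" "tcod (fsig S) s = m" using 5 typed_tdom_tcod by metis+
  let ?X = "{cospan_class S (Cospan (n1 + n2) (copair n1 (l \<then> h) (l' \<then> k)) P (copair m1 (r \<then> h) (r'
      \<then> k)) (m1 + m2))
     | n1 l G r m1 n2 l' G' r' m2 P h k.
     Cospan n1 l G r m1 \<in> Sem S n m (\<lambda>K. wgt S K s) \<and> Cospan n2 l' G' r' m2 \<in> Sem S n' m' (\<lambda>K. wgt S
         K t) \<and>
     disjoint_union S G G' P h k}"
  have X: "x = Sem S (n + n') (m + m') (\<lambda>K. wgt S K (s || t))" if "x \<in> ?X" for x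
  proof -
    from that obtain n1 l G r m1 n2 l' G' r' m2 P h k
      where x: "x = cospan_class S (Cospan (n1 + n2) (copair n1 (l \<then> h) (l' \<then> k)) P (copair m1 (r \<then>
          h) (r' \<then> k)) (m1 + m2))"
      and s': "Cospan n1 l G r m1 \<in> Sem S n m (\<lambda>K. wgt S K s)" and t: "Cospan n2 l' G' r' m2 \<in> Sem S
          n' m' (\<lambda>K. wgt S K t)"
      and du: "disjoint_union S G G' P h k" by blast
    have "n1 = n" "m1 = m" "n2 = n'" "m2 = m'" using Sem_Cospan_iff[OF s'] Sem_Cospan_iff[OF t] by auto
    with s' t du have "Cospan (n1 + n2) (copair n1 (l \<then> h) (l' \<then> k)) P (copair m1 (r \<then> h) (r' \<then> k))
        (m1 + m2)
        \<in> Sem S (n + n') (m + m') (\<lambda>K. wgt S K (s || t))"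
      using ten_in_Sem[OF _ _ _ s] by blast
    from cospan_class_Sem[OF this] show ?thesis by (simp only: x)
  qed
  obtain l G r where s': "Cospan n l G r m \<in> Sem S n m (\<lambda>K. wgt S K s)" "hom S (discrete m) G r"
    using 5 by (metis (no_types, lifting) SemD_Cospan all_not_in_conv)
  obtain l' G' r' where t: "Cospan n' l' G' r' m' \<in> Sem S n' m' (\<lambda>K. wgt S K t)" "hom S (discrete
      n') G' l'"
    using 5 by (metis (no_types, lifting) SemD_Cospan all_not_in_conv)
  have du: "disjoint_union S G G' (glue id G G') (glue_left id) (glue_right id)"
    using s' t by (intro disjoint_union_exists) (auto simp: hom_def)
  have ne: "?X \<noteq> {}" using s'(1) t(1) du by blast
  have ten_in: "Sem S (n + n') (m + m') (\<lambda>K. wgt S K (s || t)) \<noteq> {}"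
    using ten_in_Sem[OF s'(1) t(1) du s] by blast
  have "phi_eval S (s || t) = \<Union>?X"
    using 5 by (simp add: FTerm_def del: wgt.simps)
  then show ?case using Union_constant[OF X ne] ten_in by (simp del: wgt.simps)
qed

text \<open>By soundness and uniqueness of types the evaluation is constant on the class, so
  \<open>the_elem\<close> in \<open>Phi\<close> is applied to a singleton.\<close>

theorem Phi_Sem:
  assumes "typed (fsig S) t n m"
  shows "Phi S (tm_class (fsig S) feqs t) = Sem S n m (\<lambda>K. wgt S K t)"
    and "Sem S n m (\<lambda>K. wgt S K t) \<noteq> {}"
proof -
  have "Sem S n' m' (\<lambda>K. wgt S K u) = Sem S n m (\<lambda>K. wgt S K t)" if "tm_eq (fsig S) feqs n' m' t u"
      for u n' m'
  proof -
    have nm: "n' = n" "m' = m"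
      using typed_tdom_tcod assms tm_eq_typed[OF that] by metis+
    show ?thesis
      using wgt_sound[OF that] unfolding nm by (auto simp: Sem_def hypergraph_def)
  qed
  moreover have "phi_eval S u = Sem S n' m' (\<lambda>K. wgt S K u)" if "tm_eq (fsig S) feqs n' m' t u" for
      u n' m'
    using phi_eval_Sem tm_eq_typed[OF that] by blast
  ultimately have "phi_eval S u = Sem S n m (\<lambda>K. wgt S K t)" if "u \<in> tm_class (fsig S) feqs t" for u
    using that unfolding tm_class_def by blast
  moreover have "t \<in> tm_class (fsig S) feqs t"
    using tm_eq.refl[OF assms, of feqs] by (auto simp: tm_class_def)
  ultimately have "phi_eval S ` tm_class (fsig S) feqs t = {Sem S n m (\<lambda>K. wgt S K t)}"
    by (rule image_constant')
  then show "Phi S (tm_class (fsig S) feqs t) = Sem S n m (\<lambda>K. wgt S K t)"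
    by (simp add: Phi_def)
  show "Sem S n m (\<lambda>K. wgt S K t) \<noteq> {}"
    using phi_eval_Sem[OF assms] by blast
qed

section \<open>Frobenius structure in a symmetric strict monoidal category\<close>

text \<open>Associativity and whiskering are assumed without typing conditions: in a presented PROP they hold
  for ill-typed composites as well, both sides being the empty set.\<close>

locale smc =
  fixes arr :: "'a \<Rightarrow> bool" and dm cd :: "'a \<Rightarrow> nat"
    and sq :: "'a \<Rightarrow> 'a \<Rightarrow> 'a" (infixr "\<odot>" 60)
    and tn :: "'a \<Rightarrow> 'a \<Rightarrow> 'a" (infixr "\<otimes>" 65)
    and I :: "nat \<Rightarrow> 'a" and Sy :: "nat \<Rightarrow> nat \<Rightarrow> 'a"
  assumes sq_assoc: "(f \<odot> g) \<odot> h = f \<odot> g \<odot> h"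
    and tn_assoc: "(f \<otimes> g) \<otimes> h = f \<otimes> g \<otimes> h"
    and I_tn: "I n \<otimes> I m = I (n + m)"
    and sq_tn_I: "(f \<odot> g) \<otimes> I k = (f \<otimes> I k) \<odot> (g \<otimes> I k)"
    and I_tn_sq: "I k \<otimes> (f \<odot> g) = (I k \<otimes> f) \<odot> (I k \<otimes> g)"
    and arr_sq: "arr f \<Longrightarrow> arr g \<Longrightarrow> cd f = dm g \<Longrightarrow> arr (f \<odot> g)"
    and dm_sq: "arr f \<Longrightarrow> arr g \<Longrightarrow> cd f = dm g \<Longrightarrow> dm (f \<odot> g) = dm f"
    and cd_sq: "arr f \<Longrightarrow> arr g \<Longrightarrow> cd f = dm g \<Longrightarrow> cd (f \<odot> g) = cd g"
    and arr_tn: "arr f \<Longrightarrow> arr g \<Longrightarrow> arr (f \<otimes> g)"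
    and dm_tn: "arr f \<Longrightarrow> arr g \<Longrightarrow> dm (f \<otimes> g) = dm f + dm g"
    and cd_tn: "arr f \<Longrightarrow> arr g \<Longrightarrow> cd (f \<otimes> g) = cd f + cd g"
    and I_typ: "arr (I n)" "dm (I n) = n" "cd (I n) = n"
    and Sy_typ: "arr (Sy n m)" "dm (Sy n m) = n + m" "cd (Sy n m) = m + n"
    and I_sq: "arr f \<Longrightarrow> dm f = n \<Longrightarrow> I n \<odot> f = f"
    and sq_I: "arr f \<Longrightarrow> cd f = n \<Longrightarrow> f \<odot> I n = f"
    and I0_tn: "arr f \<Longrightarrow> I 0 \<otimes> f = f"
    and tn_I0: "arr f \<Longrightarrow> f \<otimes> I 0 = f"
    and interchange: "arr f \<Longrightarrow> arr g \<Longrightarrow> arr f' \<Longrightarrow> arr g' \<Longrightarrow> cd f = dm g \<Longrightarrow> cd f' = dm g' \<Longrightarrow>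
      (f \<odot> g) \<otimes> (f' \<odot> g') = (f \<otimes> f') \<odot> (g \<otimes> g')"
    and Sy_natural: "arr f \<Longrightarrow> arr g \<Longrightarrow> (f \<otimes> g) \<odot> Sy (cd f) (cd g) = Sy (dm f) (dm g) \<odot> (g \<otimes> f)"
    and Sy_inv: "Sy n m \<odot> Sy m n = I (n + m)"
    and Sy_0: "Sy n 0 = I n"
    and Sy_hex: "Sy n (m + k) = (Sy n m \<otimes> I k) \<odot> (I m \<otimes> Sy n k)"
begin

section \<open>Derived laws of the symmetries\<close>

lemmas smc_ty = arr_sq dm_sq cd_sq arr_tn dm_tn cd_tn I_typ Sy_typ

lemma I_tn_assoc: "I n \<otimes> I m \<otimes> f = I (n + m) \<otimes> f"
  by (simp add: I_tn tn_assoc[symmetric])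

lemmas whisker_laws = sq_assoc tn_assoc I_tn sq_tn_I I_tn_sq I_tn_assoc
lemmas unit_laws = I_sq sq_I I0_tn tn_I0

lemma sq_ext: "f \<odot> g = h \<Longrightarrow> f \<odot> g \<odot> k = h \<odot> k"
  by (metis sq_assoc)

lemma sq_ext2: "f \<odot> g = h \<odot> h' \<Longrightarrow> f \<odot> g \<odot> k = h \<odot> h' \<odot> k"
  by (metis sq_assoc)

lemma tn_split:
  assumes "arr f" "arr g"
  shows "(f \<otimes> I (dm g)) \<odot> (I (cd f) \<otimes> g) = f \<otimes> g" "(I (dm f) \<otimes> g) \<odot> (f \<otimes> I (cd g)) = f \<otimes> g"
  using assms interchange[of f "I (cd f)" "I (dm g)" g] interchange[of "I (dm f)" f g "I (cd g)"]
  by (simp_all add: smc_ty unit_laws)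

text \<open>Arrows on disjoint wires slide past each other. Domains and codomains are separate
  variables so that the rule matches identities whose arity is a numeral or a sum.\<close>

lemma exchange:
  assumes "arr f" "arr g" "dm g = b" "cd f = a'" "dm f = a" "cd g = b'"
  shows "(f \<otimes> I b) \<odot> (I a' \<otimes> g) = (I a \<otimes> g) \<odot> (f \<otimes> I b')"
  using tn_split[OF assms(1,2)] assms by simp

lemma Sy_0l: "Sy 0 n = I n"
  using Sy_inv[of n 0] by (simp add: Sy_0 unit_laws smc_ty)

text \<open>The inverse form of the hexagon \<open>Sy_hex\<close>: the right-hand side composed with
  \<open>Sy k (n + m)\<close> is an identity, and \<open>Sy (n + m) k\<close> is inverse to that
  symmetry.\<close>

lemma Sy_hex2: "Sy (n + m) k = (I n \<otimes> Sy m k) \<odot> (Sy n k \<otimes> I m)"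
proof -
  let ?X = "(I n \<otimes> Sy m k) \<odot> (Sy n k \<otimes> I m)"
  have "?X \<odot> Sy k (n + m) = (I n \<otimes> Sy m k) \<odot> ((Sy n k \<odot> Sy k n) \<otimes> I m) \<odot> (I n \<otimes> Sy k m)"
    by (simp add: Sy_hex sq_tn_I sq_assoc)
  also have "\<dots> = I n \<otimes> (Sy m k \<odot> Sy k m)"
    unfolding Sy_inv[of n k] by (simp add: I_tn I_tn_sq unit_laws smc_ty add_ac)
  also have "\<dots> = I (n + m + k)"
    by (simp add: Sy_inv I_tn add_ac)
  finally have 1: "?X \<odot> Sy k (n + m) = I (n + m + k)" .
  have "Sy (n + m) k = (?X \<odot> Sy k (n + m)) \<odot> Sy (n + m) k"
    unfolding 1 by (simp add: unit_laws smc_ty)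
  also have "\<dots> = ?X \<odot> (Sy k (n + m) \<odot> Sy (n + m) k)"
    by (simp only: sq_assoc)
  also have "\<dots> = ?X"
    unfolding Sy_inv by (intro sq_I) (simp_all add: smc_ty)
  finally show ?thesis .
qed

text \<open>Whiskering on the left is whiskering on the right conjugated by symmetries, so later
  closure properties have to be proved for one side only.\<close>

lemma slide_left:
  assumes "arr f"
  shows "I x \<otimes> f = Sy x (dm f) \<odot> (f \<otimes> I x) \<odot> Sy (cd f) x"
proof -
  have "Sy x (dm f) \<odot> (f \<otimes> I x) \<odot> Sy (cd f) x = (I x \<otimes> f) \<odot> Sy x (cd f) \<odot> Sy (cd f) x"
    using sq_ext2[OF Sy_natural[of "I x" f], symmetric] assms by (simp add: smc_ty)
  then show ?thesis using assms by (simp add: Sy_inv unit_laws smc_ty)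
qed

text \<open>Naturality of the symmetry of one wire with two, applied to the crossing of those two
  and expanded by the hexagon.\<close>

lemma Yang_Baxter:
  "(Sy 1 1 \<otimes> I 1) \<odot> (I 1 \<otimes> Sy 1 1) \<odot> (Sy 1 1 \<otimes> I 1) = (I 1 \<otimes> Sy 1 1) \<odot> (Sy 1 1 \<otimes> I 1) \<odot> (I 1 \<otimes> Sy 1 1)"
proof -
  have "Sy 1 (1 + 1) = (Sy 1 1 \<otimes> I 1) \<odot> (I 1 \<otimes> Sy 1 1)"
    by (rule Sy_hex)
  moreover have "(I 1 \<otimes> Sy 1 1) \<odot> Sy 1 (1 + 1) = Sy 1 (1 + 1) \<odot> (Sy 1 1 \<otimes> I 1)"
    using Sy_natural[of "I 1" "Sy 1 1"] by (simp add: smc_ty)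
  ultimately show ?thesis by (simp add: sq_assoc)
qed

end

section \<open>Frobenius structure and copying of single wires\<close>

locale frobenius_prop = smc +
  fixes \<mu> \<eta> \<delta> \<epsilon> :: 'a
  assumes frob_typ: "arr \<mu>" "dm \<mu> = 2" "cd \<mu> = 1" "arr \<eta>" "dm \<eta> = 0" "cd \<eta> = 1"
      "arr \<delta>" "dm \<delta> = 1" "cd \<delta> = 2" "arr \<epsilon>" "dm \<epsilon> = 1" "cd \<epsilon> = 0"
    and mu_unit: "(\<eta> \<otimes> I 1) \<odot> \<mu> = I 1"
    and mu_unit2: "(I 1 \<otimes> \<eta>) \<odot> \<mu> = I 1"
    and mu_comm: "Sy 1 1 \<odot> \<mu> = \<mu>"
    and de_assoc: "\<delta> \<odot> (\<delta> \<otimes> I 1) = \<delta> \<odot> (I 1 \<otimes> \<delta>)"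
    and de_counit: "\<delta> \<odot> (\<epsilon> \<otimes> I 1) = I 1"
    and de_counit2: "\<delta> \<odot> (I 1 \<otimes> \<epsilon>) = I 1"
    and de_comm: "\<delta> \<odot> Sy 1 1 = \<delta>"
    and frob1: "(\<delta> \<otimes> I 1) \<odot> (I 1 \<otimes> \<mu>) = \<mu> \<odot> \<delta>"
    and frob2: "(I 1 \<otimes> \<delta>) \<odot> (\<mu> \<otimes> I 1) = \<mu> \<odot> \<delta>"
    and special: "\<delta> \<odot> \<mu> = I 1"
begin

lemmas arrow_ty = smc_ty frob_typ

text \<open>\<open>dup x v : v \<rightarrow> 1 + v\<close> puts a copy of wire \<open>x\<close> in front.\<close>

fun dup :: "nat \<Rightarrow> nat \<Rightarrow> 'a" where
  "dup x 0 = I 0"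
| "dup 0 (Suc v) = \<delta> \<otimes> I v"
| "dup (Suc x) (Suc v) = (I 1 \<otimes> dup x v) \<odot> (Sy 1 1 \<otimes> I v)"

lemma dup_typ: "x < v \<Longrightarrow> arr (dup x v)" "x < v \<Longrightarrow> dm (dup x v) = v" "x < v \<Longrightarrow> cd (dup x v) = Suc v"
proof -
  have "arr (dup x v) \<and> dm (dup x v) = v \<and> cd (dup x v) = Suc v" if "x < v"
    using that by (induction x v rule: dup.induct) (auto simp: arrow_ty)
  then show "x < v \<Longrightarrow> arr (dup x v)" "x < v \<Longrightarrow> dm (dup x v) = v" "x < v \<Longrightarrow> cd (dup x v) = Suc v"
    by blast+
qed

lemma sym_delta: "Sy 1 1 \<odot> (I 1 \<otimes> \<delta>) = (\<delta> \<otimes> I 1) \<odot> (I 1 \<otimes> Sy 1 1) \<odot> (Sy 1 1 \<otimes> I 1)"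
  using Sy_natural[of \<delta> "I 1"] Sy_hex2[of 1 1 1] by (simp add: arrow_ty numeral_2_eq_2)

lemma sym_delta2: "Sy 1 1 \<odot> (\<delta> \<otimes> I 1) = (I 1 \<otimes> \<delta>) \<odot> (Sy 1 1 \<otimes> I 1) \<odot> (I 1 \<otimes> Sy 1 1)"
  using Sy_natural[of "I 1" \<delta>] Sy_hex[of 1 1 1] by (simp add: arrow_ty numeral_2_eq_2)

lemma sym_eps: "Sy 1 1 \<odot> (\<epsilon> \<otimes> I 1) = I 1 \<otimes> \<epsilon>" "Sy 1 1 \<odot> (I 1 \<otimes> \<epsilon>) = \<epsilon> \<otimes> I 1"
  using Sy_natural[of "I 1" \<epsilon>] Sy_natural[of \<epsilon> "I 1"] by (simp_all add: arrow_ty Sy_0 Sy_0l unit_laws)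

lemma sym_eta: "(\<eta> \<otimes> I 1) \<odot> Sy 1 1 = I 1 \<otimes> \<eta>" "(I 1 \<otimes> \<eta>) \<odot> Sy 1 1 = \<eta> \<otimes> I 1"
  using Sy_natural[of "I 1" \<eta>] Sy_natural[of \<eta> "I 1"] by (simp_all add: arrow_ty Sy_0 Sy_0l unit_laws)

lemma tn_I_cong: "f = g \<Longrightarrow> f \<otimes> I k = g \<otimes> I k" by simp

text \<open>The case of \<open>dup_swap\<close> in which one wire is the front one:
  \<open>sym_delta\<close> carries the crossing through \<delta>, and the two copying steps then act
  on disjoint wires.\<close>

lemma dup_swap_0: "y < v \<Longrightarrow>
  dup 0 (Suc v) \<odot> (I 1 \<otimes> dup (Suc y) (Suc v)) \<odot> (Sy 1 1 \<otimes> I (Suc v)) = dup (Suc y) (Suc v) \<odot> (I 1 \<otimes>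
      dup 0 (Suc v))"
proof -
  assume y: "y < v"
  have "dup (Suc y) (Suc v) \<odot> (I 1 \<otimes> dup 0 (Suc v)) = (I 1 \<otimes> dup y v) \<odot> ((Sy 1 1 \<odot> (I 1 \<otimes> \<delta>)) \<otimes> I v)"
    by (simp add: whisker_laws)
  also have "\<dots> = ((I 1 \<otimes> dup y v) \<odot> (\<delta> \<otimes> I (Suc v))) \<odot> (I 1 \<otimes> Sy 1 1 \<otimes> I v) \<odot> (Sy 1 1 \<otimes> I (Suc v))"
    unfolding sym_delta by (simp add: whisker_laws)
  also have "(I 1 \<otimes> dup y v) \<odot> (\<delta> \<otimes> I (Suc v)) = (\<delta> \<otimes> I v) \<odot> (I 2 \<otimes> dup y v)"
    using y by (intro exchange[symmetric]) (simp_all add: arrow_ty dup_typ)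
  finally show ?thesis by (simp add: whisker_laws numeral_2_eq_2)
qed

text \<open>This commutation is what makes the order of copying immaterial. On the front wire it is
  cocommutativity with coassociativity; for two later wires the induction hypothesis is conjugated
  by crossings.\<close>

lemma dup_swap:
  "x < v \<Longrightarrow> y < v \<Longrightarrow> dup x v \<odot> (I 1 \<otimes> dup y v) \<odot> (Sy 1 1 \<otimes> I v) = dup y v \<odot> (I 1 \<otimes> dup x v)"
proof (induction v arbitrary: x y)
  case (Suc v)
  \<comment> \<open>The crossing is an involution, so the claim for \<open>x\<close>,
    \<open>y\<close> gives the claim for \<open>y\<close>, \<open>x\<close>.\<close>
  have flip: "dup y (Suc v) \<odot> (I 1 \<otimes> dup x (Suc v)) \<odot> (Sy 1 1 \<otimes> I (Suc v)) = dup x (Suc v) \<odot> (I 1 \<otimes>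
      dup y (Suc v))"
    if "dup x (Suc v) \<odot> (I 1 \<otimes> dup y (Suc v)) \<odot> (Sy 1 1 \<otimes> I (Suc v)) = dup y (Suc v) \<odot> (I 1 \<otimes> dup x
        (Suc v))"
      "x < Suc v" "y < Suc v" for x y
  proof -
    have "dup y (Suc v) \<odot> (I 1 \<otimes> dup x (Suc v)) \<odot> (Sy 1 1 \<otimes> I (Suc v)) =
        dup x (Suc v) \<odot> (I 1 \<otimes> dup y (Suc v)) \<odot> ((Sy 1 1 \<odot> Sy 1 1) \<otimes> I (Suc v))"
      using that(1) by (simp add: sq_tn_I) (metis sq_assoc)
    then show ?thesis using that(2,3) by (simp add: Sy_inv I_tn unit_laws arrow_ty dup_typ del:
        dup.simps)
  qed
  show ?case
  proof (cases x)
    case 0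
    show ?thesis
    proof (cases y)
      case y: 0
      have "\<delta> \<odot> (I 1 \<otimes> \<delta>) \<odot> (Sy 1 1 \<otimes> I 1) = \<delta> \<odot> ((\<delta> \<odot> Sy 1 1) \<otimes> I 1)"
        by (simp add: sq_tn_I sq_ext[OF de_assoc, unfolded One_nat_def] sq_assoc)
      also have "\<dots> = \<delta> \<odot> (I 1 \<otimes> \<delta>)" by (simp only: de_comm de_assoc)
      finally show ?thesis
        unfolding 0 y by (drule_tac tn_I_cong[where k = v]) (simp add: whisker_laws)
    next
      case (Suc y')
      then show ?thesis using dup_swap_0[of y' v] Suc.prems 0 by simp
    qed
  next
    case (Suc x')
    note x = this
    show ?thesis
    proof (cases y)
      case 0
      then show ?thesis using flip[of y x, OF _ Suc.prems(2,1)] dup_swap_0[of x' v] Suc.prems x by simp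
    next
      case (Suc y')
      have v: "x' < v" "y' < v" using Suc.prems x Suc by auto
      have ex: "(Sy 1 1 \<otimes> I v) \<odot> (I 2 \<otimes> dup z v) = (I 2 \<otimes> dup z v) \<odot> (Sy 1 1 \<otimes> I (Suc v))" if "z <
          v" for z
        using that by (intro exchange) (simp_all add: arrow_ty dup_typ)
      \<comment> \<open>Both wires lie behind the front one. The Yang-Baxter equation moves one
        crossing next to the two inner copying steps, where the induction hypothesis absorbs
        it.\<close>
      have "dup x (Suc v) \<odot> (I 1 \<otimes> dup y (Suc v)) \<odot> (Sy 1 1 \<otimes> I (Suc v)) =
        (I 1 \<otimes> dup x' v) \<odot> ((Sy 1 1 \<otimes> I v) \<odot> (I 2 \<otimes> dup y' v)) \<odot> (I 1 \<otimes> Sy 1 1 \<otimes> I v) \<odot> (Sy 1 1 \<otimes> I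
            (Suc v))"
        unfolding x Suc by (simp add: whisker_laws numeral_2_eq_2)
      also have "\<dots> = (I 1 \<otimes> dup x' v) \<odot> (I 2 \<otimes> dup y' v) \<odot>
          (((Sy 1 1 \<otimes> I 1) \<odot> (I 1 \<otimes> Sy 1 1) \<odot> (Sy 1 1 \<otimes> I 1)) \<otimes> I v)"
        unfolding ex[OF v(2)] by (simp add: whisker_laws)
      also have "\<dots> = (I 1 \<otimes> (dup x' v \<odot> (I 1 \<otimes> dup y' v) \<odot> (Sy 1 1 \<otimes> I v))) \<odot> (Sy 1 1 \<otimes> I (Suc v)) \<odot>
          (I 1 \<otimes> Sy 1 1 \<otimes> I v)"
        unfolding Yang_Baxter by (simp add: whisker_laws numeral_2_eq_2)
      also have "\<dots> = (I 1 \<otimes> dup y' v) \<odot> ((I 2 \<otimes> dup x' v) \<odot> (Sy 1 1 \<otimes> I (Suc v))) \<odot> (I 1 \<otimes> Sy 1 1 \<otimes> I v)"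
        unfolding Suc.IH[OF v] by (simp add: whisker_laws numeral_2_eq_2)
      also have "\<dots> = dup y (Suc v) \<odot> (I 1 \<otimes> dup x (Suc v))"
        unfolding ex[OF v(1), symmetric] x Suc by (simp add: whisker_laws numeral_2_eq_2)
      finally show ?thesis .
    qed
  qed
qed simp

text \<open>Coassociativity, transported past the earlier wires by
  \<open>sym_delta2\<close>.\<close>

lemma dup_delta: "x < v \<Longrightarrow> dup x v \<odot> (\<delta> \<otimes> I v) = dup x v \<odot> (I 1 \<otimes> dup x v)"
proof (induction x v rule: dup.induct)
  case (2 v)
  show ?case using tn_I_cong[OF de_assoc, of v] by (simp add: whisker_laws)
next
  case (3 x v)
  have ex: "(Sy 1 1 \<otimes> I v) \<odot> (I 2 \<otimes> dup x v) = (I 2 \<otimes> dup x v) \<odot> (Sy 1 1 \<otimes> I (Suc v))"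
    using 3 by (intro exchange) (simp_all add: arrow_ty dup_typ)
  have "dup (Suc x) (Suc v) \<odot> (\<delta> \<otimes> I (Suc v)) = (I 1 \<otimes> dup x v) \<odot> ((Sy 1 1 \<odot> (\<delta> \<otimes> I 1)) \<otimes> I v)"
    by (simp add: whisker_laws)
  also have "\<dots> = (I 1 \<otimes> (dup x v \<odot> (\<delta> \<otimes> I v))) \<odot> (Sy 1 1 \<otimes> I (Suc v)) \<odot> (I 1 \<otimes> Sy 1 1 \<otimes> I v)"
    unfolding sym_delta2 by (simp add: whisker_laws)
  also have "dup x v \<odot> (\<delta> \<otimes> I v) = dup x v \<odot> (I 1 \<otimes> dup x v)" using 3 by simp
  also have "(I 1 \<otimes> (dup x v \<odot> (I 1 \<otimes> dup x v))) \<odot> (Sy 1 1 \<otimes> I (Suc v)) \<odot> (I 1 \<otimes> Sy 1 1 \<otimes> I v) =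
      (I 1 \<otimes> dup x v) \<odot> ((I 2 \<otimes> dup x v) \<odot> (Sy 1 1 \<otimes> I (Suc v))) \<odot> (I 1 \<otimes> Sy 1 1 \<otimes> I v)"
    by (simp add: whisker_laws numeral_2_eq_2)
  also have "\<dots> = dup (Suc x) (Suc v) \<odot> (I 1 \<otimes> dup (Suc x) (Suc v))"
    unfolding ex[symmetric] by (simp add: whisker_laws numeral_2_eq_2)
  finally show ?case .
qed simp

text \<open>The counit law, transported past the earlier wires by \<open>sym_eps\<close>.\<close>

lemma dup_eps: "x < v \<Longrightarrow> dup x v \<odot> (\<epsilon> \<otimes> I v) = I v"
proof (induction x v rule: dup.induct)
  case (2 v)
  show ?case using tn_I_cong[OF de_counit, of v] by (simp add: whisker_laws)
next
  case (3 x v)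
  have "dup (Suc x) (Suc v) \<odot> (\<epsilon> \<otimes> I (Suc v)) = (I 1 \<otimes> dup x v) \<odot> ((Sy 1 1 \<odot> (\<epsilon> \<otimes> I 1)) \<otimes> I v)"
    by (simp add: whisker_laws)
  also have "\<dots> = I 1 \<otimes> (dup x v \<odot> (\<epsilon> \<otimes> I v))"
    unfolding sym_eps by (simp add: whisker_laws)
  finally show ?case using 3 by (simp add: I_tn)
qed simp

primrec news :: "nat \<Rightarrow> 'a" where
  "news 0 = I 0"
| "news (Suc v) = \<eta> \<otimes> news v"

primrec dels :: "nat \<Rightarrow> 'a" where
  "dels 0 = I 0"
| "dels (Suc v) = \<epsilon> \<otimes> dels v"

lemma news_typ: "arr (news v)" "dm (news v) = 0" "cd (news v) = v"
  by (induction v) (simp_all add: arrow_ty)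

lemma dels_typ: "arr (dels v)" "dm (dels v) = v" "cd (dels v) = 0"
  by (induction v) (simp_all add: arrow_ty)

lemma news_add: "news (n + m) = news n \<otimes> news m"
  by (induction n) (simp_all add: unit_laws news_typ tn_assoc)

text \<open>Naturality of the symmetry, whose instance at domain 0 is an identity: fresh nodes are
  indistinguishable.\<close>

lemma news_Sy: "news (n + m) \<odot> Sy n m = news (n + m)"
  using Sy_natural[of "news n" "news m"] by (simp add: news_typ Sy_0 unit_laws news_add[symmetric]
      add.commute)

text \<open>The discrete cospan whose nodes are the \<open>v\<close> inputs and whose
  \<open>i\<close>-th output is attached to input \<open>p ! i\<close>.\<close>

primrec tuple :: "nat \<Rightarrow> nat list \<Rightarrow> 'a" where
  "tuple v [] = dels v"
| "tuple v (x # p) = dup x v \<odot> (I 1 \<otimes> tuple v p)"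

abbreviation below :: "nat \<Rightarrow> nat list \<Rightarrow> bool" where
  "below v p \<equiv> set p \<subseteq> {..<v}"

lemma tuple_typ:
  assumes "below v p"
  shows "arr (tuple v p)" "dm (tuple v p) = v" "cd (tuple v p) = length p"
proof -
  have "arr (tuple v p) \<and> dm (tuple v p) = v \<and> cd (tuple v p) = length p"
    using assms by (induction p) (auto simp: arrow_ty dup_typ dels_typ)
  then show "arr (tuple v p)" "dm (tuple v p) = v" "cd (tuple v p) = length p" by auto
qed

lemmas arrow_tys = arrow_ty dup_typ dels_typ news_typ tuple_typ

text \<open>Lifts an identity about the last outputs to the whole list; it is the tool for acting in
  the middle of a tuple.\<close>

lemma tuple_prefix:
  "tuple v q \<odot> f = tuple v q' \<Longrightarrow> below v p \<Longrightarrow> arr f \<Longrightarrow> below v q \<Longrightarrow> tuple v (p @ q) \<odot> (I (length p) \<otimes> f)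
      = tuple v (p @ q')"
proof (induction p)
  case (Cons x p)
  have "tuple v ((x # p) @ q) \<odot> (I (length (x # p)) \<otimes> f) = dup x v \<odot> (I 1 \<otimes> (tuple v (p @ q) \<odot> (I
      (length p) \<otimes> f)))"
    by (simp add: whisker_laws)
  with Cons show ?case by simp
qed (simp add: unit_laws)

text \<open>This is \<open>dup_swap\<close> seen at the outputs. Together with the two hexagons it
  yields the rotations and block exchanges that follow.\<close>

lemma tuple_swap:
  assumes "below v (x # y # p)"
  shows "tuple v (x # y # p) \<odot> (Sy 1 1 \<otimes> I (length p)) = tuple v (y # x # p)"
proof -
  have ex: "(I 2 \<otimes> tuple v p) \<odot> (Sy 1 1 \<otimes> I (length p)) = (Sy 1 1 \<otimes> I v) \<odot> (I 2 \<otimes> tuple v p)"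
    using assms by (intro exchange[symmetric]) (simp_all add: arrow_tys)
  have "tuple v (x # y # p) \<odot> (Sy 1 1 \<otimes> I (length p)) =
      dup x v \<odot> (I 1 \<otimes> dup y v) \<odot> (I 2 \<otimes> tuple v p) \<odot> (Sy 1 1 \<otimes> I (length p))"
    by (simp add: whisker_laws numeral_2_eq_2)
  also have "\<dots> = (dup x v \<odot> (I 1 \<otimes> dup y v) \<odot> (Sy 1 1 \<otimes> I v)) \<odot> (I 2 \<otimes> tuple v p)"
    unfolding ex by (simp add: sq_assoc)
  also have "\<dots> = tuple v (y # x # p)"
    using assms by (subst dup_swap) (simp_all add: whisker_laws numeral_2_eq_2)
  finally show ?thesis .
qed

lemma tuple_rot:
  "below v (x # q @ w) \<Longrightarrow> tuple v (x # q @ w) \<odot> (Sy 1 (length q) \<otimes> I (length w)) = tuple v (q @ x # w)"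
proof (induction q)
  case Nil
  then show ?case by (simp add: Sy_0 I_tn unit_laws arrow_tys)
next
  case (Cons y q)
  have "Sy 1 (length (y # q)) \<otimes> I (length w) =
      (Sy 1 1 \<otimes> I (length (q @ w))) \<odot> (I 1 \<otimes> Sy 1 (length q) \<otimes> I (length w))"
    using Sy_hex[of 1 1 "length q"] by (simp add: whisker_laws)
  then have "tuple v (x # (y # q) @ w) \<odot> (Sy 1 (length (y # q)) \<otimes> I (length w)) =
      (tuple v (x # y # q @ w) \<odot> (Sy 1 1 \<otimes> I (length (q @ w)))) \<odot> (I 1 \<otimes> Sy 1 (length q) \<otimes> I (length w))"
    by (simp add: sq_assoc)
  also have "\<dots> = tuple v (y # x # q @ w) \<odot> (I (length [y]) \<otimes> Sy 1 (length q) \<otimes> I (length w))"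
    using Cons.prems by (subst tuple_swap) auto
  also have "\<dots> = tuple v ([y] @ q @ x # w)"
    using Cons tuple_prefix[of v "x # q @ w" "Sy 1 (length q) \<otimes> I (length w)" "q @ x # w" "[y]"]
    by (simp add: arrow_ty)
  finally show ?case by simp
qed

lemma tuple_block:
  "below v (q @ r @ w) \<Longrightarrow> tuple v (q @ r @ w) \<odot> (Sy (length q) (length r) \<otimes> I (length w)) = tuple v
      (r @ q @ w)"
proof (induction q)
  case Nil
  then show ?case by (simp add: Sy_0l I_tn unit_laws arrow_tys)
next
  case (Cons x q)
  have "Sy (length (x # q)) (length r) \<otimes> I (length w) =
      (I (length [x]) \<otimes> Sy (length q) (length r) \<otimes> I (length w)) \<odot> (Sy 1 (length r) \<otimes> I (length (q @
          w)))"
    using Sy_hex2[of 1 "length q" "length r"] by (simp add: whisker_laws)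
  then have "tuple v ((x # q) @ r @ w) \<odot> (Sy (length (x # q)) (length r) \<otimes> I (length w)) =
      (tuple v ([x] @ q @ r @ w) \<odot> (I (length [x]) \<otimes> Sy (length q) (length r) \<otimes> I (length w))) \<odot>
      (Sy 1 (length r) \<otimes> I (length (q @ w)))"
    by (simp only: sq_assoc append_Cons append_Nil)
  also have "\<dots> = tuple v (x # r @ q @ w) \<odot> (Sy 1 (length r) \<otimes> I (length (q @ w)))"
    using Cons by (subst tuple_prefix[where q' = "r @ q @ w"]) (auto simp: arrow_ty)
  also have "\<dots> = tuple v (r @ x # q @ w)"
    using Cons.prems by (intro tuple_rot) auto
  finally show ?case by simp
qed

lemma tuple_delta:
  assumes "below v (x # p)"
  shows "tuple v (x # p) \<odot> (\<delta> \<otimes> I (length p)) = tuple v (x # x # p)"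
proof -
  have ex: "(I 1 \<otimes> tuple v p) \<odot> (\<delta> \<otimes> I (length p)) = (\<delta> \<otimes> I v) \<odot> (I 2 \<otimes> tuple v p)"
    using assms by (intro exchange[symmetric]) (simp_all add: arrow_tys)
  have "tuple v (x # p) \<odot> (\<delta> \<otimes> I (length p)) = (dup x v \<odot> (\<delta> \<otimes> I v)) \<odot> (I 2 \<otimes> tuple v p)"
    by (simp add: sq_assoc ex[unfolded One_nat_def])
  also have "dup x v \<odot> (\<delta> \<otimes> I v) = dup x v \<odot> (I 1 \<otimes> dup x v)"
    using assms by (simp add: dup_delta)
  finally show ?thesis by (simp add: whisker_laws numeral_2_eq_2)
qed

lemma tuple_eps:
  assumes "below v (x # p)"
  shows "tuple v (x # p) \<odot> (\<epsilon> \<otimes> I (length p)) = tuple v p"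
proof -
  have ex: "(I 1 \<otimes> tuple v p) \<odot> (\<epsilon> \<otimes> I (length p)) = (\<epsilon> \<otimes> I v) \<odot> (I 0 \<otimes> tuple v p)"
    using assms by (intro exchange[symmetric]) (simp_all add: arrow_tys)
  have "tuple v (x # p) \<odot> (\<epsilon> \<otimes> I (length p)) = (dup x v \<odot> (\<epsilon> \<otimes> I v)) \<odot> (I 0 \<otimes> tuple v p)"
    by (simp add: sq_assoc ex[unfolded One_nat_def])
  then show ?thesis using assms by (simp add: dup_eps unit_laws arrow_tys)
qed

lemma tuple_dels: "below v q \<Longrightarrow> tuple v q \<odot> dels (length q) = dels v"
proof (induction q)
  case (Cons x q)
  have "dels (length (x # q)) = (\<epsilon> \<otimes> I (length q)) \<odot> dels (length q)"
    using tn_split(1)[of \<epsilon> "dels (length q)"] by (simp add: arrow_tys unit_laws)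
  then have "tuple v (x # q) \<odot> dels (length (x # q)) = (tuple v (x # q) \<odot> (\<epsilon> \<otimes> I (length q))) \<odot> dels
      (length q)"
    by (simp only: sq_assoc)
  then show ?case using Cons tuple_eps[where v = v and x = x and p = q] by simp
qed (simp add: unit_laws arrow_tys)

text \<open>Copying is natural with respect to tuples: a copy of an output may be taken at the input
  it comes from. This is the inductive step of \<open>tuple_comp\<close>.\<close>

lemma tuple_dup:
  "below v q \<Longrightarrow> x < length q \<Longrightarrow> tuple v q \<odot> dup x (length q) = dup (q ! x) v \<odot> (I 1 \<otimes> tuple v q)"
proof (induction q arbitrary: x)
  case (Cons z q)
  have below: "below v q" "z < v" using Cons.prems by auto
  show ?case
  proof (cases x)
    case 0
    then show ?thesis using tuple_delta[OF Cons.prems(1)] by simp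
  next
    case (Suc y)
    have y: "y < length q" "q ! y < v" using Suc Cons.prems by (auto simp: subset_iff)
    have ex: "(I 2 \<otimes> tuple v q) \<odot> (Sy 1 1 \<otimes> I (length q)) = (Sy 1 1 \<otimes> I v) \<odot> (I 2 \<otimes> tuple v q)"
      using below by (intro exchange[symmetric]) (simp_all add: arrow_tys)
    have "tuple v (z # q) \<odot> dup x (length (z # q)) =
        dup z v \<odot> (I 1 \<otimes> (tuple v q \<odot> dup y (length q))) \<odot> (Sy 1 1 \<otimes> I (length q))"
      by (simp add: Suc whisker_laws)
    also have "\<dots> = dup z v \<odot> (I 1 \<otimes> dup (q ! y) v) \<odot> (I 2 \<otimes> tuple v q) \<odot> (Sy 1 1 \<otimes> I (length q))"
      unfolding Cons.IH[OF below(1) y(1)] by (simp add: whisker_laws numeral_2_eq_2)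
    also have "\<dots> = (dup z v \<odot> (I 1 \<otimes> dup (q ! y) v) \<odot> (Sy 1 1 \<otimes> I v)) \<odot> (I 2 \<otimes> tuple v q)"
      unfolding ex by (simp only: sq_assoc)
    also have "\<dots> = dup ((z # q) ! x) v \<odot> (I 1 \<otimes> tuple v (z # q))"
      unfolding dup_swap[OF below(2) y(2)] Suc by (simp add: whisker_laws numeral_2_eq_2)
    finally show ?thesis .
  qed
qed simp

text \<open>Tuples compose like the index functions that they encode, contravariantly.\<close>

lemma tuple_comp:
  "below v q \<Longrightarrow> below (length q) p \<Longrightarrow> tuple v q \<odot> tuple (length q) p = tuple v (map ((!) q) p)"
proof (induction p)
  case Nil
  then show ?case by (simp add: tuple_dels)
next
  case (Cons x p)
  have "tuple v q \<odot> tuple (length q) (x # p) = (tuple v q \<odot> dup x (length q)) \<odot> (I 1 \<otimes> tuple (length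
      q) p)"
    by (simp add: sq_assoc)
  also have "\<dots> = dup (q ! x) v \<odot> (I 1 \<otimes> (tuple v q \<odot> tuple (length q) p))"
    using Cons.prems by (subst tuple_dup) (simp_all add: I_tn_sq sq_assoc)
  finally show ?case using Cons by simp
qed

text \<open>No output refers to the front wire, so the copying steps slide past it until it is
  discarded.\<close>

lemma tuple_Suc: "below v p \<Longrightarrow> tuple (Suc v) (map Suc p) = \<epsilon> \<otimes> tuple v p"
proof (induction p)
  case (Cons x p)
  have below: "below v p" "x < v" using Cons.prems by auto
  have "tuple (Suc v) (map Suc (x # p)) = (I 1 \<otimes> dup x v) \<odot> (Sy 1 1 \<otimes> I v) \<odot> (I 1 \<otimes> \<epsilon> \<otimes> tuple v p)"
    using Cons by (simp add: whisker_laws)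
  also have "I 1 \<otimes> \<epsilon> \<otimes> tuple v p = (I 1 \<otimes> \<epsilon> \<otimes> I v) \<odot> (I 1 \<otimes> tuple v p)"
    using tn_split(1)[of "I 1 \<otimes> \<epsilon>" "tuple v p"] below by (simp add: arrow_tys tn_assoc)
  also have "(I 1 \<otimes> dup x v) \<odot> (Sy 1 1 \<otimes> I v) \<odot> (I 1 \<otimes> \<epsilon> \<otimes> I v) \<odot> (I 1 \<otimes> tuple v p) =
      (I 1 \<otimes> dup x v) \<odot> ((Sy 1 1 \<odot> (I 1 \<otimes> \<epsilon>)) \<otimes> I v) \<odot> (I 1 \<otimes> tuple v p)"
    by (simp add: whisker_laws)
  also have "\<dots> = ((I 1 \<otimes> dup x v) \<odot> (\<epsilon> \<otimes> I (Suc v))) \<odot> (I 1 \<otimes> tuple v p)"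
    unfolding sym_eps by (simp add: whisker_laws)
  also have "(I 1 \<otimes> dup x v) \<odot> (\<epsilon> \<otimes> I (Suc v)) = (\<epsilon> \<otimes> I v) \<odot> (I 0 \<otimes> dup x v)"
    using below by (intro exchange[symmetric]) (simp_all add: arrow_tys)
  also have "((\<epsilon> \<otimes> I v) \<odot> (I 0 \<otimes> dup x v)) \<odot> (I 1 \<otimes> tuple v p) = \<epsilon> \<otimes> tuple v (x # p)"
    using below tn_split(1)[of \<epsilon> "tuple v (x # p)"] by (simp add: arrow_tys unit_laws sq_assoc)
  finally show ?case .
qed simp

lemma tuple_new:
  assumes "below v p"
  shows "tuple (Suc v) (0 # map Suc p) = I 1 \<otimes> tuple v p"
proof -
  have "tuple (Suc v) (0 # map Suc p) = (\<delta> \<otimes> I v) \<odot> (I 1 \<otimes> \<epsilon> \<otimes> tuple v p)"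
    using assms by (simp add: tuple_Suc)
  also have "I 1 \<otimes> \<epsilon> \<otimes> tuple v p = (I 1 \<otimes> \<epsilon> \<otimes> I v) \<odot> (I 1 \<otimes> tuple v p)"
    using tn_split(1)[of "I 1 \<otimes> \<epsilon>" "tuple v p"] assms by (simp add: arrow_tys tn_assoc)
  also have "(\<delta> \<otimes> I v) \<odot> (I 1 \<otimes> \<epsilon> \<otimes> I v) \<odot> (I 1 \<otimes> tuple v p) = ((\<delta> \<odot> (I 1 \<otimes> \<epsilon>)) \<otimes> I v) \<odot> (I 1 \<otimes>
      tuple v p)"
    by (simp add: whisker_laws)
  finally show ?thesis
    using assms by (simp add: de_counit2[unfolded One_nat_def] whisker_laws unit_laws arrow_tys)
qed

lemma tuple_id: "tuple v [0..<v] = I v"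
proof (induction v)
  case (Suc v)
  have "[0..<Suc v] = 0 # map Suc [0..<v]"
    by (simp add: upt_conv_Cons map_Suc_upt del: upt_Suc)
  then show ?case using tuple_new[where v = v and p = "[0..<v]"] Suc by (simp add: I_tn
      atLeast0LessThan del: upt_Suc tuple.simps)
qed simp

text \<open>\<open>v\<close> fresh nodes of which node \<open>p ! i\<close> is connected to the output \<open>i\<close>.\<close>

definition spider :: "nat \<Rightarrow> nat list \<Rightarrow> 'a" where
  "spider v p = news v \<odot> tuple v p"

lemma spider_typ:
  assumes "below v p"
  shows "arr (spider v p)" "dm (spider v p) = 0" "cd (spider v p) = length p"
  using assms by (simp_all add: spider_def arrow_tys)

lemma spider_new:
  assumes "below v p"
  shows "spider v p \<odot> (\<eta> \<otimes> I (length p)) = spider (Suc v) (0 # map Suc p)"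
proof -
  have "spider v p \<odot> (\<eta> \<otimes> I (length p)) = \<eta> \<otimes> spider v p"
    using tn_split(2)[of \<eta> "spider v p"] assms by (simp add: spider_typ arrow_ty unit_laws)
  also have "\<dots> = (\<eta> \<otimes> news v) \<odot> (I 1 \<otimes> tuple v p)"
    using interchange[of \<eta> "I 1" "news v" "tuple v p"] assms by (simp add: spider_def arrow_tys
        unit_laws)
  finally show ?thesis
    using assms by (simp add: spider_def tuple_new[unfolded One_nat_def] del: tuple.simps)
qed

text \<open>The arrow \<open>f\<close> is built from symmetries by bringing the first entry of
  \<open>q'\<close> to the front. That the same \<open>f\<close> permutes tuples and fixes fresh
  nodes is what makes nodes renameable in \<open>spider_rename\<close>.\<close>

lemma tuple_perm:
  "mset q = mset q' \<Longrightarrow> \<exists>f. arr f \<and> dm f = length q \<and> cd f = length q \<and> news (length q) \<odot> f = news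
      (length q) \<and>
     (\<forall>v. below v q \<longrightarrow> tuple v q \<odot> f = tuple v q')"
proof (induction q' arbitrary: q)
  case Nil
  then show ?case by (intro exI[of _ "I 0"]) (auto simp: arrow_tys unit_laws)
next
  case (Cons x q')
  then have "x \<in> set q" by (metis list.set_intros(1) set_mset_mset)
  then obtain u w where q: "q = u @ x # w" by (meson split_list)
  with Cons.prems have "mset (u @ w) = mset q'" by simp
  from Cons.IH[OF this] obtain f where f: "arr f" "dm f = length (u @ w)" "cd f = length (u @ w)"
      "news (length (u @ w)) \<odot> f = news (length (u @ w))" "\<And>v. below v (u @ w) \<Longrightarrow> tuple v (u @ w) \<odot> f
          = tuple v q'"
    by blast
  let ?g = "(Sy (length u) 1 \<otimes> I (length w)) \<odot> (I 1 \<otimes> f)"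
  have "news (length q) \<odot> ?g = ((news (length u + 1) \<otimes> news (length w)) \<odot> (Sy (length u) 1 \<otimes> I
      (length w))) \<odot> (I 1 \<otimes> f)"
    using news_add[of "length u + 1" "length w"] by (simp add: q sq_assoc)
  also have "(news (length u + 1) \<otimes> news (length w)) \<odot> (Sy (length u) 1 \<otimes> I (length w)) = news
      (length u + 1) \<otimes> news (length w)"
    using interchange[of "news (length u + 1)" "Sy (length u) 1" "news (length w)" "I (length w)"]
    by (simp add: arrow_tys unit_laws news_Sy[of _ 1, simplified])
  also have "\<dots> = \<eta> \<otimes> news (length (u @ w))"
    using news_add[of "length u + 1" "length w"] by simp
  also have "\<dots> \<odot> (I 1 \<otimes> f) = \<eta> \<otimes> (news (length (u @ w)) \<odot> f)"
    using interchange[of \<eta> "I 1" "news (length (u @ w))" f] f by (simp add: arrow_tys unit_laws)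
  finally have "news (length q) \<odot> ?g = news (length q)"
    using f by (simp add: q)
  moreover have "tuple v q \<odot> ?g = tuple v (x # q')" if "below v q" for v
  proof -
    have "tuple v q \<odot> ?g = (tuple v (u @ [x] @ w) \<odot> (Sy (length u) (length [x]) \<otimes> I (length w))) \<odot>
        (I 1 \<otimes> f)"
      by (simp add: q sq_assoc)
    also have "\<dots> = tuple v ([x] @ u @ w) \<odot> (I (length [x]) \<otimes> f)"
      using that q by (subst tuple_block) auto
    also have "\<dots> = tuple v ([x] @ q')"
      using that q f by (intro tuple_prefix) auto
    finally show ?thesis by simp
  qed
  ultimately show ?case using f by (intro exI[of _ ?g]) (simp add: arrow_ty q)
qed

lemma spider_rename:
  assumes "\<pi> permutes {..<v}" "below v p"
  shows "spider v (map \<pi> p) = spider v p"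
proof -
  let ?q = "map \<pi> [0..<v]"
  have "mset ?q = mset [0..<v]"
    using assms(1) by (metis mset_map mset_upt image_mset_mset_set permutes_image permutes_inj_on
        atLeast0LessThan)
  then obtain f where f: "news v \<odot> f = news v" "tuple v [0..<v] \<odot> f = tuple v ?q" "arr f" "dm f = v"
    using tuple_perm[of "[0..<v]" ?q] by auto
  have okq: "below v ?q" using permutes_image[OF assms(1)] by (auto simp: atLeast0LessThan)
  have eq: "map \<pi> p = map ((!) ?q) p" using assms(2) by auto
  have "spider v (map \<pi> p) = news v \<odot> tuple v ?q \<odot> tuple v p"
    unfolding spider_def eq using tuple_comp[OF okq, of p] assms(2) by simp
  \<comment> \<open>The tuple of \<open>[0..<v]\<close> is the identity, so \<open>f\<close> itself
    is the renaming of the wires, and the fresh nodes absorb it.\<close>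
  also have "tuple v ?q = f" using f by (simp add: tuple_id unit_laws)
  finally show ?thesis by (simp add: spider_def sq_ext[OF f(1)])
qed

end

section \<open>Merging nodes\<close>

context frobenius_prop
begin

text \<open>By the Frobenius law, a fresh node merged with an existing wire is not a new node but a
  further copy of that wire.\<close>

lemma cap_mu: "(\<eta> \<otimes> I 1) \<odot> (\<delta> \<otimes> I 1) \<odot> (I 1 \<otimes> Sy 1 1) \<odot> (\<mu> \<otimes> I 1) = \<delta>"
proof -
  have "(Sy 1 1 \<otimes> I 1) \<odot> (Sy 1 1 \<otimes> I 1) = I 3"
    unfolding sq_tn_I[symmetric] Sy_inv by (simp add: I_tn numeral_3_eq_3)
  then have "Sy 1 1 \<odot> (I 1 \<otimes> \<delta>) \<odot> (Sy 1 1 \<otimes> I 1) = (\<delta> \<otimes> I 1) \<odot> (I 1 \<otimes> Sy 1 1)"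
    using sq_ext[OF sym_delta, of "Sy 1 1 \<otimes> I 1"] by (simp add: sq_assoc unit_laws arrow_ty)
  then have "(\<eta> \<otimes> I 1) \<odot> (\<delta> \<otimes> I 1) \<odot> (I 1 \<otimes> Sy 1 1) \<odot> (\<mu> \<otimes> I 1) =
      ((\<eta> \<otimes> I 1) \<odot> Sy 1 1) \<odot> (I 1 \<otimes> \<delta>) \<odot> ((Sy 1 1 \<odot> \<mu>) \<otimes> I 1)"
    by (metis sq_assoc sq_tn_I)
  also have "\<dots> = ((I 1 \<otimes> \<eta>) \<odot> \<mu>) \<odot> \<delta>"
    unfolding sym_eta mu_comm frob2 by (simp add: sq_assoc)
  finally show ?thesis by (simp add: mu_unit2[unfolded One_nat_def] unit_laws arrow_ty)
qed

text \<open>The identity \<open>cap_mu\<close> at wire \<open>x\<close> among \<open>v\<close>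
  wires; the copying of \<open>x\<close> is first slid past the fresh cap.\<close>

lemma dup_merge:
  assumes "x < v"
  shows "(\<eta> \<otimes> I v) \<odot> dup 0 (Suc v) \<odot> (I 1 \<otimes> dup (Suc x) (Suc v)) \<odot> (\<mu> \<otimes> I (Suc v)) = dup x v \<odot> (I 1
      \<otimes> dup x v)"
proof -
  have ex: "((\<eta> \<odot> \<delta>) \<otimes> I v) \<odot> (I 2 \<otimes> dup x v) = (I 0 \<otimes> dup x v) \<odot> ((\<eta> \<odot> \<delta>) \<otimes> I (Suc v))"
    using assms by (intro exchange) (simp_all add: arrow_tys)
  have "(\<eta> \<otimes> I v) \<odot> dup 0 (Suc v) \<odot> (I 1 \<otimes> dup (Suc x) (Suc v)) \<odot> (\<mu> \<otimes> I (Suc v)) =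
      (((\<eta> \<odot> \<delta>) \<otimes> I v) \<odot> (I 2 \<otimes> dup x v)) \<odot> (I 1 \<otimes> Sy 1 1 \<otimes> I v) \<odot> (\<mu> \<otimes> I (Suc v))"
    by (simp add: whisker_laws numeral_2_eq_2)
  also have "\<dots> = dup x v \<odot> (((\<eta> \<otimes> I 1) \<odot> (\<delta> \<otimes> I 1) \<odot> (I 1 \<otimes> Sy 1 1) \<odot> (\<mu> \<otimes> I 1)) \<otimes> I v)"
    unfolding ex using assms by (simp add: whisker_laws unit_laws dup_typ)
  also have "\<dots> = dup x v \<odot> (I 1 \<otimes> dup x v)"
    unfolding cap_mu using assms by (rule dup_delta)
  finally show ?thesis .
qed

text \<open>The list \<open>x # [0..<v]\<close> encodes the quotient map: node 0 is identified with
  node \<open>Suc x\<close>, which is now called \<open>x\<close>, and the other nodes shift down by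
  one.\<close>

lemma spider_merge:
  assumes "x < v" "below (Suc v) p"
  shows "spider (Suc v) (0 # Suc x # p) \<odot> (\<mu> \<otimes> I (length p)) = spider v (x # map ((!) (x # [0..<v])) p)"
proof -
  have ex: "(I 2 \<otimes> tuple (Suc v) p) \<odot> (\<mu> \<otimes> I (length p)) = (\<mu> \<otimes> I (Suc v)) \<odot> (I 1 \<otimes> tuple (Suc v) p)"
    using assms by (intro exchange[symmetric]) (simp_all add: arrow_tys)
  have Dx: "dup x v = tuple v (x # [0..<v])"
    using assms by (simp add: tuple_id I_tn unit_laws arrow_tys)
  have news: "news (Suc v) = news v \<odot> (\<eta> \<otimes> I v)"
    using tn_split(2)[of \<eta> "news v"] by (simp add: arrow_tys unit_laws)
  have "spider (Suc v) (0 # Suc x # p) \<odot> (\<mu> \<otimes> I (length p)) =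
    news v \<odot> (\<eta> \<otimes> I v) \<odot> dup 0 (Suc v) \<odot> (I 1 \<otimes> dup (Suc x) (Suc v)) \<odot> (I 2 \<otimes> tuple (Suc v) p) \<odot> (\<mu>
        \<otimes> I (length p))"
    unfolding spider_def news by (simp add: whisker_laws numeral_2_eq_2)
  also have "\<dots> = news v \<odot> ((\<eta> \<otimes> I v) \<odot> dup 0 (Suc v) \<odot> (I 1 \<otimes> dup (Suc x) (Suc v)) \<odot> (\<mu> \<otimes> I (Suc
      v))) \<odot> (I 1 \<otimes> tuple (Suc v) p)"
    unfolding ex by (simp only: sq_assoc)
  also have "\<dots> = news v \<odot> dup x v \<odot> (I 1 \<otimes> (dup x v \<odot> tuple (Suc v) p))"
    unfolding dup_merge[OF assms(1)] by (simp only: sq_assoc I_tn_sq)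
  also have "dup x v \<odot> tuple (Suc v) p = tuple v (map ((!) (x # [0..<v])) p)"
    using tuple_comp[where v = v and q = "x # [0..<v]" and p = p] assms unfolding Dx by (simp add:
        atLeast0LessThan del: tuple.simps)
  finally show ?thesis by (simp add: spider_def)
qed

text \<open>If both wires come from one node, the special law removes the merge. Otherwise a
  transposition renames \<open>x\<close> to 0, the position that \<open>spider_merge\<close>
  expects.\<close>

lemma spider_mu:
  assumes "below v (x # y # p)"
  shows "\<exists>v' \<rho>. (\<forall>z<v. \<rho> z < v') \<and> spider v (x # y # p) \<odot> (\<mu> \<otimes> I (length p)) = spider v' (\<rho> x # map \<rho> p)"
proof (cases "x = y")
  case True
  have "spider v (x # y # p) \<odot> (\<mu> \<otimes> I (length p)) = spider v (x # p) \<odot> ((\<delta> \<odot> \<mu>) \<otimes> I (length p))"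
    using assms True sq_ext[OF tuple_delta[where x = x and v = v and p = p], of "\<mu> \<otimes> I (length p)"]
        by (simp add: spider_def whisker_laws)
  also have "\<dots> = spider v (x # p)"
    unfolding special using assms by (simp add: I_tn unit_laws spider_typ)
  finally show ?thesis by (intro exI[of _ v] exI[of _ id]) simp
next
  case False
  obtain w where v: "v = Suc w" using assms by (cases v) auto
  define \<tau> where "\<tau> = transpose 0 x"
  have \<tau>: "\<tau> permutes {..<v}"
    using assms unfolding \<tau>_def v by (intro permutes_swap_id) auto
  have "\<tau> y \<noteq> 0" using False by (auto simp: \<tau>_def transpose_def)
  moreover have \<tau>v: "\<tau> z < v" if "z < v" for z using permutes_in_image[OF \<tau>] that by simp
  ultimately obtain y' where y': "\<tau> y = Suc y'" "y' < w"
    using assms v by (metis Suc_less_eq insert_subset lessThan_iff list.simps(15) not0_implies_Suc)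
  have \<tau>x: "\<tau> x = 0" by (simp add: \<tau>_def)
  let ?\<rho> = "\<lambda>z. (y' # [0..<w]) ! \<tau> z"
  have "spider v (x # y # p) = spider (Suc w) (0 # Suc y' # map \<tau> p)"
    using spider_rename[OF \<tau> assms] v y' \<tau>x by simp
  then have "spider v (x # y # p) \<odot> (\<mu> \<otimes> I (length p)) = spider w (y' # map ((!) (y' # [0..<w]))
      (map \<tau> p))"
    using spider_merge[of y' w "map \<tau> p"] y' assms \<tau>v v by (auto simp: subset_iff)
  moreover have "?\<rho> z < w" if "z < v" for z
    using \<tau>v[OF that] v y' by (cases "\<tau> z") auto
  ultimately show ?thesis
    using \<tau>x by (intro exI[of _ w] exI[of _ ?\<rho>]) (simp add: comp_def)
qed

subsection \<open>Caps and cups\<close>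

text \<open>The nested caps and cups connect wire \<open>i\<close> to the \<open>i\<close>-th wire from the end. For them the snake
  equation needs no symmetries; the price is the list reversal in \<open>ports\<close>.\<close>

primrec Cap :: "nat \<Rightarrow> 'a" where
  "Cap 0 = I 0"
| "Cap (Suc n) = (\<eta> \<odot> \<delta>) \<odot> (I 1 \<otimes> Cap n \<otimes> I 1)"

primrec Cup :: "nat \<Rightarrow> 'a" where
  "Cup 0 = I 0"
| "Cup (Suc n) = (I n \<otimes> (\<mu> \<odot> \<epsilon>) \<otimes> I n) \<odot> Cup n"

lemma Cap_typ: "arr (Cap n)" "dm (Cap n) = 0" "cd (Cap n) = n + n"
  by (induction n) (simp_all add: arrow_ty)

lemma Cup_typ: "arr (Cup n)" "dm (Cup n) = n + n" "cd (Cup n) = 0"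
  by (induction n) (simp_all add: arrow_ty)

text \<open>The Frobenius law separates the unit law from the counit law.\<close>

lemma snake1: "(I 1 \<otimes> (\<eta> \<odot> \<delta>)) \<odot> ((\<mu> \<odot> \<epsilon>) \<otimes> I 1) = I 1"
proof -
  have "(I 1 \<otimes> (\<eta> \<odot> \<delta>)) \<odot> ((\<mu> \<odot> \<epsilon>) \<otimes> I 1) = (I 1 \<otimes> \<eta>) \<odot> ((I 1 \<otimes> \<delta>) \<odot> (\<mu> \<otimes> I 1)) \<odot> (\<epsilon> \<otimes> I 1)"
    by (simp only: I_tn_sq sq_tn_I sq_assoc)
  also have "\<dots> = ((I 1 \<otimes> \<eta>) \<odot> \<mu>) \<odot> (\<delta> \<odot> (\<epsilon> \<otimes> I 1))"
    unfolding frob2 by (simp only: sq_assoc)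
  finally show ?thesis unfolding mu_unit2 de_counit by (simp add: unit_laws arrow_ty)
qed

text \<open>The outermost cap is adjacent to the innermost cup. The fact \<open>ex\<close> moves the
  remaining caps past that cup, so that \<open>snake1\<close> and the induction hypothesis
  apply.\<close>

lemma snake: "(I n \<otimes> Cap n) \<odot> (Cup n \<otimes> I n) = I n"
proof (induction n)
  case 0
  then show ?case by (simp add: arrow_ty unit_laws)
next
  case (Suc n)
  let ?cap = "\<eta> \<odot> \<delta>" and ?cup = "\<mu> \<odot> \<epsilon>"
  have ex: "(I (Suc (Suc n)) \<otimes> Cap n) \<odot> (I n \<otimes> ?cup \<otimes> I (n + n)) = (I n \<otimes> ?cup) \<odot> (I n \<otimes> Cap n)"
    using exchange[of "I n \<otimes> ?cup" "Cap n" 0 n "Suc (Suc n)" "n + n"]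
    by (simp add: arrow_ty Cap_typ unit_laws whisker_laws numeral_2_eq_2)
  have "(I (Suc n) \<otimes> Cap (Suc n)) \<odot> (Cup (Suc n) \<otimes> I (Suc n)) =
    (I (Suc n) \<otimes> ?cap) \<odot> (((I (Suc (Suc n)) \<otimes> Cap n) \<odot> (I n \<otimes> ?cup \<otimes> I (n + n))) \<otimes> I 1) \<odot> (Cup n \<otimes> I
        (Suc n))"
    by (simp add: whisker_laws)
  also have "\<dots> = (I n \<otimes> ((I 1 \<otimes> ?cap) \<odot> (?cup \<otimes> I 1))) \<odot> (((I n \<otimes> Cap n) \<odot> (Cup n \<otimes> I n)) \<otimes> I 1)"
    unfolding ex by (simp add: whisker_laws)
  also have "\<dots> = I (Suc n)"
    unfolding snake1 Suc by (simp add: whisker_laws unit_laws arrow_ty)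
  finally show ?case .
qed

text \<open>Shows that bending is injective, which reduces equations between arrows to equations
  between states.\<close>

lemma unbend:
  assumes "arr f" "dm f = n" "cd f = m"
  shows "(I n \<otimes> (Cap n \<odot> (I n \<otimes> f))) \<odot> (Cup n \<otimes> I m) = f"
proof -
  have ex: "(Cup n \<otimes> I n) \<odot> (I 0 \<otimes> f) = (I (n + n) \<otimes> f) \<odot> (Cup n \<otimes> I m)"
    using assms by (intro exchange) (simp_all add: Cup_typ)
  have "(I n \<otimes> (Cap n \<odot> (I n \<otimes> f))) \<odot> (Cup n \<otimes> I m) = (I n \<otimes> Cap n) \<odot> (I (n + n) \<otimes> f) \<odot> (Cup n \<otimes> I m)"
    by (simp add: whisker_laws)
  also have "\<dots> = ((I n \<otimes> Cap n) \<odot> (Cup n \<otimes> I n)) \<odot> (I 0 \<otimes> f)"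
    unfolding ex[symmetric] by (simp only: sq_assoc)
  finally show ?thesis unfolding snake using assms by (simp add: unit_laws)
qed

text \<open>The counterpart for outputs; it replaces a generator by its bent form preceded by
  caps.\<close>

lemma unbend2:
  assumes "arr f" "dm f = n" "cd f = m"
  shows "(I n \<otimes> Cap m) \<odot> (((f \<otimes> I m) \<odot> Cup m) \<otimes> I m) = f"
proof -
  have ex: "(f \<otimes> I 0) \<odot> (I m \<otimes> Cap m) = (I n \<otimes> Cap m) \<odot> (f \<otimes> I (m + m))"
    using assms by (intro exchange) (simp_all add: Cap_typ)
  have "(I n \<otimes> Cap m) \<odot> (((f \<otimes> I m) \<odot> Cup m) \<otimes> I m) = ((I n \<otimes> Cap m) \<odot> (f \<otimes> I (m + m))) \<odot> (Cup m \<otimes> I m)"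
    by (simp add: whisker_laws)
  also have "\<dots> = (f \<otimes> I 0) \<odot> ((I m \<otimes> Cap m) \<odot> (Cup m \<otimes> I m))"
    unfolding ex[symmetric] by (simp only: sq_assoc)
  finally show ?thesis unfolding snake using assms by (simp add: unit_laws)
qed

section \<open>Arrows that carry spiders to spiders\<close>

lemma spider_prefix:
  assumes "tuple v q \<odot> f = tuple v q'" "below v p" "arr f" "below v q"
  shows "spider v (p @ q) \<odot> (I (length p) \<otimes> f) = spider v (p @ q')"
  using tuple_prefix[OF assms] by (simp add: spider_def sq_assoc)

lemma spider_block:
  assumes "below v (p @ q @ r @ w)"
  shows "spider v (p @ q @ r @ w) \<odot> (I (length p) \<otimes> Sy (length q) (length r) \<otimes> I (length w)) =
      spider v (p @ r @ q @ w)"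
  using assms by (intro spider_prefix tuple_block) (auto simp: arrow_ty)

lemma spider_eta:
  assumes "below v (s @ p)"
  shows "spider v (s @ p) \<odot> (I (length s) \<otimes> \<eta> \<otimes> I (length p)) = spider (Suc v) (map Suc s @ 0 # map
      Suc p)"
proof -
  have "I (length s) \<otimes> \<eta> = (\<eta> \<otimes> I (length s)) \<odot> Sy 1 (length s)"
    using Sy_natural[of \<eta> "I (length s)"] by (simp add: arrow_ty Sy_0l unit_laws)
  then have "spider v (s @ p) \<odot> (I (length s) \<otimes> \<eta> \<otimes> I (length p)) =
      (spider v (s @ p) \<odot> (\<eta> \<otimes> I (length (s @ p)))) \<odot> (Sy 1 (length s) \<otimes> I (length p))"
    by (simp add: tn_assoc[symmetric]) (simp add: whisker_laws)
  also have "\<dots> = spider (Suc v) ([] @ [0] @ map Suc s @ map Suc p) \<odot>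
     (I (length ([] :: nat list)) \<otimes> Sy (length [0 :: nat]) (length (map Suc s)) \<otimes> I (length (map Suc
         p)))"
    using assms by (subst spider_new) (simp_all add: unit_laws arrow_ty)
  also have "\<dots> = spider (Suc v) ([] @ map Suc s @ [0] @ map Suc p)"
    using assms by (intro spider_block) auto
  finally show ?thesis by simp
qed

text \<open>Each cap contributes a fresh node with two outputs, and the nesting lists these outputs
  as \<open>rev t @ t\<close>.\<close>

lemma spider_cap:
  "below v (s @ p) \<Longrightarrow> \<exists>v' \<rho> t. (\<forall>z<v. \<rho> z < v') \<and> below v' t \<and> length t = b \<and>
     spider v (s @ p) \<odot> (I (length s) \<otimes> Cap b \<otimes> I (length p)) = spider v' (map \<rho> s @ rev t @ t @ map
         \<rho> p)"
proof (induction b arbitrary: v s p)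
  case 0
  then show ?case
    by (intro exI[of _ v] exI[of _ id] exI[of _ "[]"]) (simp add: I_tn unit_laws spider_typ)
next
  case (Suc b)
  let ?s = "map Suc s @ [0]" and ?p = "0 # map Suc p"
  have below: "below (Suc v) (?s @ ?p)" using Suc.prems by auto
  have "spider v (s @ p) \<odot> (I (length s) \<otimes> Cap (Suc b) \<otimes> I (length p)) =
      ((spider v (s @ p) \<odot> (I (length s) \<otimes> \<eta> \<otimes> I (length p))) \<odot> (I (length (map Suc s)) \<otimes> \<delta> \<otimes> I
          (length (map Suc p)))) \<odot>
      (I (length ?s) \<otimes> Cap b \<otimes> I (length ?p))"
    by (simp add: whisker_laws)
  also have "\<dots> = spider (Suc v) (map Suc s @ 0 # 0 # map Suc p) \<odot> (I (length ?s) \<otimes> Cap b \<otimes> I (length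
      ?p))"
    using Suc.prems by (subst spider_eta, simp, subst spider_prefix[OF tuple_delta]) (auto simp:
        arrow_ty)
  finally have eq: "spider v (s @ p) \<odot> (I (length s) \<otimes> Cap (Suc b) \<otimes> I (length p)) =
      spider (Suc v) (?s @ ?p) \<odot> (I (length ?s) \<otimes> Cap b \<otimes> I (length ?p))"
    by simp
  from Suc.IH[OF below] obtain v' \<rho> t where 1: "\<forall>z<Suc v. \<rho> z < v'" "below v' t" "length t = b"
    "spider (Suc v) (?s @ ?p) \<odot> (I (length ?s) \<otimes> Cap b \<otimes> I (length ?p)) = spider v' (map \<rho> ?s @ rev
        t @ t @ map \<rho> ?p)"
    by blast
  then show ?case
    unfolding eq by (intro exI[of _ v'] exI[of _ "\<rho> \<circ> Suc"] exI[of _ "t @ [\<rho> 0]"]) (auto simp: comp_def)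
qed

text \<open>Postcomposition of a spider with such an arrow is again a spider, possibly with its nodes renamed,
  merged or extended by \<open>\<rho>\<close>.\<close>

definition reroutes :: "'a \<Rightarrow> bool" where
  "reroutes f \<longleftrightarrow> arr f \<and> (\<forall>v r p. below v (r @ p) \<longrightarrow> length r = dm f \<longrightarrow>
     (\<exists>v' \<rho> r'. (\<forall>z<v. \<rho> z < v') \<and> below v' r' \<and> length r' = cd f \<and>
        spider v (r @ p) \<odot> (f \<otimes> I (length p)) = spider v' (r' @ map \<rho> p)))"

lemma reroutes_sq:
  assumes f: "reroutes f" and g: "reroutes g" and "cd f = dm g"
  shows "reroutes (f \<odot> g)"
  unfolding reroutes_def
proof (intro conjI allI impI)
  show "arr (f \<odot> g)" using assms by (simp add: reroutes_def arrow_ty)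
  fix v r p assume 1: "below v (r @ p)" "length r = dm (f \<odot> g)"
  then have "length r = dm f" using assms by (simp add: reroutes_def arrow_ty)
  with f 1 obtain v' \<rho> r' where 2: "\<forall>z<v. \<rho> z < v'" "below v' r'" "length r' = cd f"
    "spider v (r @ p) \<odot> (f \<otimes> I (length p)) = spider v' (r' @ map \<rho> p)"
    unfolding reroutes_def by blast
  have "below v' (r' @ map \<rho> p)" using 1 2 by auto
  with g 2(3) assms(3) obtain v'' \<rho>' r'' where 3: "\<forall>z<v'. \<rho>' z < v''" "below v'' r''" "length r'' = cd g"
    "spider v' (r' @ map \<rho> p) \<odot> (g \<otimes> I (length (map \<rho> p))) = spider v'' (r'' @ map \<rho>' (map \<rho> p))"
    unfolding reroutes_def by metis
  have "spider v (r @ p) \<odot> ((f \<odot> g) \<otimes> I (length p)) = spider v'' (r'' @ map (\<rho>' \<circ> \<rho>) p)"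
    using sq_ext[OF 2(4), of "g \<otimes> I (length p)"] 3(4) by (simp add: sq_tn_I sq_assoc)
  then show "\<exists>v' \<rho> r'. (\<forall>z<v. \<rho> z < v') \<and> below v' r' \<and> length r' = cd (f \<odot> g) \<and>
      spider v (r @ p) \<odot> ((f \<odot> g) \<otimes> I (length p)) = spider v' (r' @ map \<rho> p)"
    using 2 3 assms by (intro exI[of _ v''] exI[of _ "\<rho>' \<circ> \<rho>"] exI[of _ r'']) (simp add:
        reroutes_def arrow_ty)
qed

lemma reroutes_tn_I:
  assumes f: "reroutes f"
  shows "reroutes (f \<otimes> I k)"
  unfolding reroutes_def
proof (intro conjI allI impI)
  have a: "arr f" using f by (simp add: reroutes_def)
  then show "arr (f \<otimes> I k)" by (simp add: arrow_ty)
  fix v r p assume 1: "below v (r @ p)" "length r = dm (f \<otimes> I k)"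
  define s u where "s = take (dm f) r" and "u = drop (dm f) r"
  have su: "r = s @ u" "length s = dm f" "length u = k"
    using 1 a by (simp_all add: s_def u_def arrow_ty)
  have "below v (s @ u @ p)" using 1 su by simp
  with f su obtain v' \<rho> r' where 2: "\<forall>z<v. \<rho> z < v'" "below v' r'" "length r' = cd f"
    "spider v (s @ u @ p) \<odot> (f \<otimes> I (length (u @ p))) = spider v' (r' @ map \<rho> (u @ p))"
    unfolding reroutes_def by blast
  then show "\<exists>v' \<rho> r'. (\<forall>z<v. \<rho> z < v') \<and> below v' r' \<and> length r' = cd (f \<otimes> I k) \<and>
      spider v (r @ p) \<odot> ((f \<otimes> I k) \<otimes> I (length p)) = spider v' (r' @ map \<rho> p)"
    using 1 su a by (intro exI[of _ v'] exI[of _ \<rho>] exI[of _ "r' @ map \<rho> u"]) (auto simp: arrow_ty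
        whisker_laws)
qed

lemma reroutes_Sy: "reroutes (Sy n m)"
  unfolding reroutes_def
proof (intro conjI allI impI)
  fix v r p assume 1: "below v (r @ p)" "length r = dm (Sy n m)"
  define s u where "s = take n r" and "u = drop n r"
  have su: "r = s @ u" "length s = n" "length u = m"
    using 1 by (simp_all add: s_def u_def arrow_ty)
  then show "\<exists>v' \<rho> r'. (\<forall>z<v. \<rho> z < v') \<and> below v' r' \<and> length r' = cd (Sy n m) \<and>
      spider v (r @ p) \<odot> (Sy n m \<otimes> I (length p)) = spider v' (r' @ map \<rho> p)"
    using 1 spider_block[where v = v and p = "[]" and q = s and r = u and w = p] by (intro exI[of _
        v] exI[of _ id] exI[of _ "u @ s"]) (simp add: arrow_ty unit_laws)
qed (simp add: arrow_ty)

text \<open>By \<open>slide_left\<close> this follows from closure under composition and right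
  whiskering, since symmetries reroute.\<close>

lemma reroutes_I_tn:
  assumes "reroutes f"
  shows "reroutes (I k \<otimes> f)"
proof -
  have "arr f" using assms by (simp add: reroutes_def)
  then show ?thesis
    using assms by (simp add: slide_left reroutes_sq reroutes_tn_I reroutes_Sy arrow_ty)
qed

lemma reroutes_frob: "reroutes \<mu>" "reroutes \<eta>" "reroutes \<delta>" "reroutes \<epsilon>"
proof -
  show "reroutes \<mu>"
    unfolding reroutes_def
  proof (intro conjI allI impI)
    fix v r p assume 1: "below v (r @ p)" "length r = dm \<mu>"
    then obtain x y where r: "r = [x, y]"
      by (auto simp: arrow_ty numeral_2_eq_2 length_Suc_conv)
    with 1 spider_mu[of x y p v] obtain v' \<rho> where "\<forall>z<v. \<rho> z < v'"
      "spider v (x # y # p) \<odot> (\<mu> \<otimes> I (length p)) = spider v' (\<rho> x # map \<rho> p)" by auto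
    then show "\<exists>v' \<rho> r'. (\<forall>z<v. \<rho> z < v') \<and> below v' r' \<and> length r' = cd \<mu> \<and>
      spider v (r @ p) \<odot> (\<mu> \<otimes> I (length p)) = spider v' (r' @ map \<rho> p)"
      using 1 r by (intro exI[of _ v'] exI[of _ \<rho>] exI[of _ "[\<rho> x]"]) (simp add: arrow_ty)
  qed (simp add: arrow_ty)
  show "reroutes \<eta>"
    unfolding reroutes_def
  proof (intro conjI allI impI)
    fix v r p assume 1: "below v (r @ p)" "length r = dm \<eta>"
    then show "\<exists>v' \<rho> r'. (\<forall>z<v. \<rho> z < v') \<and> below v' r' \<and> length r' = cd \<eta> \<and>
      spider v (r @ p) \<odot> (\<eta> \<otimes> I (length p)) = spider v' (r' @ map \<rho> p)"
      using spider_new[where v = v and p = p]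
      by (intro exI[of _ "Suc v"] exI[of _ Suc] exI[of _ "[0]"]) (simp add: arrow_ty)
  qed (simp add: arrow_ty)
  show "reroutes \<delta>"
    unfolding reroutes_def
  proof (intro conjI allI impI)
    fix v r p assume 1: "below v (r @ p)" "length r = dm \<delta>"
    then obtain x where r: "r = [x]"
      by (auto simp: arrow_ty length_Suc_conv)
    then show "\<exists>v' \<rho> r'. (\<forall>z<v. \<rho> z < v') \<and> below v' r' \<and> length r' = cd \<delta> \<and>
      spider v (r @ p) \<odot> (\<delta> \<otimes> I (length p)) = spider v' (r' @ map \<rho> p)"
      using tuple_delta[where x = x and v = v and p = p] 1
      by (intro exI[of _ v] exI[of _ id] exI[of _ "[x, x]"]) (simp add: arrow_ty spider_def sq_assoc)
  qed (simp add: arrow_ty)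
  show "reroutes \<epsilon>"
    unfolding reroutes_def
  proof (intro conjI allI impI)
    fix v r p assume 1: "below v (r @ p)" "length r = dm \<epsilon>"
    then obtain x where r: "r = [x]"
      by (auto simp: arrow_ty length_Suc_conv)
    then show "\<exists>v' \<rho> r'. (\<forall>z<v. \<rho> z < v') \<and> below v' r' \<and> length r' = cd \<epsilon> \<and>
      spider v (r @ p) \<odot> (\<epsilon> \<otimes> I (length p)) = spider v' (r' @ map \<rho> p)"
      using tuple_eps[where x = x and v = v and p = p] 1
      by (intro exI[of _ v] exI[of _ id] exI[of _ "[]"]) (simp add: arrow_ty spider_def sq_assoc)
  qed (simp add: arrow_ty)
qed

end

subsection \<open>Normal forms\<close>

locale frobenius_gen = frobenius_prop +
  fixes GS :: "'g set" and gen :: "'g \<Rightarrow> 'a" and gar gco :: "'g \<Rightarrow> nat"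
  assumes gen_typ: "g \<in> GS \<Longrightarrow> arr (gen g)" "g \<in> GS \<Longrightarrow> dm (gen g) = gar g" "g \<in> GS \<Longrightarrow> cd (gen g) = gco g"
begin

text \<open>With its outputs bent back a generator is an arrow to 0, so that all hyperedges can
  stand side by side behind a spider.\<close>

definition bent_gen :: "'g \<Rightarrow> 'a" where
  "bent_gen g = (gen g \<otimes> I (gco g)) \<odot> Cup (gco g)"

lemma bent_gen_typ:
  assumes "g \<in> GS"
  shows "arr (bent_gen g)" "dm (bent_gen g) = gar g + gco g" "cd (bent_gen g) = 0"
  using assms by (simp_all add: bent_gen_def arrow_ty gen_typ Cup_typ)

primrec ports :: "('g \<times> nat list \<times> nat list) list \<Rightarrow> nat list" where
  "ports [] = []"
| "ports (e # es) = (case e of (g, s, t) \<Rightarrow> s @ rev t) @ ports es"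

primrec bent_gens :: "('g \<times> nat list \<times> nat list) list \<Rightarrow> 'a" where
  "bent_gens [] = I 0"
| "bent_gens (e # es) = bent_gen (fst e) \<otimes> bent_gens es"

definition wf_edge :: "nat \<Rightarrow> ('g \<times> nat list \<times> nat list) \<Rightarrow> bool" where
  "wf_edge v e = (case e of (g, s, t) \<Rightarrow> g \<in> GS \<and> length s = gar g \<and> length t = gco g \<and> below v s \<and>
      below v t)"

abbreviation wf_edges :: "nat \<Rightarrow> ('g \<times> nat list \<times> nat list) list \<Rightarrow> bool" where
  "wf_edges v es \<equiv> \<forall>e\<in>set es. wf_edge v e"

text \<open>The hypergraph with nodes \<open>{..<v}\<close> and hyperedges \<open>es\<close> whose \<open>i\<close>-th output is the node \<open>r ! i\<close>.\<close>

definition nf :: "nat \<Rightarrow> ('g \<times> nat list \<times> nat list) list \<Rightarrow> nat list \<Rightarrow> 'a" where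
  "nf v es r = spider v (r @ ports es) \<odot> (I (length r) \<otimes> bent_gens es)"

abbreviation map_edge :: "(nat \<Rightarrow> nat) \<Rightarrow> ('g \<times> nat list \<times> nat list) \<Rightarrow> ('g \<times> nat list \<times> nat list)" where
  "map_edge \<rho> \<equiv> map_prod id (map_prod (map \<rho>) (map \<rho>))"

lemma ports_append: "ports (es @ es') = ports es @ ports es'"
  by (induction es) auto

lemma bent_gens_append: "wf_edges v es \<Longrightarrow> wf_edges v es' \<Longrightarrow> bent_gens (es @ es') = bent_gens es \<otimes>
    bent_gens es' \<and> arr (bent_gens es')"
proof -
  have *: "wf_edges v es \<Longrightarrow> arr (bent_gens es)" for es
    by (induction es) (auto simp: wf_edge_def arrow_ty bent_gen_typ)
  show "wf_edges v es \<Longrightarrow> wf_edges v es' \<Longrightarrow> ?thesis"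
    by (induction es) (auto simp: unit_laws * tn_assoc)
qed

lemma below_ports: "wf_edges v es \<Longrightarrow> below v (ports es)"
  by (induction es) (auto simp: wf_edge_def)

lemma bent_gens_typ:
  assumes "wf_edges v es"
  shows "arr (bent_gens es)" "dm (bent_gens es) = length (ports es)" "cd (bent_gens es) = 0"
proof -
  have "arr (bent_gens es) \<and> dm (bent_gens es) = length (ports es) \<and> cd (bent_gens es) = 0"
    using assms by (induction es) (auto simp: wf_edge_def arrow_ty bent_gen_typ)
  then show "arr (bent_gens es)" "dm (bent_gens es) = length (ports es)" "cd (bent_gens es) = 0" by auto
qed

lemma ports_map_edge: "ports (map (map_edge \<rho>) es) = map \<rho> (ports es)"
  by (induction es) (auto simp: rev_map)

lemma bent_gens_map_edge: "bent_gens (map (map_edge \<rho>) es) = bent_gens es"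
  by (induction es) auto

lemma wf_edges_map_edge: "wf_edges v es \<Longrightarrow> \<forall>z<v. \<rho> z < v' \<Longrightarrow> wf_edges v' (map (map_edge \<rho>) es)"
  by (fastforce simp: wf_edge_def)

text \<open>An arrow on the outputs slides past the generators plugged into the ports, so its effect
  is decided on the spider alone.\<close>

lemma nf_step:
  assumes "wf_edges v es" "below v r" "arr f" "dm f = length r" "cd f = length r'"
    and "spider v (r @ ports es) \<odot> (f \<otimes> I (length (ports es))) = spider v' (r' @ map \<rho> (ports es))"
  shows "nf v es r \<odot> f = nf v' (map (map_edge \<rho>) es) r'"
proof -
  have "(I (length r) \<otimes> bent_gens es) \<odot> (f \<otimes> I 0) = (f \<otimes> I (length (ports es))) \<odot> (I (length r') \<otimes>
      bent_gens es)"
    using assms by (intro exchange[symmetric]) (simp_all add: bent_gens_typ)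
  then have "nf v es r \<odot> f = (spider v (r @ ports es) \<odot> (f \<otimes> I (length (ports es)))) \<odot> (I (length
      r') \<otimes> bent_gens es)"
    using assms(1-5) by (simp add: nf_def unit_laws sq_assoc)
  then show ?thesis
    unfolding assms(6) by (simp add: nf_def ports_map_edge bent_gens_map_edge)
qed

definition has_nf :: "nat \<Rightarrow> 'a \<Rightarrow> bool" where
  "has_nf m a \<longleftrightarrow> (\<exists>v es r. wf_edges v es \<and> below v r \<and> length r = m \<and> a = nf v es r)"

lemma has_nf_reroutes:
  assumes "has_nf m a" "reroutes f" "dm f = m" "cd f = m'"
  shows "has_nf m' (a \<odot> f)"
proof -
  obtain v es r where 1: "wf_edges v es" "below v r" "length r = m" "a = nf v es r"
    using assms by (auto simp: has_nf_def)
  then have "below v (r @ ports es)" using below_ports by auto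
  then obtain v' \<rho> r' where 2: "\<forall>z<v. \<rho> z < v'" "below v' r'" "length r' = cd f"
     "spider v (r @ ports es) \<odot> (f \<otimes> I (length (ports es))) = spider v' (r' @ map \<rho> (ports es))"
    using assms 1 unfolding reroutes_def by metis
  have "a \<odot> f = nf v' (map (map_edge \<rho>) es) r'"
    unfolding 1 using assms 1 2 by (intro nf_step) (auto simp: reroutes_def)
  then show ?thesis
    using 1 2 assms wf_edges_map_edge[OF 1(1) 2(1)] unfolding has_nf_def by metis
qed

text \<open>Plugging a generator into the first outputs turns these outputs into ports. A block
  symmetry moves them behind the remaining outputs, where the ports of the first hyperedge
  belong.\<close>

lemma nf_bent_gen:
  assumes "wf_edges v es" "below v (s @ rev t @ w)" "g \<in> GS" "length s = gar g" "length t = gco g"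
  shows "nf v es ((s @ rev t) @ w) \<odot> (bent_gen g \<otimes> I (length w)) = nf v ((g, s, t) # es) w"
proof -
  let ?u = "s @ rev t" and ?ps = "ports es"
  note smc_ty = bent_gens_typ[OF assms(1)] bent_gen_typ[OF assms(3)]
  have below: "below v (w @ ?u @ ?ps)" using assms below_ports by auto
  have "(I (length (?u @ w)) \<otimes> bent_gens es) \<odot> (bent_gen g \<otimes> I (length w)) = bent_gen g \<otimes> I (length
      w) \<otimes> bent_gens es"
    using tn_split(2)[of "bent_gen g \<otimes> I (length w)" "bent_gens es"] assms by (simp add: smc_ty
        arrow_ty unit_laws tn_assoc add.assoc)
  then have "nf v es (?u @ w) \<odot> (bent_gen g \<otimes> I (length w)) = spider v (?u @ w @ ?ps) \<odot> (bent_gen g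
      \<otimes> I (length w) \<otimes> bent_gens es)"
    by (simp add: nf_def sq_assoc)
  also have "spider v (?u @ w @ ?ps) = spider v (w @ ?u @ ?ps) \<odot> (Sy (length w) (length ?u) \<otimes> I
      (length ?ps))"
    using spider_block[where v = v and p = "[]" and q = w and r = ?u and w = ?ps] below by (simp
        add: unit_laws arrow_ty)
  also have "\<dots> \<odot> (bent_gen g \<otimes> I (length w) \<otimes> bent_gens es) =
      spider v (w @ ?u @ ?ps) \<odot> ((Sy (length w) (length ?u) \<odot> (bent_gen g \<otimes> I (length w))) \<otimes>
          bent_gens es)"
    using interchange[of "Sy (length w) (length ?u)" "bent_gen g \<otimes> I (length w)" "I (length ?ps)"
        "bent_gens es"] assms
    by (simp add: smc_ty arrow_ty unit_laws sq_assoc tn_assoc)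
  also have "Sy (length w) (length ?u) \<odot> (bent_gen g \<otimes> I (length w)) = I (length w) \<otimes> bent_gen g"
    using Sy_natural[of "I (length w)" "bent_gen g"] assms by (simp add: smc_ty arrow_ty unit_laws Sy_0)
  finally show ?thesis
    by (simp add: nf_def tn_assoc)
qed

text \<open>By \<open>unbend2\<close> the generator is its bent form behind caps. The caps create
  the target nodes \<open>t\<close> with two legs each: the reversed row is plugged into the bent
  generator, the other row becomes the new outputs.\<close>

lemma has_nf_gen:
  assumes "has_nf (gar g + k) a" and g: "g \<in> GS"
  shows "has_nf (gco g + k) (a \<odot> (gen g \<otimes> I k))"
proof -
  obtain v es r where 1: "wf_edges v es" "below v r" "length r = gar g + k" "a = nf v es r"
    using assms by (auto simp: has_nf_def)
  define s u where "s = take (gar g) r" and "u = drop (gar g) r"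
  have su: "r = s @ u" "length s = gar g" "length u = k"
    using 1 by (simp_all add: s_def u_def)
  let ?f = "I (gar g) \<otimes> Cap (gco g) \<otimes> I k"
  have "below v (s @ u @ ports es)" using 1 su below_ports[OF 1(1)] by auto
  from spider_cap[OF this, of "gco g"] obtain v' \<rho> t where 2: "\<forall>z<v. \<rho> z < v'" "below v' t" "length
      t = gco g"
    "spider v (s @ u @ ports es) \<odot> (I (length s) \<otimes> Cap (gco g) \<otimes> I (length (u @ ports es))) =
     spider v' (map \<rho> s @ rev t @ t @ map \<rho> (u @ ports es))"
    by blast
  have "a \<odot> (gen g \<otimes> I k) = (a \<odot> ?f) \<odot> (bent_gen g \<otimes> I (gco g + k))"
    using arg_cong[OF unbend2[OF gen_typ[OF g]], of "\<lambda>f. f \<otimes> I k"] by (simp add: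
        bent_gen_def[symmetric] whisker_laws)
  also have "a \<odot> ?f = nf v' (map (map_edge \<rho>) es) (map \<rho> s @ rev t @ t @ map \<rho> u)"
    unfolding 1(4) using 1 2 su by (intro nf_step) (auto simp: arrow_ty Cap_typ whisker_laws)
  also have "\<dots> \<odot> (bent_gen g \<otimes> I (gco g + k)) = nf v' ((g, map \<rho> s, t) # map (map_edge \<rho>) es) (t @
      map \<rho> u)"
    using nf_bent_gen[where v = v' and es = "map (map_edge \<rho>) es" and s = "map \<rho> s" and t = t and w
        = "t @ map \<rho> u" and g = g] 1 2 su g wf_edges_map_edge[OF 1(1) 2(1)]
    by (auto simp: subset_iff)
  finally have eq: "a \<odot> (gen g \<otimes> I k) = nf v' ((g, map \<rho> s, t) # map (map_edge \<rho>) es) (t @ map \<rho> u)" .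
  have "wf_edges v' ((g, map \<rho> s, t) # map (map_edge \<rho>) es)" "below v' (t @ map \<rho> u)" "length (t @
      map \<rho> u) = gco g + k"
    using 1 2 su g wf_edges_map_edge[OF 1(1) 2(1)] by (auto simp: wf_edge_def)
  with eq show ?thesis unfolding has_nf_def by blast
qed

text \<open>Symmetries bring the affected wires to the front and back again, so it suffices to treat
  arrows that act on the first outputs.\<close>

lemma has_nf_whisker:
  assumes "\<And>k a. has_nf (dm f + k) a \<Longrightarrow> has_nf (cd f + k) (a \<odot> (f \<otimes> I k))" "arr f" "has_nf (x + dm f
      + y) a"
  shows "has_nf (x + cd f + y) (a \<odot> (I x \<otimes> f \<otimes> I y))"
proof -
  have "a \<odot> (I x \<otimes> f \<otimes> I y) = ((a \<odot> (Sy x (dm f) \<otimes> I y)) \<odot> (f \<otimes> I (x + y))) \<odot> (Sy (cd f) x \<otimes> I y)"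
    using slide_left[OF assms(2), of x] by (simp add: tn_assoc[symmetric]) (simp add: whisker_laws)
  moreover have "has_nf (dm f + (x + y)) (a \<odot> (Sy x (dm f) \<otimes> I y))"
    using assms(3) by (rule has_nf_reroutes) (simp_all add: reroutes_tn_I reroutes_Sy arrow_ty)
  then have "has_nf (cd f + (x + y)) ((a \<odot> (Sy x (dm f) \<otimes> I y)) \<odot> (f \<otimes> I (x + y)))"
    by (rule assms(1))
  then have "has_nf (x + cd f + y) (((a \<odot> (Sy x (dm f) \<otimes> I y)) \<odot> (f \<otimes> I (x + y))) \<odot> (Sy (cd f) x \<otimes> I y))"
    by (rule has_nf_reroutes) (simp_all add: reroutes_tn_I reroutes_Sy arrow_ty)
  ultimately show ?thesis by simp
qed

lemma has_nf_0: "has_nf 0 (I 0)"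
  unfolding has_nf_def by (intro exI[of _ 0] exI[of _ "[]"]) (simp add: nf_def spider_def arrow_ty
      unit_laws)

lemma reroutes_Cap: "reroutes (Cap n)"
proof (induction n)
  case 0
  have "reroutes (Sy 0 0)" by (rule reroutes_Sy)
  then show ?case by (simp add: Sy_0)
next
  case (Suc n)
  then show ?case
    by (simp add: reroutes_sq reroutes_frob reroutes_I_tn reroutes_tn_I arrow_ty Cap_typ)
qed

lemma nf_rename:
  assumes "wf_edges v es" "below v r" "\<pi> permutes {..<v}"
  shows "nf v (map (map_edge \<pi>) es) (map \<pi> r) = nf v es r"
  using spider_rename[OF assms(3), of "r @ ports es"] assms below_ports[OF assms(1)]
  by (simp add: nf_def ports_map_edge bent_gens_map_edge)

text \<open>One hyperedge is moved to the front together with its block of ports; naturality of the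
  symmetry turns an exchange of port blocks into an exchange of generators. The prefix
  \<open>u\<close> is arbitrary because the ports of the hyperedges already treated join it.\<close>

lemma tuple_bent_gens_perm:
  "mset es = mset es' \<Longrightarrow> wf_edges v es \<Longrightarrow> below v u \<Longrightarrow>
     tuple v (u @ ports es) \<odot> (I (length u) \<otimes> bent_gens es) = tuple v (u @ ports es') \<odot> (I (length
         u) \<otimes> bent_gens es')"
proof (induction es' arbitrary: es u)
  case (Cons e es')
  then have "e \<in> set es" by (metis list.set_intros(1) set_mset_mset)
  then obtain xs ys where es: "es = xs @ e # ys" by (meson split_list)
  obtain g s t where e: "e = (g, s, t)" by (cases e)
  have m: "mset (xs @ ys) = mset es'" using Cons.prems es by simp
  have wf_edges: "wf_edges v xs" "wf_edges v ys" "wf_edges v (xs @ ys)" "wf_edge v e" using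
      Cons.prems es by auto
  let ?pe = "s @ rev t"
  have pe: "g \<in> GS" "length ?pe = gar g + gco g" "below v ?pe"
    using wf_edges(4) by (auto simp: wf_edge_def e)
  have below: "below v (u @ ?pe)" "below v (ports xs)" "below v (ports ys)" using pe Cons.prems
      wf_edges below_ports by auto
  note smc_ty = bent_gen_typ[OF pe(1)] bent_gens_typ[OF wf_edges(1)] bent_gens_typ[OF wf_edges(2)]
  have O: "bent_gens (xs @ ys) = bent_gens xs \<otimes> bent_gens ys" "bent_gens es = bent_gens xs \<otimes>
      bent_gen g \<otimes> bent_gens ys"
    using bent_gens_append[OF wf_edges(1,2)] bent_gens_append[OF wf_edges(1), of "e # ys"] wf_edges
        es e by auto
  have "tuple v (u @ ports es) = tuple v (u @ ?pe @ ports xs @ ports ys) \<odot>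
      (I (length u) \<otimes> Sy (length ?pe) (length (ports xs)) \<otimes> I (length (ports ys)))"
    using below by (subst tuple_prefix[OF tuple_block]) (auto simp: arrow_ty es e ports_append)
  then have "tuple v (u @ ports es) \<odot> (I (length u) \<otimes> bent_gens es) = tuple v (u @ ?pe @ ports xs @
      ports ys) \<odot>
      (I (length u) \<otimes> ((Sy (length ?pe) (length (ports xs)) \<otimes> I (length (ports ys))) \<odot> ((bent_gens
          xs \<otimes> bent_gen g) \<otimes> bent_gens ys)))"
    by (simp only: O sq_assoc I_tn_sq tn_assoc)
  also have "(Sy (length ?pe) (length (ports xs)) \<otimes> I (length (ports ys))) \<odot> ((bent_gens xs \<otimes>
      bent_gen g) \<otimes> bent_gens ys) =
      (Sy (length ?pe) (length (ports xs)) \<odot> (bent_gens xs \<otimes> bent_gen g)) \<otimes> bent_gens ys"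
    using interchange[of "Sy (length ?pe) (length (ports xs))" "bent_gens xs \<otimes> bent_gen g" "I
        (length (ports ys))" "bent_gens ys"] pe(2)
    by (simp add: arrow_ty unit_laws smc_ty)
  also have "Sy (length ?pe) (length (ports xs)) \<odot> (bent_gens xs \<otimes> bent_gen g) = bent_gen g \<otimes>
      bent_gens xs"
    using Sy_natural[of "bent_gen g" "bent_gens xs"] pe(2) by (simp add: smc_ty arrow_ty unit_laws Sy_0)
  also have "(bent_gen g \<otimes> bent_gens xs) \<otimes> bent_gens ys = (I (length ?pe) \<otimes> bent_gens (xs @ ys)) \<odot>
      bent_gen g"
    using tn_split(2)[of "bent_gen g" "bent_gens xs \<otimes> bent_gens ys"] pe(2) O by (simp add: smc_ty
        arrow_ty unit_laws tn_assoc)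
  also have "tuple v (u @ ?pe @ ports xs @ ports ys) \<odot> (I (length u) \<otimes> ((I (length ?pe) \<otimes> bent_gens
      (xs @ ys)) \<odot> bent_gen g)) =
      (tuple v ((u @ ?pe) @ ports (xs @ ys)) \<odot> (I (length (u @ ?pe)) \<otimes> bent_gens (xs @ ys))) \<odot> (I
          (length u) \<otimes> bent_gen g)"
    by (simp add: ports_append whisker_laws)
  also have "\<dots> = (tuple v ((u @ ?pe) @ ports es') \<odot> (I (length (u @ ?pe)) \<otimes> bent_gens es')) \<odot> (I
      (length u) \<otimes> bent_gen g)"
    using Cons.IH[OF m wf_edges(3) below(1)] by simp
  also have "\<dots> = tuple v (u @ ports (e # es')) \<odot> (I (length u) \<otimes> ((I (length ?pe) \<otimes> bent_gens es') \<odot>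
      bent_gen g))"
    by (simp add: e whisker_laws)
  also have "(I (length ?pe) \<otimes> bent_gens es') \<odot> bent_gen g = bent_gens (e # es')"
  proof -
    have "wf_edges v es'" using Cons.prems by (metis list.set_intros(2) set_mset_mset)
    then show ?thesis
      using tn_split(2)[of "bent_gen g" "bent_gens es'"] pe(2) by (simp add: smc_ty arrow_ty
          unit_laws bent_gens_typ e)
  qed
  finally show ?case .
qed simp

lemma nf_edge_perm:
  assumes "mset es = mset es'" "wf_edges v es" "below v r"
  shows "nf v es r = nf v es' r"
  using tuple_bent_gens_perm[OF assms] by (simp add: nf_def spider_def sq_assoc)

end

section \<open>Matrices of normal forms\<close>

text \<open>Normal forms are compared over an abstract matrix semantics \<open>wc\<close>. What
  enters is its value on generators, its compatibility with both compositions and, in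
  \<open>arr_induct\<close>, that the generators generate. Terms and their classes return in
  \<open>frobenius_wgt_SFrob\<close>.\<close>

locale frobenius_wgt = frobenius_gen arr dm cd sq tn I Sy \<mu> \<eta> \<delta> \<epsilon> "gens S" gen "ar S" "coar S"
  for arr :: "'a \<Rightarrow> bool" and dm cd :: "'a \<Rightarrow> nat" and sq (infixr "\<odot>" 60) and tn (infixr "\<otimes>" 65)
    and I Sy \<mu> \<eta> \<delta> \<epsilon> and S :: "'g signature" and gen :: "'g \<Rightarrow> 'a" +
  fixes wc :: "'g hypergraph \<Rightarrow> 'a \<Rightarrow> nat list \<Rightarrow> nat list \<Rightarrow> nat"
  assumes wc_sq: "hypergraph S K \<Longrightarrow> arr A \<Longrightarrow> arr B \<Longrightarrow> cd A = dm B \<Longrightarrow> a \<in> vec K (dm A) \<Longrightarrow> b \<in> vec K (cd B) \<Longrightarrow>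
      wc K (A \<odot> B) a b = (\<Sum>c\<in>vec K (cd A). wc K A a c * wc K B c b)"
    and wc_tn: "hypergraph S K \<Longrightarrow> arr A \<Longrightarrow> arr B \<Longrightarrow> a \<in> vec K (dm A) \<Longrightarrow> b \<in> vec K (cd A) \<Longrightarrow>
      a' \<in> vec K (dm B) \<Longrightarrow> b' \<in> vec K (cd B) \<Longrightarrow> wc K (A \<otimes> B) (a @ a') (b @ b') = wc K A a b * wc K B a' b'"
    and wc_I: "hypergraph S K \<Longrightarrow> a \<in> vec K n \<Longrightarrow> b \<in> vec K n \<Longrightarrow> wc K (I n) a b = of_bool (a = b)"
    and wc_Sy: "hypergraph S K \<Longrightarrow> a \<in> vec K n \<Longrightarrow> a' \<in> vec K m \<Longrightarrow> b \<in> vec K (m + n) \<Longrightarrow>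
      wc K (Sy n m) (a @ a') b = of_bool (b = a' @ a)"
    and wc_mu: "hypergraph S K \<Longrightarrow> x \<in> nodes K \<Longrightarrow> y \<in> nodes K \<Longrightarrow> z \<in> nodes K \<Longrightarrow>
      wc K \<mu> [x, y] [z] = of_bool (x = z \<and> y = z)"
    and wc_eta: "hypergraph S K \<Longrightarrow> z \<in> nodes K \<Longrightarrow> wc K \<eta> [] [z] = 1"
    and wc_delta: "hypergraph S K \<Longrightarrow> x \<in> nodes K \<Longrightarrow> y \<in> nodes K \<Longrightarrow> z \<in> nodes K \<Longrightarrow>
      wc K \<delta> [x] [y, z] = of_bool (y = x \<and> z = x)"
    and wc_eps: "hypergraph S K \<Longrightarrow> z \<in> nodes K \<Longrightarrow> wc K \<epsilon> [z] [] = 1"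
    and wc_gen: "hypergraph S K \<Longrightarrow> g \<in> gens S \<Longrightarrow> a \<in> vec K (ar S g) \<Longrightarrow> b \<in> vec K (coar S g) \<Longrightarrow>
      wc K (gen g) a b = card {y \<in> edges K. lab K y = g \<and> srcs K y = a \<and> tgts K y = b}"
    and arr_induct: "arr A \<Longrightarrow> (\<And>g. g \<in> gens S \<Longrightarrow> P (gen g)) \<Longrightarrow> P \<mu> \<Longrightarrow> P \<eta> \<Longrightarrow> P \<delta> \<Longrightarrow> P \<epsilon> \<Longrightarrow>
      (\<And>n. P (I n)) \<Longrightarrow> (\<And>n m. P (Sy n m)) \<Longrightarrow>
      (\<And>A B. arr A \<Longrightarrow> arr B \<Longrightarrow> cd A = dm B \<Longrightarrow> P A \<Longrightarrow> P B \<Longrightarrow> P (A \<odot> B)) \<Longrightarrow>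
      (\<And>A B. arr A \<Longrightarrow> arr B \<Longrightarrow> P A \<Longrightarrow> P B \<Longrightarrow> P (A \<otimes> B)) \<Longrightarrow> P A"
begin

lemma append_in_vecI: "a \<in> vec K n \<Longrightarrow> b \<in> vec K m \<Longrightarrow> a @ b \<in> vec K (n + m)"
  by (auto simp: vec_def)

lemma fin: "hypergraph S K \<Longrightarrow> finite (nodes K)"
  by (simp add: hypergraph_def)

text \<open>The working form of the matrix product: a diagram is evaluated layer by layer, and only
  the wires on which a layer acts contribute a sum.\<close>

lemma wc_layer:
  assumes K: "hypergraph S K" and A: "arr A" and B: "arr B" "dm B = p + cd A + q"
    and x: "x \<in> vec K p" and y: "y \<in> vec K (dm A)" and z: "z \<in> vec K q" and b: "b \<in> vec K (cd B)"
  shows "wc K ((I p \<otimes> A \<otimes> I q) \<odot> B) (x @ y @ z) b = (\<Sum>w\<in>vec K (cd A). wc K A y w * wc K B (x @ w @ z) b)"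
proof -
  note [simp del] = sum_of_bool_eq sum_mult_of_bool_eq sum_of_bool_mult_eq
  have "wc K ((I p \<otimes> A \<otimes> I q) \<odot> B) (x @ y @ z) b =
      (\<Sum>c\<in>vec K (p + (cd A + q)). wc K (I p \<otimes> A \<otimes> I q) (x @ y @ z) c * wc K B c b)"
    using assms by (subst wc_sq) (auto simp: arrow_ty in_vec_add)
  also have "\<dots> = (\<Sum>c\<in>vec K p. \<Sum>w\<in>vec K (cd A). \<Sum>d\<in>vec K q.
      wc K (I p \<otimes> A \<otimes> I q) (x @ y @ z) (c @ w @ d) * wc K B (c @ w @ d) b)"
    by (simp add: sum_vec_add)
  also have "\<dots> = (\<Sum>c\<in>vec K p. \<Sum>w\<in>vec K (cd A). \<Sum>d\<in>vec K q.
      of_bool (x = c) * (of_bool (z = d) * (wc K A y w * wc K B (c @ w @ d) b)))"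
  proof (intro sum.cong HOL.refl)
    fix c w d assume c: "c \<in> vec K p" "w \<in> vec K (cd A)" "d \<in> vec K q"
    have "wc K (A \<otimes> I q) (y @ z) (w @ d) = wc K A y w * wc K (I q) z d"
      using assms c by (intro wc_tn) (auto simp: arrow_ty)
    moreover have "wc K (I p \<otimes> A \<otimes> I q) (x @ (y @ z)) (c @ (w @ d)) = wc K (I p) x c * wc K (A \<otimes> I
        q) (y @ z) (w @ d)"
      using assms c by (intro wc_tn) (auto simp: arrow_ty in_vec_add)
    ultimately show "wc K (I p \<otimes> A \<otimes> I q) (x @ y @ z) (c @ w @ d) * wc K B (c @ w @ d) b =
        of_bool (x = c) * (of_bool (z = d) * (wc K A y w * wc K B (c @ w @ d) b))"
      using wc_I[OF K x c(1)] wc_I[OF K z c(3)] by simp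
  qed
  also have "\<dots> = (\<Sum>w\<in>vec K (cd A). wc K A y w * wc K B (x @ w @ z) b)"
    using x z fin[OF K] by (simp add: sum_distrib_left[symmetric] sum_of_bool_eq_mult)
  finally show ?thesis .
qed

lemma wc_layer_left:
  assumes "hypergraph S K" "arr A" "arr B" "dm B = cd A + q"
    "y \<in> vec K (dm A)" "z \<in> vec K q" "b \<in> vec K (cd B)"
  shows "wc K ((A \<otimes> I q) \<odot> B) (y @ z) b = (\<Sum>w\<in>vec K (cd A). wc K A y w * wc K B (w @ z) b)"
  using wc_layer[of K A B 0 q "[]" y z b] assms by (simp add: unit_laws arrow_ty)

lemma wc_layer_right:
  assumes "hypergraph S K" "arr A" "arr B" "dm B = p + cd A"
    "x \<in> vec K p" "y \<in> vec K (dm A)" "b \<in> vec K (cd B)"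
  shows "wc K ((I p \<otimes> A) \<odot> B) (x @ y) b = (\<Sum>w\<in>vec K (cd A). wc K A y w * wc K B (x @ w) b)"
  using wc_layer[of K A B p 0 x y "[]" b] assms by (simp add: unit_laws arrow_ty)

text \<open>Arrows whose matrix has a single 1 in each row. A product with such a matrix is a
  substitution instead of a sum.\<close>

definition represents :: "'g hypergraph \<Rightarrow> 'a \<Rightarrow> (nat list \<Rightarrow> nat list) \<Rightarrow> bool" where
  "represents K A f \<longleftrightarrow> arr A \<and> (\<forall>a\<in>vec K (dm A). f a \<in> vec K (cd A) \<and>
     (\<forall>b\<in>vec K (cd A). wc K A a b = of_bool (b = f a)))"

lemma represents_sq_wc:
  assumes "hypergraph S K" "represents K A f" "arr B" "cd A = dm B" "a \<in> vec K (dm A)" "b \<in> vec K (cd B)"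
  shows "wc K (A \<odot> B) a b = wc K B (f a) b"
proof -
  have "wc K (A \<odot> B) a b = (\<Sum>c\<in>vec K (cd A). of_bool (c = f a) * wc K B c b)"
    using assms by (subst wc_sq) (auto simp: represents_def)
  then show ?thesis
    using assms fin[OF assms(1)] by (simp add: sum_of_bool_eq_mult represents_def)
qed

lemma represents_sq:
  assumes "hypergraph S K" "represents K A f" "represents K B g" "cd A = dm B"
  shows "represents K (A \<odot> B) (g \<circ> f)"
  using assms represents_sq_wc[OF assms(1,2), of B] unfolding represents_def by (simp add: arrow_ty)

lemma represents_tn:
  assumes "hypergraph S K" "represents K A f" "represents K B g"
  shows "represents K (A \<otimes> B) (\<lambda>a. f (take (dm A) a) @ g (drop (dm A) a))"
proof -
  have A: "arr A" "arr B" using assms by (auto simp: represents_def)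
  have "f a @ g a' \<in> vec K (cd A + cd B) \<and> (\<forall>b\<in>vec K (cd A + cd B). wc K (A \<otimes> B) (a @ a') b =
      of_bool (b = f a @ g a'))"
    if a: "a \<in> vec K (dm A)" "a' \<in> vec K (dm B)" for a a'
  proof (intro conjI ballI)
    have fg: "f a \<in> vec K (cd A)" "g a' \<in> vec K (cd B)" using assms a by (auto simp: represents_def)
    then show "f a @ g a' \<in> vec K (cd A + cd B)" by (rule append_in_vecI)
    fix b assume "b \<in> vec K (cd A + cd B)"
    then obtain c c' where b: "b = c @ c'" "c \<in> vec K (cd A)" "c' \<in> vec K (cd B)" by (auto simp:
        in_vec_add)
    then have "wc K (A \<otimes> B) (a @ a') b = of_bool (c = f a) * of_bool (c' = g a')"
      using assms a by (simp add: wc_tn represents_def)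
    moreover have "b = f a @ g a' \<longleftrightarrow> c = f a \<and> c' = g a'"
      using b fg by (simp add: vec_length[of c K] vec_length[of "f a" K])
    ultimately show "wc K (A \<otimes> B) (a @ a') b = of_bool (b = f a @ g a')" by simp
  qed
  then show ?thesis
    using A unfolding represents_def by (auto simp: arrow_ty in_vec_add[of _ _ "dm A" "dm B"] vec_length)
qed

lemma represents_I: "hypergraph S K \<Longrightarrow> represents K (I n) id"
  by (auto simp: represents_def arrow_ty wc_I)

lemma represents_dup:
  "hypergraph S K \<Longrightarrow> x < v \<Longrightarrow> represents K (dup x v) (\<lambda>a. a ! x # a)"
proof (induction x v rule: dup.induct)
  case (2 v)
  have "represents K \<delta> (\<lambda>a. [hd a, hd a])"
    using 2 by (auto simp: represents_def arrow_ty in_vec_Suc wc_delta numeral_2_eq_2)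
  from represents_tn[OF 2(1) this represents_I[OF 2(1)], of v] show ?case
    unfolding represents_def by (auto simp: arrow_ty in_vec_Suc)
next
  case (3 x v)
  have "represents K (Sy 1 1) (\<lambda>a. [a ! 1, a ! 0])"
    using 3 wc_Sy[of K "[y]" 1 "[z]" 1 for y z] by (auto simp: represents_def arrow_ty in_vec_Suc)
  from represents_tn[OF 3(2) this represents_I[OF 3(2)], of v]
  have a: "represents K (Sy 1 1 \<otimes> I v) (\<lambda>a. a ! 1 # a ! 0 # drop 2 a)"
    unfolding represents_def by (auto simp: arrow_ty in_vec_Suc)
  from 3 have "represents K (dup x v) (\<lambda>a. a ! x # a)" by simp
  from represents_tn[OF 3(2) represents_I[OF 3(2)] this, of 1]
  have b: "represents K (I 1 \<otimes> dup x v) (\<lambda>a. hd a # tl a ! x # tl a)"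
    using 3(3) unfolding represents_def by (auto simp: arrow_ty dup_typ in_vec_Suc)
  from represents_sq[OF 3(2) b a] show ?case
    using 3(3) unfolding represents_def by (auto simp: arrow_ty dup_typ in_vec_Suc)
qed simp

lemma represents_dels: "hypergraph S K \<Longrightarrow> represents K (dels v) (\<lambda>a. [])"
proof (induction v)
  case 0
  then show ?case using represents_I[of K 0] by (auto simp: represents_def arrow_ty)
next
  case (Suc v)
  have "represents K \<epsilon> (\<lambda>a. [])"
    using Suc by (auto simp: represents_def arrow_ty in_vec_Suc wc_eps)
  from represents_tn[OF Suc(2) this Suc.IH[OF Suc(2)]] show ?case by simp
qed

lemma represents_tuple: "hypergraph S K \<Longrightarrow> below v p \<Longrightarrow> represents K (tuple v p) (\<lambda>a. map ((!) a) p)"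
proof (induction p)
  case Nil
  then show ?case by (simp add: represents_dels)
next
  case (Cons x p)
  then have x: "x < v" "below v p" and "represents K (tuple v p) (\<lambda>a. map ((!) a) p)" by auto
  from represents_tn[OF Cons(2) represents_I[OF Cons(2)] this(3), of 1]
  have a: "represents K (I 1 \<otimes> tuple v p) (\<lambda>a. hd a # map ((!) (tl a)) p)"
    using x unfolding represents_def by (auto simp: arrow_tys in_vec_Suc)
  from represents_sq[OF Cons(2) represents_dup[OF Cons(2) x(1)] a] show ?case
    using x unfolding represents_def by (auto simp: arrow_tys in_vec_Suc)
qed

lemma wc_news: "hypergraph S K \<Longrightarrow> b \<in> vec K v \<Longrightarrow> wc K (news v) [] b = 1"
proof (induction v arbitrary: b)
  case 0
  then show ?case by (simp add: wc_I)
next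
  case (Suc v)
  then obtain x c where b: "b = [x] @ c" "x \<in> nodes K" "c \<in> vec K v"
    by (auto simp: in_vec_Suc)
  have "wc K (\<eta> \<otimes> news v) ([] @ []) ([x] @ c) = wc K \<eta> [] [x] * wc K (news v) [] c"
    using Suc b by (intro wc_tn) (auto simp: arrow_tys)
  then show ?case using Suc b by (simp add: wc_eta)
qed

lemma wc_cup1: "hypergraph S K \<Longrightarrow> x \<in> nodes K \<Longrightarrow> y \<in> nodes K \<Longrightarrow> wc K (\<mu> \<odot> \<epsilon>) [x, y] [] = of_bool (x = y)"
proof -
  assume a: "hypergraph S K" "x \<in> nodes K" "y \<in> nodes K"
  have "wc K (\<mu> \<odot> \<epsilon>) [x, y] [] = (\<Sum>z\<in>nodes K. of_bool (z = x) * of_bool (y = z))"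
    using a by (subst wc_sq) (auto simp: arrow_ty sum_vec_Suc wc_mu wc_eps numeral_2_eq_2 intro!:
        sum.cong)
  then show ?thesis using a fin[OF a(1)]
    by (simp add: sum_of_bool_eq_mult eq_commute del: sum_of_bool_eq sum_mult_of_bool_eq
        sum_of_bool_mult_eq)
qed

lemma wc_Cup:
  "hypergraph S K \<Longrightarrow> a \<in> vec K n \<Longrightarrow> b \<in> vec K n \<Longrightarrow> wc K (Cup n) (a @ b) [] = of_bool (b = rev a)"
proof (induction n arbitrary: a b)
  case 0
  then show ?case by (simp add: wc_I)
next
  case (Suc n)
  have "a \<in> vec K (n + 1)" "b \<in> vec K (Suc n)" using Suc by auto
  then obtain a' x y b' where ab: "a = a' @ [x]" "b = y # b'" "a' \<in> vec K n" "b' \<in> vec K n" "x \<in>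
      nodes K" "y \<in> nodes K"
    unfolding in_vec_add in_vec_Suc by (auto simp: in_vec_Suc)
  have "wc K (Cup (Suc n)) (a' @ [x, y] @ b') [] = wc K (\<mu> \<odot> \<epsilon>) [x, y] [] * wc K (Cup n) (a' @ b') []"
    unfolding Cup.simps using Suc ab by (subst wc_layer) (auto simp: arrow_ty Cup_typ numeral_2_eq_2)
  then show ?case using ab Suc by (auto simp: wc_cup1)
qed

abbreviation ecount :: "'g hypergraph \<Rightarrow> 'g \<Rightarrow> nat list \<Rightarrow> nat list \<Rightarrow> nat" where
  "ecount K g a b \<equiv> card {y \<in> edges K. lab K y = g \<and> srcs K y = a \<and> tgts K y = b}"

lemma rev_in_vec: "rev b \<in> vec K n \<longleftrightarrow> b \<in> vec K n"
  by (auto simp: vec_def)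

lemma wc_bent_gen:
  assumes K: "hypergraph S K" and g: "g \<in> gens S" and a: "a \<in> vec K (ar S g)" and b: "b \<in> vec K
      (coar S g)"
  shows "wc K (bent_gen g) (a @ rev b) [] = ecount K g a b"
proof -
  have "wc K (bent_gen g) (a @ rev b) [] = (\<Sum>c\<in>vec K (coar S g). wc K (gen g) a c * wc K (Cup (coar
      S g)) (c @ rev b) [])"
    unfolding bent_gen_def using assms by (subst wc_layer_left) (auto simp: gen_typ Cup_typ rev_in_vec)
  also have "\<dots> = (\<Sum>c\<in>vec K (coar S g). wc K (gen g) a c * of_bool (b = c))"
    using assms by (intro sum.cong HOL.refl) (simp add: wc_Cup rev_in_vec)
  also have "\<dots> = wc K (gen g) a b"
    using b fin[OF K] by (simp add: sum_of_bool_eq_mult del: sum_of_bool_eq sum_mult_of_bool_eq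
        sum_of_bool_mult_eq)
  finally show ?thesis using assms by (simp add: wc_gen)
qed

definition edge_weight :: "'g hypergraph \<Rightarrow> nat list \<Rightarrow> ('g \<times> nat list \<times> nat list) \<Rightarrow> nat" where
  "edge_weight K \<phi> e = (case e of (g, s, t) \<Rightarrow> ecount K g (map ((!) \<phi>) s) (map ((!) \<phi>) t))"

lemma map_nth_in_vec: "\<phi> \<in> vec K v \<Longrightarrow> below v s \<Longrightarrow> map ((!) \<phi>) s \<in> vec K (length s)"
  by (auto simp: vec_def subset_iff)

lemma wc_bent_gens:
  assumes K: "hypergraph S K" and \<phi>: "\<phi> \<in> vec K v"
  shows "wf_edges v es \<Longrightarrow> wc K (bent_gens es) (map ((!) \<phi>) (ports es)) [] = prod_list (map
      (edge_weight K \<phi>) es)"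
proof (induction es)
  case Nil
  then show ?case using K by (simp add: wc_I)
next
  case (Cons e es)
  obtain g s t where e: "e = (g, s, t)" by (cases e)
  have g: "g \<in> gens S" "length s = ar S g" "length t = coar S g" "below v s" "below v t" and
      wf_edges: "wf_edges v es"
    using Cons.prems by (auto simp: e wf_edge_def)
  let ?m = "map ((!) \<phi>)"
  have v: "?m s \<in> vec K (ar S g)" "?m t \<in> vec K (coar S g)" "?m (ports es) \<in> vec K (length (ports es))"
    using map_nth_in_vec[OF \<phi>] g below_ports[OF wf_edges] by metis+
  have "wc K (bent_gen g \<otimes> bent_gens es) ((?m s @ rev (?m t)) @ ?m (ports es)) ([] @ []) =
      wc K (bent_gen g) (?m s @ rev (?m t)) [] * wc K (bent_gens es) (?m (ports es)) []"
    using K v g by (intro wc_tn) (auto simp: bent_gen_typ bent_gens_typ[OF wf_edges] rev_in_vec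
        intro!: append_in_vecI)
  then show ?case using Cons wc_bent_gen[OF K g(1) v(1,2)] by (simp add: e edge_weight_def rev_map)
qed

lemma nf_typ:
  assumes "wf_edges v es" "below v r"
  shows "arr (nf v es r)" "dm (nf v es r) = 0" "cd (nf v es r) = length r"
proof -
  have "below v (r @ ports es)" using assms below_ports by auto
  then show "arr (nf v es r)" "dm (nf v es r) = 0" "cd (nf v es r) = length r"
    using assms by (simp_all add: nf_def arrow_ty spider_typ bent_gens_typ)
qed

text \<open>The fresh nodes contribute a sum over all their images \<phi>, and the tuple distributes
  \<phi> to outputs and ports. It is the formula by which \<open>card_homs_standard\<close> counts
  homomorphisms.\<close>

lemma wc_nf:
  assumes K: "hypergraph S K" and wf_edges: "wf_edges v es" and r: "below v r" and b: "b \<in> vec K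
      (length r)"
  shows "wc K (nf v es r) [] b = (\<Sum>\<phi>\<in>vec K v. of_bool (b = map ((!) \<phi>) r) * prod_list (map
      (edge_weight K \<phi>) es))"
proof -
  have below: "below v (r @ ports es)" using r below_ports[OF wf_edges] by auto
  note smc_ty = bent_gens_typ[OF wf_edges] tuple_typ[OF below]
  have "wc K (tuple v (r @ ports es) \<odot> (I (length r) \<otimes> bent_gens es)) \<phi> b =
      of_bool (b = map ((!) \<phi>) r) * prod_list (map (edge_weight K \<phi>) es)" if \<phi>: "\<phi> \<in> vec K v" for \<phi>
  proof -
    let ?m = "map ((!) \<phi>)"
    have "wc K (tuple v (r @ ports es) \<odot> (I (length r) \<otimes> bent_gens es)) \<phi> b = wc K (I (length r) \<otimes>
        bent_gens es) (?m (r @ ports es)) b"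
      using represents_tuple[OF K below] K \<phi> b by (intro represents_sq_wc) (auto simp: smc_ty arrow_ty)
    also have "\<dots> = wc K (I (length r) \<otimes> bent_gens es) (?m r @ ?m (ports es)) (b @ [])"
      by simp
    also have "\<dots> = wc K (I (length r)) (?m r) b * wc K (bent_gens es) (?m (ports es)) []"
      using K b map_nth_in_vec[OF \<phi>] r below_ports[OF wf_edges] by (intro wc_tn) (auto simp: smc_ty
          arrow_ty)
    also have "wc K (I (length r)) (?m r) b = of_bool (?m r = b)"
      using K b map_nth_in_vec[OF \<phi> r] by (intro wc_I)
    finally show ?thesis using wc_bent_gens[OF K \<phi> wf_edges] by auto
  qed
  then have "wc K (news v \<odot> tuple v (r @ ports es) \<odot> (I (length r) \<otimes> bent_gens es)) [] b =
      (\<Sum>\<phi>\<in>vec K v. of_bool (b = map ((!) \<phi>) r) * prod_list (map (edge_weight K \<phi>) es))"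
    using K b by (subst wc_sq) (auto simp: smc_ty arrow_tys wc_news)
  then show ?thesis by (simp add: nf_def spider_def sq_assoc)
qed

section \<open>The hypergraph of a normal form\<close>

definition nf_graph :: "nat \<Rightarrow> ('g \<times> nat list \<times> nat list) list \<Rightarrow> 'g hypergraph" where
  "nf_graph v es = \<lparr> nodes = {..<v}, edges = {..<length es}, srcs = (\<lambda>i. fst (snd (es ! i))),
     tgts = (\<lambda>i. snd (snd (es ! i))), lab = (\<lambda>i. fst (es ! i)) \<rparr>"

lemma nf_graph_simps [simp]: "nodes (nf_graph v es) = {..<v}" "edges (nf_graph v es) = {..<length es}"
  by (simp_all add: nf_graph_def)

lemma hypergraph_nf_graph: "wf_edges v es \<Longrightarrow> hypergraph S (nf_graph v es)"
proof -
  assume wf_edges: "wf_edges v es"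
  have "set (fst (snd (es ! i))) \<subseteq> {..<v} \<and> set (snd (snd (es ! i))) \<subseteq> {..<v} \<and> fst (es ! i) \<in> gens S \<and>
      length (fst (snd (es ! i))) = ar S (fst (es ! i)) \<and> length (snd (snd (es ! i))) = coar S (fst
          (es ! i))"
    if "i < length es" for i
    using wf_edges nth_mem[OF that] by (cases "es ! i") (auto simp: wf_edge_def)
  then show ?thesis
    unfolding hypergraph_def by (simp add: nf_graph_def)
qed

text \<open>A normal form is a state, so both legs are listed one after the other. Completeness uses
  the case \<open>n = 0\<close>, fullness the general one.\<close>

lemma card_homs_nf_graph:
  assumes K: "hypergraph S K" and wf_edges: "wf_edges v es"
    and l: "hom S (discrete n) (nf_graph v es) l" and r: "hom S (discrete m) (nf_graph v es) r"
    and a: "a \<in> vec K n" and b: "b \<in> vec K m"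
  shows "card (homs S K (Cospan n l (nf_graph v es) r m) a b) =
     wc K (nf v es (map (vmap l) [0..<n] @ map (vmap r) [0..<m])) [] (a @ b)"
proof -
  have "below v (map (vmap l) [0..<n] @ map (vmap r) [0..<m])"
    using l r by (auto simp: hom_discrete)
  moreover have "a @ b \<in> vec K (length (map (vmap l) [0..<n] @ map (vmap r) [0..<m]))"
    using a b by (auto simp: in_vec_add)
  ultimately have 1: "wc K (nf v es (map (vmap l) [0..<n] @ map (vmap r) [0..<m])) [] (a @ b) =
     (\<Sum>\<phi>\<in>vec K v. of_bool (a @ b = map ((!) \<phi>) (map (vmap l) [0..<n] @ map (vmap r) [0..<m])) *
        prod_list (map (edge_weight K \<phi>) es))"
    using wc_nf[OF K wf_edges] by blast
  have p: "(\<Prod>i<length es. card {y \<in> edges K. lab K y = lab (nf_graph v es) i \<and> srcs K y = map ((!)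
      \<phi>) (srcs (nf_graph v es) i) \<and>
         tgts K y = map ((!) \<phi>) (tgts (nf_graph v es) i)}) = prod_list (map (edge_weight K \<phi>) es)" for \<phi>
    by (simp add: prod.list_conv_set_nth edge_weight_def nf_graph_def case_prod_unfold atLeast0LessThan)
  have q: "(map (\<lambda>i. \<phi> ! vmap l i) [0..<n] = a \<and> map (\<lambda>i. \<phi> ! vmap r i) [0..<m] = b) \<longleftrightarrow>
      (a @ b = map ((!) \<phi>) (map (vmap l) [0..<n] @ map (vmap r) [0..<m]))" for \<phi>
  proof -
    have "map ((!) \<phi>) (map (vmap l) [0..<n] @ map (vmap r) [0..<m]) =
        map (\<lambda>i. \<phi> ! vmap l i) [0..<n] @ map (\<lambda>i. \<phi> ! vmap r i) [0..<m]"
      by (simp add: comp_def)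
    then show ?thesis using vec_length[OF a] by (auto simp: append_eq_append_conv simp del: map_map
        map_append)
  qed
  show ?thesis
    unfolding 1 card_homs_standard[OF nf_graph_simps l r K] p q ..
qed

end

section \<open>Completeness, fullness and bending\<close>

context frobenius_wgt
begin

lemma reroutes_I: "reroutes (I n)"
  using reroutes_Sy[of n 0] by (simp add: Sy_0)

text \<open>The arrow acts in the middle of the outputs because the induction needs this for sums:
  the arrow \<open>A \<otimes> B\<close> is applied as a layer of \<open>A\<close> followed by a
  layer of \<open>B\<close>.\<close>

lemma has_nf_arr:
  assumes "arr A"
  shows "has_nf (x + dm A + y) a \<Longrightarrow> has_nf (x + cd A + y) (a \<odot> (I x \<otimes> A \<otimes> I y))"
proof -
  have reroutes: "has_nf (x + cd A + y) (a \<odot> (I x \<otimes> A \<otimes> I y))" if "reroutes A" "has_nf (x + dm A +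
      y) a" for A x y a
  proof -
    have "arr A" using that(1) by (simp add: reroutes_def)
    then show ?thesis
      using that by (intro has_nf_reroutes[where m = "x + dm A + y"]) (simp_all add: reroutes_I_tn
          reroutes_tn_I arrow_ty add.assoc)
  qed
  have "\<forall>x y a. has_nf (x + dm A + y) a \<longrightarrow> has_nf (x + cd A + y) (a \<odot> (I x \<otimes> A \<otimes> I y))"
    using assms
  proof (induction A rule: arr_induct[consumes 1])
    case (1 g)
    then show ?case
      by (intro allI impI has_nf_whisker) (simp_all add: gen_typ has_nf_gen)
  next
    case (8 A B)
    show ?case
    proof (intro allI impI)
      fix x y a assume "has_nf (x + dm (A \<odot> B) + y) a"
      then have "has_nf (x + cd B + y) ((a \<odot> (I x \<otimes> A \<otimes> I y)) \<odot> (I x \<otimes> B \<otimes> I y))"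
        using 8 by (metis dm_sq)
      then show "has_nf (x + cd (A \<odot> B) + y) (a \<odot> (I x \<otimes> (A \<odot> B) \<otimes> I y))"
        using 8 by (simp add: cd_sq whisker_laws)
    qed
  next
    case (9 A B)
    show ?case
    proof (intro allI impI)
      fix x y a assume "has_nf (x + dm (A \<otimes> B) + y) a"
      then have "has_nf (x + dm A + (dm B + y)) a" using 9 by (simp add: arrow_ty add.assoc)
      then have "has_nf (x + cd A + (dm B + y)) (a \<odot> (I x \<otimes> A \<otimes> I (dm B + y)))" using 9 by blast
      then have "has_nf ((x + cd A) + dm B + y) (a \<odot> (I x \<otimes> A \<otimes> I (dm B + y)))" by (simp add: add.assoc)
      then have "has_nf ((x + cd A) + cd B + y) ((a \<odot> (I x \<otimes> A \<otimes> I (dm B + y))) \<odot> (I (x + cd A) \<otimes> B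
          \<otimes> I y))"
        using 9 by blast
      moreover have "I x \<otimes> (A \<otimes> B) \<otimes> I y = (I x \<otimes> A \<otimes> I (dm B + y)) \<odot> (I (x + cd A) \<otimes> B \<otimes> I y)"
        using 9 by (simp add: tn_split(1)[symmetric] whisker_laws)
      ultimately show "has_nf (x + cd (A \<otimes> B) + y) (a \<odot> (I x \<otimes> (A \<otimes> B) \<otimes> I y))"
        using 9 by (simp add: arrow_ty sq_assoc add.assoc)
    qed
  qed (use reroutes reroutes_frob reroutes_Sy reroutes_I in blast)+
  then show "has_nf (x + dm A + y) a \<Longrightarrow> has_nf (x + cd A + y) (a \<odot> (I x \<otimes> A \<otimes> I y))" by blast
qed

lemma has_nf_bend:
  assumes "arr A"
  shows "has_nf (dm A + cd A) (Cap (dm A) \<odot> (I (dm A) \<otimes> A))"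
proof -
  have "has_nf (dm A + dm A) (I 0 \<odot> Cap (dm A))"
    by (rule has_nf_reroutes[OF has_nf_0 reroutes_Cap]) (simp_all add: Cap_typ)
  then have "has_nf (dm A + dm A + 0) (Cap (dm A))"
    by (simp add: unit_laws Cap_typ)
  from has_nf_arr[OF assms this] show ?thesis
    using assms by (simp add: unit_laws arrow_ty)
qed

text \<open>By Lovasz's theorem equal matrices give an isomorphism of the two hypergraphs that
  respects the outputs. It consists of a renaming of nodes and a bijection of hyperedges, and both
  leave the arrow unchanged.\<close>

lemma nf_complete:
  assumes wf_edges: "wf_edges v es" "wf_edges v' es'" and below: "below v r" "below v' r'" and m:
      "length r = m" "length r' = m"
    and eq: "\<And>K b. hypergraph S K \<Longrightarrow> b \<in> vec K m \<Longrightarrow> wc K (nf v es r) [] b = wc K (nf v' es' r') [] b"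
  shows "nf v es r = nf v' es' r'"
proof -
  let ?c = "\<lambda>v es r. Cospan 0 mor_id (nf_graph v es) (node_mor ((!) r)) m"
  have is_cospan: "hom S (discrete 0) (nf_graph v es) mor_id" "hom S (discrete m) (nf_graph v es)
      (node_mor ((!) r))"
    if "wf_edges v es" "below v r" "length r = m" for v es r
    using that hypergraph_nf_graph[OF that(1)] by (auto simp: hom_discrete subset_iff)
  have card: "card (homs S K (?c v es r) [] b) = wc K (nf v es r) [] b"
    if "wf_edges v es" "below v r" "length r = m" "hypergraph S K" "b \<in> vec K m" for v es r K b
    using card_homs_nf_graph[OF that(4,1) is_cospan[OF that(1-3)], of "[]" b] that map_nth[of r] by simp
  have "card (homs S K (?c v es r) a b) = card (homs S K (?c v' es' r') a b)" if K: "hypergraph S K"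
      for K a b
  proof (cases "a = [] \<and> b \<in> vec K m")
    case True
    then show ?thesis using card[where v = v and es = es and r = r and K = K and b = b]
        card[where v = v' and es = es' and r = r' and K = K and b = b] assms K by (simp del: homs.simps)
  next
    case False
    have "homs S K (?c v es r) a b = {}" if "wf_edges v es" "below v r" "length r = m" for v es r
      using is_cospan[OF that] False by (intro homs_empty[of S 0 m]) (auto simp: is_cospan_def)
    then show ?thesis using assms by (simp del: homs.simps)
  qed
  then have "cospan_iso S (?c v es r) (?c v' es' r')"
    using is_cospan assms by (intro cospan_iso_of_card_eq[of S 0 m]) (auto simp: is_cospan_def simp
        del: homs.simps)
  then obtain f where f: "iso S (nf_graph v es) (nf_graph v' es') f" and leg: "leg_eq m (node_mor
      ((!) r) \<then> f) (node_mor ((!) r'))"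
    by auto
  obtain g where h: "hom S (nf_graph v es) (nf_graph v' es') f" "hom S (nf_graph v' es') (nf_graph v
      es) g"
    and fg: "mor_eq (nf_graph v es) (f \<then> g) mor_id" "mor_eq (nf_graph v' es') (g \<then> f) mor_id"
    using f by (auto simp: iso_def)
  have bv: "bij_betw (vmap f) {..<v} {..<v'}"
    using h fg by (intro bij_betw_byWitness[where f' = "vmap g"]) (auto simp: mor_eq_def hom_def)
  have be: "bij_betw (emap f) {..<length es} {..<length es'}"
    using h fg by (intro bij_betw_byWitness[where f' = "emap g"]) (auto simp: mor_eq_def hom_def)
  have v: "v' = v" and q: "length es' = length es"
    using bij_betw_same_card[OF bv] bij_betw_same_card[OF be] by auto
  \<comment> \<open>Extended by the identity, because \<open>permutes\<close> demands fixed points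
    outside the set.\<close>
  define \<pi> where "\<pi> x = (if x < v then vmap f x else x)" for x
  have "bij_betw \<pi> {..<v} {..<v}"
    using bv unfolding v by (subst bij_betw_cong[where g = "vmap f"]) (auto simp: \<pi>_def)
  then have \<pi>: "\<pi> permutes {..<v}"
    by (intro bij_imp_permutes) (auto simp: \<pi>_def)
  have map\<pi>: "map (vmap f) xs = map \<pi> xs" if "below v xs" for xs
    using that by (auto simp: \<pi>_def)
  have r': "r' = map \<pi> r"
    using leg m below(1) by (intro nth_equalityI) (auto simp: leg_eq_def \<pi>_def subset_iff)
  have es': "es' ! emap f i = map_edge \<pi> (es ! i)" if "i < length es" for i
  proof -
    have "wf_edge v (es ! i)" using wf_edges(1) that by simp
    then have "below v (fst (snd (es ! i)))" "below v (snd (snd (es ! i)))"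
      by (auto simp: wf_edge_def split: prod.splits)
    then show ?thesis
      using h(1) that map\<pi> by (auto simp: hom_def nf_graph_def prod_eq_iff)
  qed
  \<comment> \<open>Along the bijection of hyperedges, the renamed list \<open>es\<close> and the
    list \<open>es'\<close> have the same multiset of entries.\<close>
  have "mset (map (map_edge \<pi>) es) = image_mset (\<lambda>i. map_edge \<pi> (es ! i)) (mset_set {..<length es})"
    using arg_cong[OF map_nth[of es], of "\<lambda>es. mset (map (map_edge \<pi>) es)"]
    by (simp add: atLeast0LessThan image_mset.compositionality comp_def del: map_nth)
  also have "\<dots> = image_mset ((!) es') (image_mset (emap f) (mset_set {..<length es}))"
    unfolding image_mset.compositionality by (intro image_mset_cong) (auto simp: es')
  also have "image_mset (emap f) (mset_set {..<length es}) = mset_set {..<length es'}"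
    using be by (simp add: image_mset_mset_set bij_betw_def)
  also have "image_mset ((!) es') (mset_set {..<length es'}) = mset es'"
    using arg_cong[OF map_nth[of es'], of mset] by (simp add: atLeast0LessThan)
  finally have m: "mset (map (map_edge \<pi>) es) = mset es'" .
  have "\<forall>z<v. \<pi> z < v" "below v (map \<pi> r)"
    using permutes_in_image[OF \<pi>] below by auto
  then have "nf v (map (map_edge \<pi>) es) (map \<pi> r) = nf v es' (map \<pi> r)"
    by (intro nf_edge_perm[OF m] wf_edges_map_edge[OF wf_edges(1)])
  then show ?thesis
    using nf_rename[OF wf_edges(1) below(1) \<pi>] by (simp add: r' v)
qed

text \<open>Only states have normal forms, so both arrows are bent first; the snake equation undoes
  the bending.\<close>

theorem complete:
  assumes A: "arr A" "dm A = n" "cd A = m" and B: "arr B" "dm B = n" "cd B = m"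
    and eq: "\<And>K a b. hypergraph S K \<Longrightarrow> a \<in> vec K n \<Longrightarrow> b \<in> vec K m \<Longrightarrow> wc K A a b = wc K B a b"
  shows "A = B"
proof -
  have wcE: "wc K (Cap n \<odot> (I n \<otimes> A)) [] b = wc K (Cap n \<odot> (I n \<otimes> B)) [] b"
    if K: "hypergraph S K" and b: "b \<in> vec K (n + m)" for K b
  proof -
    have 1: "wc K (Cap n \<odot> (I n \<otimes> X)) [] b = (\<Sum>c\<in>vec K (n + n). wc K (Cap n) [] c * wc K (I n \<otimes> X) c b)"
      if "arr X" "dm X = n" "cd X = m" for X
      using that K b by (subst wc_sq) (auto simp: arrow_ty Cap_typ)
    have "wc K (I n \<otimes> A) c b = wc K (I n \<otimes> B) c b" if "c \<in> vec K (n + n)" for c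
      using that b K A B eq by (auto simp: in_vec_add wc_tn arrow_ty)
    then show ?thesis using 1[OF A] 1[OF B] by simp
  qed
  obtain v es r where 1: "wf_edges v es" "below v r" "length r = n + m" "Cap n \<odot> (I n \<otimes> A) = nf v es r"
    using has_nf_bend[OF A(1)] A by (auto simp: has_nf_def)
  obtain v' es' r' where 2: "wf_edges v' es'" "below v' r'" "length r' = n + m" "Cap n \<odot> (I n \<otimes> B) =
      nf v' es' r'"
    using has_nf_bend[OF B(1)] B by (auto simp: has_nf_def)
  have "Cap n \<odot> (I n \<otimes> A) = Cap n \<odot> (I n \<otimes> B)"
    unfolding 1(4) 2(4) by (rule nf_complete[OF 1(1) 2(1) 1(2) 2(2) 1(3) 2(3)]) (rule wcE[unfolded
        1(4) 2(4)])
  from arg_cong[OF this, of "\<lambda>f. (I n \<otimes> f) \<odot> (Cup n \<otimes> I m)"] show ?thesis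
    by (simp only: unbend[OF A] unbend[OF B])
qed

text \<open>In contrast to the nested \<open>Cap\<close> and \<open>Cup\<close>, the arrows \<open>cup_par\<close> and \<open>cap_par\<close> connect wire \<open>i\<close> to
  wire \<open>n + i\<close>, as in the definition of bending.\<close>

primrec cup_par :: "nat \<Rightarrow> 'a" where
  "cup_par 0 = I 0"
| "cup_par (Suc n) = (I 1 \<otimes> Sy n 1 \<otimes> I n) \<odot> ((\<mu> \<odot> \<epsilon>) \<otimes> cup_par n)"

lemma cup_par_typ: "arr (cup_par n)" "dm (cup_par n) = n + n" "cd (cup_par n) = 0"
  by (induction n) (simp_all add: arrow_ty)

lemma wc_cup_par:
  "hypergraph S K \<Longrightarrow> a \<in> vec K n \<Longrightarrow> b \<in> vec K n \<Longrightarrow> wc K (cup_par n) (a @ b) [] = of_bool (a = b)"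
proof (induction n arbitrary: a b)
  case 0
  then show ?case by (simp add: wc_I)
next
  case (Suc n)
  obtain x u y w where ab: "a = x # u" "b = y # w" "u \<in> vec K n" "w \<in> vec K n" "x \<in> nodes K" "y \<in>
      nodes K"
    using Suc.prems by (auto simp: in_vec_Suc)
  note K = Suc.prems(1)
  let ?B = "(\<mu> \<odot> \<epsilon>) \<otimes> cup_par n"
  have uy: "u @ [y] \<in> vec K (n + 1)" using ab by (intro append_in_vecI) auto
  have "wc K (cup_par (Suc n)) ([x] @ (u @ [y]) @ w) [] =
      (\<Sum>c\<in>vec K (1 + n). wc K (Sy n 1) (u @ [y]) c * wc K ?B ([x] @ c @ w) [])"
    unfolding cup_par.simps using K ab uy by (subst wc_layer) (auto simp: arrow_ty cup_par_typ)
  also have "\<dots> = (\<Sum>c\<in>vec K (1 + n). of_bool (c = [y] @ u) * wc K ?B ([x] @ c @ w) [])"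
    using K ab by (intro sum.cong HOL.refl) (subst wc_Sy, auto)
  also have "\<dots> = wc K ?B ([x, y] @ (u @ w)) ([] @ [])"
    using ab fin[OF K] by (simp add: sum_of_bool_eq_mult del: sum_of_bool_eq sum_mult_of_bool_eq
        sum_of_bool_mult_eq)
  also have "\<dots> = wc K (\<mu> \<odot> \<epsilon>) [x, y] [] * wc K (cup_par n) (u @ w) []"
    using K ab by (intro wc_tn) (auto simp: arrow_ty cup_par_typ numeral_2_eq_2 intro: append_in_vecI)
  finally show ?case using Suc ab by (auto simp: wc_cup1)
qed

text \<open>On matrices, bending the first \<open>n\<close> outputs of an arrow back only moves an
  index from the output side to the input side.\<close>

lemma wc_cup_par_layer:
  assumes K: "hypergraph S K" and X: "arr X" "dm X = q" "cd X = n + m"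
    and a: "a \<in> vec K n" and z: "z \<in> vec K q" and b: "b \<in> vec K m"
  shows "wc K ((I n \<otimes> X) \<odot> (cup_par n \<otimes> I m)) (a @ z) b = wc K X z (a @ b)"
proof -
  note [simp del] = sum_of_bool_eq sum_mult_of_bool_eq sum_of_bool_mult_eq
  let ?B = "cup_par n \<otimes> I m"
  have "wc K ((I n \<otimes> X) \<odot> ?B) (a @ z) b = (\<Sum>s\<in>vec K n. \<Sum>t\<in>vec K m. wc K X z (s @ t) * wc K ?B (a @ s
      @ t) b)"
    using K X a b z by (subst wc_layer_right) (simp_all add: arrow_ty cup_par_typ sum_vec_add)
  also have "\<dots> = (\<Sum>s\<in>vec K n. \<Sum>t\<in>vec K m. of_bool (a = s) * (of_bool (t = b) * wc K X z (s @ t)))"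
  proof (intro sum.cong HOL.refl)
    fix s t assume st: "s \<in> vec K n" "t \<in> vec K m"
    have "wc K ?B ((a @ s) @ t) ([] @ b) = wc K (cup_par n) (a @ s) [] * wc K (I m) t b"
      using K st append_in_vecI[OF a st(1)] b by (intro wc_tn) (simp_all add: cup_par_typ I_typ)
    then show "wc K X z (s @ t) * wc K ?B (a @ s @ t) b = of_bool (a = s) * (of_bool (t = b) * wc K
        X z (s @ t))"
      using wc_cup_par[OF K a st(1)] wc_I[OF K st(2) b] by simp
  qed
  also have "\<dots> = wc K X z (a @ b)"
    using a b fin[OF K] by (simp add: sum_distrib_left[symmetric] sum_of_bool_eq_mult)
  finally show ?thesis .
qed

text \<open>The clauses repeat those of \<open>cap\<close>, with the separate clause for 1 and the
  same bracketing, so that the two are later identified by simplification.\<close>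

fun cap_par :: "nat \<Rightarrow> 'a" where
  "cap_par 0 = I 0"
| "cap_par (Suc 0) = \<eta> \<odot> \<delta>"
| "cap_par (Suc (Suc n)) = (cap_par 1 \<otimes> cap_par (Suc n)) \<odot> ((I 1 \<otimes> Sy 1 (Suc n)) \<otimes> I (Suc n))"

lemma cap_par_typ: "arr (cap_par n)" "dm (cap_par n) = 0" "cd (cap_par n) = n + n"
proof -
  have "arr (cap_par n) \<and> dm (cap_par n) = 0 \<and> cd (cap_par n) = n + n"
    by (induction n rule: cap_par.induct) (auto simp: arrow_ty)
  then show "arr (cap_par n)" "dm (cap_par n) = 0" "cd (cap_par n) = n + n" by auto
qed

lemma wc_cap_par:
  "hypergraph S K \<Longrightarrow> a \<in> vec K n \<Longrightarrow> b \<in> vec K n \<Longrightarrow> wc K (cap_par n) [] (a @ b) = of_bool (a = b)"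
proof (induction n arbitrary: a b rule: cap_par.induct)
  case 1
  then show ?case by (simp add: wc_I)
next
  case 2
  then obtain x y where ab: "a = [x]" "b = [y]" "x \<in> nodes K" "y \<in> nodes K"
    by (auto simp: in_vec_Suc)
  have "wc K (\<eta> \<odot> \<delta>) [] [x, y] = (\<Sum>z\<in>nodes K. of_bool (x = z) * of_bool (y = z))"
    using 2 ab by (subst wc_sq) (auto simp: arrow_ty sum_vec_Suc wc_eta wc_delta numeral_2_eq_2
        intro!: sum.cong)
  also have "\<dots> = of_bool (x = y)"
    using ab fin[OF 2(1)] by (auto simp: sum_of_bool_eq_mult simp del: sum_of_bool_eq
        sum_mult_of_bool_eq sum_of_bool_mult_eq)
  finally show ?case using ab by simp
next
  case (3 n)
  note [simp del] = sum_of_bool_eq sum_mult_of_bool_eq sum_of_bool_mult_eq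
  obtain x u y w where ab: "a = x # u" "b = y # w" "u \<in> vec K (Suc n)" "w \<in> vec K (Suc n)" "x \<in>
      nodes K" "y \<in> nodes K"
    using 3 by (metis in_vec_Suc)
  note K = 3(3)
  let ?A = "cap_par 1 \<otimes> cap_par (Suc n)" and ?B = "I 1 \<otimes> Sy 1 (Suc n) \<otimes> I (Suc n)"
  have B: "wc K ?B ([p, q] @ (c @ d)) ((x # u) @ (y # w)) = of_bool (p = x) * (of_bool (q = y) *
      (of_bool (c = u) * of_bool (d = w)))"
    if "p \<in> nodes K" "q \<in> nodes K" "c \<in> vec K (Suc n)" "d \<in> vec K (Suc n)" for p q c d
  proof -
    have qc: "[q] @ c \<in> vec K (1 + Suc n)" "u @ [y] \<in> vec K (Suc n + 1)"
      using that ab append_in_vecI[of "[q]" K 1 c "Suc n"] append_in_vecI[of u K "Suc n" "[y]" 1] by auto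
    have "wc K (Sy 1 (Suc n) \<otimes> I (Suc n)) (([q] @ c) @ d) ((u @ [y]) @ w) =
        wc K (Sy 1 (Suc n)) ([q] @ c) (u @ [y]) * wc K (I (Suc n)) d w"
      using K that ab qc by (intro wc_tn) (simp_all add: arrow_ty)
    moreover have "wc K ?B ([p] @ (([q] @ c) @ d)) ([x] @ ((u @ [y]) @ w)) =
        wc K (I 1) [p] [x] * wc K (Sy 1 (Suc n) \<otimes> I (Suc n)) (([q] @ c) @ d) ((u @ [y]) @ w)"
      using K that ab append_in_vecI[OF qc(1) that(4)] append_in_vecI[OF qc(2) ab(4)]
      by (intro wc_tn) (simp_all add: arrow_ty)
    ultimately have "wc K ?B ([p, q] @ (c @ d)) ((x # u) @ (y # w)) =
        wc K (I 1) [p] [x] * (wc K (Sy 1 (Suc n)) ([q] @ c) (u @ [y]) * wc K (I (Suc n)) d w)"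
      by simp
    also have "wc K (Sy 1 (Suc n)) ([q] @ c) (u @ [y]) = of_bool (u @ [y] = c @ [q])"
      using K that qc(2) by (intro wc_Sy) auto
    finally show ?thesis
      using K that ab by (auto simp: wc_I)
  qed
  have A: "wc K ?A [] ([p, q] @ (c @ d)) = of_bool (p = q) * of_bool (c = d)"
    if "p \<in> nodes K" "q \<in> nodes K" "c \<in> vec K (Suc n)" "d \<in> vec K (Suc n)" for p q c d
  proof -
    have "wc K ?A ([] @ []) ([p, q] @ (c @ d)) = wc K (cap_par 1) [] ([p] @ [q]) * wc K (cap_par
        (Suc n)) [] (c @ d)"
      using K that append_in_vecI[OF that(3,4)] by (subst wc_tn) (auto simp: cap_par_typ arrow_ty
          numeral_2_eq_2)
    then show ?thesis using 3(1)[OF K, of "[p]" "[q]"] 3(2)[OF K that(3,4)] that by simp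
  qed
  have xuyw: "(x # u) @ (y # w) \<in> vec K (Suc (Suc n) + Suc (Suc n))"
    using ab by (intro append_in_vecI) auto
  have "wc K (cap_par (Suc (Suc n))) [] ((x # u) @ (y # w)) =
      (\<Sum>c\<in>vec K (2 + (Suc n + Suc n)). wc K ?A [] c * wc K ?B c ((x # u) @ (y # w)))"
    using K xuyw by (simp add: tn_assoc, subst wc_sq) (simp_all add: arrow_ty cap_par_typ numeral_2_eq_2)
  also have "\<dots> = (\<Sum>p\<in>nodes K. \<Sum>q\<in>nodes K. \<Sum>c\<in>vec K (Suc n). \<Sum>d\<in>vec K (Suc n).
      wc K ?A [] ([p, q] @ (c @ d)) * wc K ?B ([p, q] @ (c @ d)) ((x # u) @ (y # w)))"
    unfolding sum_vec_add[of _ K 2] sum_vec_add[of _ K "Suc n" "Suc n"] by (simp add: numeral_2_eq_2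
        sum_vec_Suc[of _ K 0] sum_vec_Suc[of _ K "Suc 0"])
  also have "\<dots> = (\<Sum>p\<in>nodes K. \<Sum>q\<in>nodes K. \<Sum>c\<in>vec K (Suc n). \<Sum>d\<in>vec K (Suc n).
      of_bool (p = x) * (of_bool (q = y) * (of_bool (c = u) * (of_bool (d = w) * (of_bool (p = q) *
          of_bool (c = d))))))"
    by (intro sum.cong HOL.refl) (simp only: A B mult_ac)
  \<comment> \<open>The four deltas of the crossing layer fix \<open>p\<close>, \<open>q\<close>,
    \<open>c\<close> and \<open>d\<close>; the two deltas of the caps remain.\<close>
  also have "\<dots> = of_bool (x = y \<and> u = w)"
    using ab fin[OF K] by (simp add: sum_distrib_left[symmetric] sum_of_bool_eq_mult)
  finally show ?case using ab by auto
qed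

section \<open>Bending and rewriting contexts\<close>

definition bend_par :: "nat \<Rightarrow> 'a \<Rightarrow> 'a" where
  "bend_par n A = cap_par n \<odot> (I n \<otimes> A)"

lemma bend_par_typ:
  assumes "arr A" "dm A = n"
  shows "arr (bend_par n A)" "dm (bend_par n A) = 0" "cd (bend_par n A) = n + cd A"
  using assms by (simp_all add: bend_par_def arrow_ty cap_par_typ)

text \<open>Caps insert one vector twice and sum over it, as fresh nodes with two legs range over
  all nodes of \<open>K\<close>.\<close>

lemma wc_cap_layer:
  assumes K: "hypergraph S K" and B: "arr B" "dm B = p + (n + n) + q" and x: "x \<in> vec K p" and z: "z
      \<in> vec K q"
    and b: "b \<in> vec K (cd B)"
  shows "wc K ((I p \<otimes> cap_par n \<otimes> I q) \<odot> B) (x @ z) b = (\<Sum>w\<in>vec K n. wc K B (x @ w @ w @ z) b)"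
proof -
  note [simp del] = sum_of_bool_eq sum_mult_of_bool_eq sum_of_bool_mult_eq
  have "wc K ((I p \<otimes> cap_par n \<otimes> I q) \<odot> B) (x @ [] @ z) b = (\<Sum>w\<in>vec K (n + n). wc K (cap_par n) [] w
      * wc K B (x @ w @ z) b)"
    using assms by (subst wc_layer) (auto simp: cap_par_typ)
  also have "\<dots> = (\<Sum>w\<in>vec K n. \<Sum>w'\<in>vec K n. of_bool (w = w') * wc K B (x @ w @ w' @ z) b)"
    by (simp add: sum_vec_add wc_cap_par[OF K])
  finally show ?thesis using fin[OF K] by (simp add: sum_of_bool_eq_mult)
qed

text \<open>Bending merely regroups the indices, so the entries of an arrow and of its bent form are
  the same numbers.\<close>

lemma wc_bend_par:
  assumes K: "hypergraph S K" and A: "arr A" "dm A = n" and a: "a \<in> vec K n" and b: "b \<in> vec K (cd A)"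
  shows "wc K (bend_par n A) [] (a @ b) = wc K A a b"
proof -
  note [simp del] = sum_of_bool_eq sum_mult_of_bool_eq sum_of_bool_mult_eq
  have ab: "a @ b \<in> vec K (n + cd A)" using a b by (rule append_in_vecI)
  have "wc K (bend_par n A) [] (a @ b) = (\<Sum>w\<in>vec K n. wc K (I n \<otimes> A) (w @ w) (a @ b))"
    using wc_cap_layer[of K "I n \<otimes> A" 0 n 0 "[]" "[]" "a @ b"] K A ab by (simp add: bend_par_def
        arrow_ty unit_laws cap_par_typ)
  also have "\<dots> = (\<Sum>w\<in>vec K n. of_bool (w = a) * wc K A w b)"
    using K A a b by (intro sum.cong HOL.refl) (subst wc_tn, auto simp: arrow_ty wc_I)
  finally show ?thesis using a fin[OF K] by (simp add: sum_of_bool_eq_mult)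
qed

lemma wc_bend_par_sq:
  assumes K: "hypergraph S K" and l: "arr l" "dm l = i" "cd l = j" and c: "arr c" "dm c = i + j" and
      b: "b \<in> vec K (cd c)"
  shows "wc K (bend_par i l \<odot> c) [] b = (\<Sum>x\<in>vec K i. \<Sum>y\<in>vec K j. wc K l x y * wc K c (x @ y) b)"
  using assms by (subst wc_sq) (simp_all add: bend_par_typ sum_vec_add wc_bend_par)

text \<open>The context seen from the rule: \<open>c\<close> consumes the whole boundary
  \<open>i + j\<close> of the bent rule side and returns the boundary of the bent composite. It is
  constructed before \<open>l\<close> is given, so that it can be used for both sides of a
  rule.\<close>

lemma bend_of_context:
  assumes c1: "arr c\<^sub>1" "dm c\<^sub>1 = n" "cd c\<^sub>1 = k + i" and c2: "arr c\<^sub>2" "dm c\<^sub>2 = k + j" "cd c\<^sub>2 = m"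
  obtains c where "arr c" "dm c = i + j" "cd c = n + m"
    "\<And>l. arr l \<Longrightarrow> dm l = i \<Longrightarrow> cd l = j \<Longrightarrow> bend_par n (c\<^sub>1 \<odot> (I k \<otimes> l) \<odot> c\<^sub>2) = bend_par i l \<odot> c"
proof
  note [simp del] = sum_of_bool_eq sum_mult_of_bool_eq sum_of_bool_mult_eq
  \<comment> \<open>The layers of \<open>c\<close> in reverse order. Caps create two copies of the
    outer input, \<open>c\<^sub>1\<close> acts on the second copy, cups join its last
    \<open>i\<close> outputs to the \<open>i\<close> input wires of the bent rule side, and
    \<open>c\<^sub>2\<close> receives the \<open>k\<close> remaining wires and the \<open>j\<close>
    outputs of the rule side.\<close>
  let ?B3 = "I n \<otimes> c\<^sub>2"
  let ?B2 = "(I (n + k) \<otimes> cup_par i \<otimes> I j) \<odot> ?B3"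
  let ?B1 = "(I n \<otimes> c\<^sub>1 \<otimes> I (i + j)) \<odot> ?B2"
  let ?c = "(I 0 \<otimes> cap_par n \<otimes> I (i + j)) \<odot> ?B1"
  have ty3: "arr ?B3" "dm ?B3 = n + k + 0 + j" "cd ?B3 = n + m" using c2 by (simp_all add: arrow_ty)
  have ty2: "arr ?B2" "dm ?B2 = n + (k + i) + (i + j)" "cd ?B2 = n + m" using c2 by (simp_all add:
      arrow_ty cup_par_typ)
  have ty1: "arr ?B1" "dm ?B1 = 0 + (n + n) + (i + j)" "cd ?B1 = n + m" using ty2 c1 by (simp_all
      add: arrow_ty)
  show smc_ty: "arr ?c" "dm ?c = i + j" "cd ?c = n + m" using ty1 by (simp_all add: arrow_ty cap_par_typ)
  fix l assume l: "arr l" "dm l = i" "cd l = j"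
  show "bend_par n (c\<^sub>1 \<odot> (I k \<otimes> l) \<odot> c\<^sub>2) = bend_par i l \<odot> ?c"
  proof (rule complete)
    let ?d = "c\<^sub>1 \<odot> (I k \<otimes> l) \<odot> c\<^sub>2"
    have d: "arr ?d" "dm ?d = n" "cd ?d = m" using c1 c2 l by (simp_all add: arrow_ty)
    show "arr (bend_par n ?d)" "dm (bend_par n ?d) = 0" "cd (bend_par n ?d) = n + m" using d by
        (simp_all add: bend_par_typ)
    show "arr (bend_par i l \<odot> ?c)" "dm (bend_par i l \<odot> ?c) = 0" "cd (bend_par i l \<odot> ?c) = n + m"
      using l smc_ty by (simp_all add: bend_par_typ arr_sq dm_sq cd_sq)
    fix K a b assume K: "hypergraph S K" and a: "a \<in> vec K 0" and "b \<in> vec K (n + m)"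
    then obtain s t where b: "b = s @ t" "s \<in> vec K n" "t \<in> vec K m" and st: "s @ t \<in> vec K (n + m)"
        by (auto simp: in_vec_add)
    \<comment> \<open>The entries are computed from the last layer back to the first; each delta
      removes one summation.\<close>
    have e3: "wc K ?B3 (a' @ w @ y) (s @ t) = of_bool (a' = s) * wc K c\<^sub>2 (w @ y) t"
      if "a' \<in> vec K n" "w \<in> vec K k" "y \<in> vec K j" for a' w y
      using K that b c2 append_in_vecI[OF that(2,3)] by (subst wc_tn) (auto simp: arrow_ty wc_I)
    have e2: "wc K ?B2 (a' @ (w @ w') @ (x @ y)) (s @ t) = of_bool (w' = x) * (of_bool (a' = s) * wc
        K c\<^sub>2 (w @ y) t)"
      if "a' \<in> vec K n" "w \<in> vec K k" "w' \<in> vec K i" "x \<in> vec K i" "y \<in> vec K j" for a' w w' x y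
    proof -
      have "wc K ?B2 ((a' @ w) @ (w' @ x) @ y) (s @ t) = wc K (cup_par i) (w' @ x) [] * wc K ?B3
          ((a' @ w) @ [] @ y) (s @ t)"
        using K that append_in_vecI[OF that(1,2)] append_in_vecI[OF that(3,4)] st ty3 by (subst
            wc_layer) (simp_all add: cup_par_typ)
      then show ?thesis using e3[OF that(1,2,5)] wc_cup_par[OF K that(3,4)] by simp
    qed
    have e1: "wc K ?B1 (a' @ a' @ (x @ y)) (s @ t) = of_bool (a' = s) * (\<Sum>w\<in>vec K k. wc K c\<^sub>1 a' (w
        @ x) * wc K c\<^sub>2 (w @ y) t)"
      if "a' \<in> vec K n" "x \<in> vec K i" "y \<in> vec K j" for a' x y
    proof -
      have "wc K ?B1 (a' @ a' @ (x @ y)) (s @ t) =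
          (\<Sum>w\<in>vec K k. \<Sum>w'\<in>vec K i. wc K c\<^sub>1 a' (w @ w') * wc K ?B2 (a' @ (w @ w') @ (x @ y)) (s @ t))"
        using K that append_in_vecI[OF that(2,3)] st ty2 c1 by (subst wc_layer) (simp_all add:
            sum_vec_add)
      also have "\<dots> = (\<Sum>w\<in>vec K k. \<Sum>w'\<in>vec K i. of_bool (w' = x) * (wc K c\<^sub>1 a' (w @ w') * (of_bool
          (a' = s) * wc K c\<^sub>2 (w @ y) t)))"
        using that by (intro sum.cong HOL.refl) (simp only: e2 mult_ac)
      also have "\<dots> = of_bool (a' = s) * (\<Sum>w\<in>vec K k. wc K c\<^sub>1 a' (w @ x) * wc K c\<^sub>2 (w @ y) t)"
        using that fin[OF K] by (simp add: sum_of_bool_eq_mult sum_distrib_left mult_ac)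
      finally show ?thesis .
    qed
    have e0: "wc K ?c (x @ y) (s @ t) = (\<Sum>w\<in>vec K k. wc K c\<^sub>1 s (w @ x) * wc K c\<^sub>2 (w @ y) t)"
      if "x \<in> vec K i" "y \<in> vec K j" for x y
    proof -
      have "wc K ?c ([] @ (x @ y)) (s @ t) = (\<Sum>a'\<in>vec K n. wc K ?B1 ([] @ a' @ a' @ (x @ y)) (s @ t))"
        using append_in_vecI[OF that] ty1 st K by (intro wc_cap_layer) simp_all
      also have "\<dots> = (\<Sum>a'\<in>vec K n. of_bool (a' = s) * (\<Sum>w\<in>vec K k. wc K c\<^sub>1 a' (w @ x) * wc K c\<^sub>2 (w
          @ y) t))"
        using that by (intro sum.cong HOL.refl) (simp only: e1 append_Nil)
      finally show ?thesis using b fin[OF K] by (simp add: sum_of_bool_eq_mult)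
    qed
    have "wc K (bend_par n ?d) a b = wc K ?d s t"
      using wc_bend_par[OF K d(1,2), of s t] a b d by simp
    also have "\<dots> = (\<Sum>w\<in>vec K k. \<Sum>x\<in>vec K i. wc K c\<^sub>1 s (w @ x) * wc K ((I k \<otimes> l) \<odot> c\<^sub>2) (w @ x) t)"
      using K b c1 c2 l by (subst wc_sq) (simp_all add: arrow_ty sum_vec_add)
    also have "\<dots> = (\<Sum>w\<in>vec K k. \<Sum>x\<in>vec K i. wc K c\<^sub>1 s (w @ x) * (\<Sum>y\<in>vec K j. wc K l x y * wc K c\<^sub>2
        (w @ y) t))"
      using K b c2 l by (intro sum.cong HOL.refl) (subst wc_layer_right, auto)
    also have "\<dots> = (\<Sum>w\<in>vec K k. \<Sum>x\<in>vec K i. \<Sum>y\<in>vec K j. wc K l x y * (wc K c\<^sub>1 s (w @ x) * wc K c\<^sub>2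
        (w @ y) t))"
      by (simp add: sum_distrib_left mult_ac)
    also have "\<dots> = (\<Sum>x\<in>vec K i. \<Sum>w\<in>vec K k. \<Sum>y\<in>vec K j. wc K l x y * (wc K c\<^sub>1 s (w @ x) * wc K c\<^sub>2
        (w @ y) t))"
      by (rule sum.swap)
    also have "\<dots> = (\<Sum>x\<in>vec K i. \<Sum>y\<in>vec K j. \<Sum>w\<in>vec K k. wc K l x y * (wc K c\<^sub>1 s (w @ x) * wc K c\<^sub>2
        (w @ y) t))"
      by (intro sum.cong HOL.refl sum.swap)
    also have "\<dots> = (\<Sum>x\<in>vec K i. \<Sum>y\<in>vec K j. wc K l x y * wc K ?c (x @ y) (s @ t))"
      by (intro sum.cong HOL.refl) (simp only: e0 sum_distrib_left)
    also have "\<dots> = wc K (bend_par i l \<odot> ?c) [] (s @ t)"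
      using wc_bend_par_sq[OF K l smc_ty(1,2)] smc_ty(3) st by simp
    finally show "wc K (bend_par n ?d) a b = wc K (bend_par i l \<odot> ?c) a b" using a b by simp
  qed
qed

text \<open>The input of \<open>d\<close> runs alongside on \<open>n\<close> wires until cups join
  it to the first outputs of \<open>c\<close>. Caps supply the \<open>i\<close> inputs of
  \<open>l\<close> and, on \<open>i\<close> further wires, the copy of them that \<open>c\<close>
  consumes. Hence \<open>n + i\<close> wires bypass \<open>l\<close>, and one context works for
  every \<open>d\<close> and \<open>l\<close>.\<close>

lemma context_of_bend:
  assumes c: "arr c" "dm c = i + j" "cd c = n + m"
  obtains c\<^sub>1 c\<^sub>2 where "arr c\<^sub>1" "dm c\<^sub>1 = n" "cd c\<^sub>1 = (n + i) + i" "arr c\<^sub>2" "dm c\<^sub>2 = (n + i) +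
      j" "cd c\<^sub>2 = m"
    "\<And>d l. arr d \<Longrightarrow> dm d = n \<Longrightarrow> cd d = m \<Longrightarrow> arr l \<Longrightarrow> dm l = i \<Longrightarrow> cd l = j \<Longrightarrow>
       bend_par n d = bend_par i l \<odot> c \<Longrightarrow> d = c\<^sub>1 \<odot> (I (n + i) \<otimes> l) \<odot> c\<^sub>2"
proof
  note [simp del] = sum_of_bool_eq sum_mult_of_bool_eq sum_of_bool_mult_eq
  let ?c1 = "I n \<otimes> cap_par i"
  let ?B = "cup_par n \<otimes> I m"
  let ?c2 = "(I n \<otimes> c) \<odot> ?B"
  show "arr ?c1" "dm ?c1 = n" "cd ?c1 = (n + i) + i" by (simp_all add: arrow_ty cap_par_typ)
  show c2: "arr ?c2" "dm ?c2 = (n + i) + j" "cd ?c2 = m" using c by (simp_all add: arrow_ty cup_par_typ)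
  fix d l assume d: "arr d" "dm d = n" "cd d = m" and l: "arr l" "dm l = i" "cd l = j"
    and eq: "bend_par n d = bend_par i l \<odot> c"
  let ?B1 = "(I (n + i) \<otimes> l) \<odot> ?c2"
  have B1: "arr ?B1" "dm ?B1 = n + (i + i)" "cd ?B1 = m" using l c2 by (simp_all add: arr_sq dm_sq
      cd_sq arr_tn dm_tn cd_tn I_typ)
  show "d = ?c1 \<odot> ?B1"
  proof (rule complete[OF d])
    show "arr (?c1 \<odot> ?B1)" "dm (?c1 \<odot> ?B1) = n" "cd (?c1 \<odot> ?B1) = m"
      using B1 by (simp_all add: arr_sq dm_sq cd_sq arr_tn dm_tn cd_tn I_typ cap_par_typ)
    fix K a b assume K: "hypergraph S K" and a: "a \<in> vec K n" and b: "b \<in> vec K m"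
    have ab: "a @ b \<in> vec K (cd c)" using append_in_vecI[OF a b] c by simp
    have e2: "wc K ?c2 (a @ x @ y) b = wc K c (x @ y) (a @ b)" if "x \<in> vec K i" "y \<in> vec K j" for x y
      by (rule wc_cup_par_layer[OF K c a append_in_vecI[OF that] b])
    have e1: "wc K ?B1 (a @ x @ x) b = (\<Sum>y\<in>vec K j. wc K l x y * wc K c (x @ y) (a @ b))" if "x \<in>
        vec K i" for x
    proof -
      have "wc K ?B1 ((a @ x) @ x) b = (\<Sum>y\<in>vec K j. wc K l x y * wc K ?c2 ((a @ x) @ y) b)"
        using wc_layer_right[of K l ?c2 "n + i" "a @ x" x b] K l c2 that append_in_vecI[OF a that] b
            by simp
      then show ?thesis using e2[OF that] by simp
    qed
    have "wc K (?c1 \<odot> ?B1) a b = (\<Sum>x\<in>vec K i. wc K ?B1 (a @ x @ x) b)"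
      using wc_cap_layer[of K ?B1 n i 0 a "[]" b] K a b B1 by (simp add: tn_I0 cap_par_typ)
    also have "\<dots> = (\<Sum>x\<in>vec K i. \<Sum>y\<in>vec K j. wc K l x y * wc K c (x @ y) (a @ b))"
      by (intro sum.cong HOL.refl e1)
    also have "\<dots> = wc K (bend_par i l \<odot> c) [] (a @ b)"
      using wc_bend_par_sq[OF K l c(1,2) ab] by simp
    also have "\<dots> = wc K d a b"
      unfolding eq[symmetric] using wc_bend_par[OF K d(1,2) a] b d by simp
    finally show "wc K d a b = wc K (?c1 \<odot> ?B1) a b" ..
  qed
qed

text \<open>The nodes and hyperedges of \<open>G\<close> are renumbered by initial segments, which
  gives a normal form with both legs as outputs; cups turn the outputs of the left leg into
  inputs.\<close>

theorem full:
  assumes l: "hom S (discrete n) G l" and r: "hom S (discrete m) G r"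
  obtains A where "arr A" "dm A = n" "cd A = m"
    "\<And>K a b. hypergraph S K \<Longrightarrow> a \<in> vec K n \<Longrightarrow> b \<in> vec K m \<Longrightarrow>
       card (homs S K (Cospan n l G r m) a b) = wc K A a b"
proof -
  have G: "hypergraph S G" using l by (simp add: hom_def)
  then have finG: "finite (nodes G)" "finite (edges G)" by (auto simp: hypergraph_def)
  obtain hn where hn: "bij_betw hn {..<card (nodes G)} (nodes G)"
    using ex_bij_betw_nat_finite[OF finG(1)] by (auto simp: atLeast0LessThan)
  obtain he where he: "bij_betw he {..<card (edges G)} (edges G)"
    using ex_bij_betw_nat_finite[OF finG(2)] by (auto simp: atLeast0LessThan)
  define v where "v = card (nodes G)"
  define ni where "ni = the_inv_into {..<v} hn"
  have ni: "ni x < v" "hn (ni x) = x" if "x \<in> nodes G" for x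
    using hn that the_inv_into_into[of hn "{..<v}" x "{..<v}"]
    by (auto simp: ni_def v_def bij_betw_def f_the_inv_into_f)
  have ni_map: "map (hn \<circ> ni) xs = xs" if "set xs \<subseteq> nodes G" for xs
    using that ni by (auto intro!: map_idI)
  let ?e = "\<lambda>i. (lab G (he i), map ni (srcs G (he i)), map ni (tgts G (he i)))"
  define es where "es = map ?e [0..<card (edges G)]"
  have heE: "he i \<in> edges G" if "i < card (edges G)" for i
    using he that by (auto simp: bij_betw_def)
  have sG: "set (srcs G (he i)) \<subseteq> nodes G" "set (tgts G (he i)) \<subseteq> nodes G" if "i < card (edges G)" for i
    using G heE[OF that] by (auto simp: hypergraph_def)
  have "wf_edge v (?e i)" if "i < card (edges G)" for i
  proof -
    have "below v (map ni (srcs G (he i)))" "below v (map ni (tgts G (he i)))"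
      using sG[OF that] ni(1) by auto
    then show ?thesis using G heE[OF that] by (simp add: wf_edge_def hypergraph_def)
  qed
  then have wf_edges: "wf_edges v es"
    by (auto simp: es_def)
  let ?f = "\<lparr> vmap = hn, emap = he \<rparr>"
  have len: "length es = card (edges G)" by (simp add: es_def)
  have "hom S (nf_graph v es) G ?f"
    unfolding hom_def using hypergraph_nf_graph[OF wf_edges] G hn heE ni_map[OF sG(1)] ni_map[OF sG(2)]
    by (auto simp: len v_def bij_betw_def) (auto simp: nf_graph_def es_def)
  then have iso: "iso S (nf_graph v es) G ?f"
    using hn he by (intro bij_hom_iso) (auto simp: len v_def bij_betw_def)
  let ?l = "node_mor (\<lambda>i. ni (vmap l i))" and ?r = "node_mor (\<lambda>i. ni (vmap r i))"
  have l': "hom S (discrete n) (nf_graph v es) ?l" and r': "hom S (discrete m) (nf_graph v es) ?r"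
    using l r ni hypergraph_nf_graph[OF wf_edges] by (auto simp: hom_discrete)
  have "cospan_iso S (Cospan n ?l (nf_graph v es) ?r m) (Cospan n l G r m)"
    using l r l' r' iso ni by (auto simp: leg_eq_def hom_discrete intro!: exI[of _ ?f])
  note card_iso = card_homs_iso[OF this]
  let ?p = "map (vmap ?l) [0..<n] @ map (vmap ?r) [0..<m]"
  have okp: "below v ?p" using l' r' by (auto simp: hom_discrete)
  let ?X = "nf v es ?p" and ?B = "cup_par n \<otimes> I m"
  note X = nf_typ[OF wf_edges okp]
  let ?A = "(I n \<otimes> ?X) \<odot> ?B"
  show ?thesis
  proof
    show "arr ?A" "dm ?A = n" "cd ?A = m" using X by (simp_all add: arrow_ty cup_par_typ)
    fix K a b assume K: "hypergraph S K" and a: "a \<in> vec K n" and b: "b \<in> vec K m"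
    have "wc K ?A (a @ []) b = wc K ?X [] (a @ b)"
      using X a b by (intro wc_cup_par_layer[OF K, where q = 0]) simp_all
    also have "\<dots> = card (homs S K (Cospan n l G r m) a b)"
      using card_homs_nf_graph[OF K wf_edges l' r' a b] card_iso by simp
    finally show "card (homs S K (Cospan n l G r m) a b) = wc K ?A a b" by simp
  qed
qed

end

section \<open>Presented PROPs as symmetric strict monoidal categories\<close>

lemma tm_class_empty: "tm_class S E t = {} \<longleftrightarrow> (\<nexists>n m. typed S t n m)"
  unfolding tm_class_def using tm_eq_typed tm_eq.refl by blast

lemma tm_eq_type_unique:
  assumes "tm_eq S E n m s t" "typed S s n' m' \<or> typed S t n' m'"
  shows "n' = n \<and> m' = m"
  using typed_tdom_tcod tm_eq_typed[OF assms(1)] assms(2) by metis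

lemma tm_class_eq:
  assumes "tm_eq S E n m s t"
  shows "tm_class S E s = tm_class S E t"
proof (intro set_eqI iffI)
  fix u assume "u \<in> tm_class S E s"
  then obtain n' m' where "tm_eq S E n' m' s u" by (auto simp: tm_class_def)
  moreover from this have "n' = n" "m' = m"
    using tm_eq_type_unique[OF assms] tm_eq_typed by blast+
  ultimately show "u \<in> tm_class S E t"
    using assms tm_eq.sym tm_eq.trans unfolding tm_class_def by blast
next
  fix u assume "u \<in> tm_class S E t"
  then obtain n' m' where "tm_eq S E n' m' t u" by (auto simp: tm_class_def)
  moreover from this have "n' = n" "m' = m"
    using tm_eq_type_unique[OF assms] tm_eq_typed by blast+
  ultimately show "u \<in> tm_class S E s"
    using assms tm_eq.trans unfolding tm_class_def by blast
qed

lemma tm_class_refl: "typed S t n m \<Longrightarrow> t \<in> tm_class S E t"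
  unfolding tm_class_def using tm_eq.refl by blast

inductive_cases typed_seqE: "typed S (s ;; t) n m"
inductive_cases typed_tenE: "typed S (s || t) n m"

text \<open>The laws of a strict monoidal category that mention no types hold for arbitrary sets of terms,
  because ill-typed composites are the empty class.\<close>

lemma UN_tm_class:
  assumes "\<And>x. x \<in> tm_class S E s \<Longrightarrow> tm_class S E (f x) = tm_class S E (f s)"
    and "\<And>n m. typed S (f s) n m \<Longrightarrow> \<exists>n m. typed S s n m"
  shows "(\<Union>x\<in>tm_class S E s. tm_class S E (f x)) = tm_class S E (f s)"
proof (cases "tm_class S E (f s) = {}")
  case True
  then show ?thesis using assms(1) by auto
next
  case False
  then obtain n m where "typed S s n m" using assms(2) unfolding tm_class_empty by blast
  then have "s \<in> tm_class S E s" by (rule tm_class_refl)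
  then show ?thesis using assms(1) by blast
qed

text \<open>The arbitrary term \<open>u\<close> may make the composites ill-typed. Equivalent terms
  have the same types, so both composites are then ill-typed and both classes are empty.\<close>

lemma tm_class_cong:
  assumes "tm_eq S E n m s x"
  shows "tm_class S E (s ;; u) = tm_class S E (x ;; u)" "tm_class S E (u ;; s) = tm_class S E (u ;; x)"
    "tm_class S E (s || u) = tm_class S E (x || u)" "tm_class S E (u || s) = tm_class S E (u || x)"
proof -
  have ty: "typed S s a b \<longleftrightarrow> typed S x a b" for a b
    using tm_eq_type_unique[OF assms] tm_eq_typed[OF assms] by blast
  have eq: "tm_eq S E a b s x" if "typed S s a b" for a b
    using tm_eq_type_unique[OF assms] that assms by blast
  have *: "tm_class S E v = tm_class S E w"
    if "\<And>a b. typed S v a b \<Longrightarrow> tm_eq S E a b v w" "\<And>a b. typed S v a b \<longleftrightarrow> typed S w a b" for v w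
  proof (cases "tm_class S E v = {}")
    case True
    then show ?thesis using that(2) tm_class_empty by metis
  next
    case False
    then show ?thesis using that(1) tm_class_eq tm_class_empty by metis
  qed
  show "tm_class S E (s ;; u) = tm_class S E (x ;; u)" "tm_class S E (u ;; s) = tm_class S E (u ;; x)"
    "tm_class S E (s || u) = tm_class S E (x || u)" "tm_class S E (u || s) = tm_class S E (u || x)"
    by (rule *; auto simp: ty elim!: typed_seqE typed_tenE intro!: tm_eq.seq_cong tm_eq.ten_cong eq
        intro: tm_eq.refl typed.intros)+
qed

text \<open>These collapse the unions over representatives in \<open>presented_prop\<close>, one
  argument at a time.\<close>

lemma UN_tm_class_simps:
  "(\<Union>x\<in>tm_class S E s. tm_class S E (x ;; u)) = tm_class S E (s ;; u)"
  "(\<Union>x\<in>tm_class S E s. tm_class S E (u ;; x)) = tm_class S E (u ;; s)"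
  "(\<Union>x\<in>tm_class S E s. tm_class S E (x || u)) = tm_class S E (s || u)"
  "(\<Union>x\<in>tm_class S E s. tm_class S E (u || x)) = tm_class S E (u || s)"
proof -
  have eq: "\<exists>n m. tm_eq S E n m s x" if "x \<in> tm_class S E s" for x
    using that by (auto simp: tm_class_def)
  show "(\<Union>x\<in>tm_class S E s. tm_class S E (x ;; u)) = tm_class S E (s ;; u)"
    by (rule UN_tm_class) (use eq tm_class_cong(1) in \<open>blast elim: typed_seqE\<close>)+
  show "(\<Union>x\<in>tm_class S E s. tm_class S E (u ;; x)) = tm_class S E (u ;; s)"
    by (rule UN_tm_class) (use eq tm_class_cong(2) in \<open>blast elim: typed_seqE\<close>)+
  show "(\<Union>x\<in>tm_class S E s. tm_class S E (x || u)) = tm_class S E (s || u)"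
    by (rule UN_tm_class) (use eq tm_class_cong(3) in \<open>blast elim: typed_tenE\<close>)+
  show "(\<Union>x\<in>tm_class S E s. tm_class S E (u || x)) = tm_class S E (u || s)"
    by (rule UN_tm_class) (use eq tm_class_cong(4) in \<open>blast elim: typed_tenE\<close>)+
qed

lemma tm_class_eqI:
  assumes "\<And>n m. typed S s n m \<Longrightarrow> tm_eq S E n m s t" "\<And>n m. typed S t n m \<Longrightarrow> tm_eq S E n m s t"
  shows "tm_class S E s = tm_class S E t"
proof (cases "\<exists>n m. typed S s n m \<or> typed S t n m")
  case True
  then show ?thesis using assms tm_class_eq by blast
next
  case False
  then show ?thesis using tm_class_empty by metis
qed

lemma presented_prop_simps:
  "seq (presented_prop S E) A B = (\<Union>s\<in>A. \<Union>t\<in>B. tm_class S E (s ;; t))"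
  "ten (presented_prop S E) A B = (\<Union>s\<in>A. \<Union>t\<in>B. tm_class S E (s || t))"
  "Idn (presented_prop S E) n = tm_class S E (TId n)"
  "Symm (presented_prop S E) n m = tm_class S E (TSym n m)"
  "Hom (presented_prop S E) n m = {tm_class S E t | t. typed S t n m}"
  by (simp_all add: presented_prop_def)

lemma seq_tm_class: "seq (presented_prop S E) (tm_class S E s) (tm_class S E t) = tm_class S E (s ;; t)"
proof -
  have "(\<Union>x\<in>tm_class S E s. \<Union>y\<in>tm_class S E t. tm_class S E (x ;; y)) = tm_class S E (s ;; t)"
    by (simp only: UN_tm_class_simps)
  then show ?thesis by (simp only: presented_prop_simps)
qed

lemma ten_tm_class: "ten (presented_prop S E) (tm_class S E s) (tm_class S E t) = tm_class S E (s || t)"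
proof -
  have "(\<Union>x\<in>tm_class S E s. \<Union>y\<in>tm_class S E t. tm_class S E (x || y)) = tm_class S E (s || t)"
    by (simp only: UN_tm_class_simps)
  then show ?thesis by (simp only: presented_prop_simps)
qed

lemma ten_assoc_class: "tm_class S E ((s || t) || u) = tm_class S E (s || (t || u))"
proof (rule tm_class_eqI)
  fix n m assume "typed S ((s || t) || u) n m"
  then show "tm_eq S E n m ((s || t) || u) (s || (t || u))"
    by (auto elim!: typed_tenE intro: tm_eq.ten_assoc)
next
  fix n m assume "typed S (s || (t || u)) n m"
  then obtain n1 m1 n2 m2 n3 m3 where "typed S s n1 m1" "typed S t n2 m2" "typed S u n3 m3"
    "n = n1 + n2 + n3" "m = m1 + m2 + m3"
    by (auto elim!: typed_tenE)
  then show "tm_eq S E n m ((s || t) || u) (s || (t || u))"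
    by (simp add: tm_eq.ten_assoc)
qed

lemma seq_assoc_class: "tm_class S E ((s ;; t) ;; u) = tm_class S E (s ;; (t ;; u))"
  by (rule tm_class_eqI) (auto elim!: typed_seqE intro: tm_eq.seq_assoc)

text \<open>Interchange, with \<open>TId k\<close> written as \<open>TId k ;; TId k\<close>.\<close>

lemma whisker_right_class: "tm_class S E ((s ;; t) || TId k) = tm_class S E ((s || TId k) ;; (t ||
    TId k))"
proof -
  have *: "tm_eq S E (n + k) (m + k) ((s ;; t) || TId k) ((s || TId k) ;; (t || TId k))"
    if "typed S s n l" "typed S t l m" for n l m
  proof -
    have "tm_eq S E (n + k) (m + k) ((s ;; t) || (TId k ;; TId k)) ((s || TId k) ;; (t || TId k))"
      using that by (intro tm_eq.interchange) (auto intro: typed.intros)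
    moreover have "tm_eq S E (n + k) (m + k) ((s ;; t) || (TId k ;; TId k)) ((s ;; t) || TId k)"
      using that by (intro tm_eq.ten_cong tm_eq.refl tm_eq.seq_id_left) (auto intro: typed.intros)
    ultimately show ?thesis using tm_eq.sym tm_eq.trans by blast
  qed
  have id: "a = k \<and> b = k" if "typed S (TId k) a b" for a b
    using typed_tdom_tcod[OF that] by simp
  show ?thesis
    by (rule tm_class_eqI) (auto elim!: typed_seqE typed_tenE dest!: id intro: *)
qed

lemma whisker_left_class: "tm_class S E (TId k || (s ;; t)) = tm_class S E ((TId k || s) ;; (TId k
    || t))"
proof -
  have *: "tm_eq S E (k + n) (k + m) (TId k || (s ;; t)) ((TId k || s) ;; (TId k || t))"
    if "typed S s n l" "typed S t l m" for n l m
  proof -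
    have "tm_eq S E (k + n) (k + m) ((TId k ;; TId k) || (s ;; t)) ((TId k || s) ;; (TId k || t))"
      using that by (intro tm_eq.interchange) (auto intro: typed.intros)
    moreover have "tm_eq S E (k + n) (k + m) ((TId k ;; TId k) || (s ;; t)) (TId k || (s ;; t))"
      using that by (intro tm_eq.ten_cong tm_eq.refl tm_eq.seq_id_left) (auto intro: typed.intros)
    ultimately show ?thesis using tm_eq.sym tm_eq.trans by blast
  qed
  have id: "a = k \<and> b = k" if "typed S (TId k) a b" for a b
    using typed_tdom_tcod[OF that] by simp
  show ?thesis
    by (rule tm_class_eqI) (auto elim!: typed_seqE typed_tenE dest!: id intro: *)
qed

text \<open>All terms of a class share one type, so any chosen representative gives the domain of
  the arrow.\<close>

definition pdom :: "'g signature \<Rightarrow> 'g tm set \<Rightarrow> nat" where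
  "pdom S A = tdom S (SOME t. t \<in> A)"

definition pcod :: "'g signature \<Rightarrow> 'g tm set \<Rightarrow> nat" where
  "pcod S A = tcod S (SOME t. t \<in> A)"

definition parr :: "'g signature \<Rightarrow> ('g tm \<times> 'g tm) set \<Rightarrow> 'g tm set \<Rightarrow> bool" where
  "parr S E A \<longleftrightarrow> (\<exists>t n m. typed S t n m \<and> A = tm_class S E t)"

lemma some_in_tm_class:
  assumes "typed S t n m"
  shows "tm_eq S E n m t (SOME u. u \<in> tm_class S E t)"
proof -
  have "(SOME u. u \<in> tm_class S E t) \<in> tm_class S E t"
    using tm_class_refl[OF assms] by (rule someI)
  then obtain n' m' where *: "tm_eq S E n' m' t (SOME u. u \<in> tm_class S E t)"
    by (auto simp: tm_class_def)
  then show ?thesis using tm_eq_type_unique[OF *] assms by blast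
qed

lemma parr_tm_class:
  assumes "typed S t n m"
  shows "parr S E (tm_class S E t)" "pdom S (tm_class S E t) = n" "pcod S (tm_class S E t) = m"
  using assms some_in_tm_class[OF assms, of E, THEN tm_eq_typed] typed_tdom_tcod
  unfolding parr_def pdom_def pcod_def by blast+

lemma Hom_iff: "A \<in> Hom (presented_prop S E) n m \<longleftrightarrow> parr S E A \<and> pdom S A = n \<and> pcod S A = m"
  unfolding presented_prop_simps using parr_tm_class by (fastforce simp: parr_def)

lemma parrE:
  assumes "parr S E A"
  obtains t where "A = tm_class S E t" "typed S t (pdom S A) (pcod S A)"
  using assms parr_tm_class unfolding parr_def by metis

lemma UN_flatten:
  "(\<Union>x\<in>(\<Union>s\<in>A. \<Union>t\<in>B. F s t). G x) = (\<Union>s\<in>A. \<Union>t\<in>B. \<Union>x\<in>F s t. G x)"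
  "(\<Union>x\<in>(\<Union>s\<in>A. F' s). \<Union>y\<in>(\<Union>t\<in>B. G' t). K x y) = (\<Union>s\<in>A. \<Union>t\<in>B. \<Union>x\<in>F' s. \<Union>y\<in>G' t. K x y)"
  by auto

text \<open>Associativity and whiskering are proved for arbitrary sets of terms by distributing
  unions. The laws with typing conditions are proved on representatives supplied by
  \<open>parrE\<close>.\<close>

lemma smc_presented_prop:
  "smc (parr S E) (pdom S) (pcod S) (seq (presented_prop S E)) (ten (presented_prop S E))
     (Idn (presented_prop S E)) (Symm (presented_prop S E))"
proof -
  let ?X = "presented_prop S E"
  show ?thesis
  proof
    fix f g h
    show "seq ?X (seq ?X f g) h = seq ?X f (seq ?X g h)"
    proof -
      have "seq ?X (seq ?X f g) h = (\<Union>s\<in>f. \<Union>t\<in>g. \<Union>u\<in>h. \<Union>x\<in>tm_class S E (s ;; t). tm_class S E (x ;; u))"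
        unfolding presented_prop_simps by blast
      also have "\<dots> = (\<Union>s\<in>f. \<Union>t\<in>g. \<Union>u\<in>h. \<Union>x\<in>tm_class S E (t ;; u). tm_class S E (s ;; x))"
        by (simp only: UN_tm_class_simps seq_assoc_class)
      also have "\<dots> = seq ?X f (seq ?X g h)"
        unfolding presented_prop_simps by blast
      finally show ?thesis .
    qed
    show "ten ?X (ten ?X f g) h = ten ?X f (ten ?X g h)"
    proof -
      have "ten ?X (ten ?X f g) h = (\<Union>s\<in>f. \<Union>t\<in>g. \<Union>u\<in>h. \<Union>x\<in>tm_class S E (s || t). tm_class S E (x || u))"
        unfolding presented_prop_simps by blast
      also have "\<dots> = (\<Union>s\<in>f. \<Union>t\<in>g. \<Union>u\<in>h. \<Union>x\<in>tm_class S E (t || u). tm_class S E (s || x))"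
        by (simp only: UN_tm_class_simps ten_assoc_class)
      also have "\<dots> = ten ?X f (ten ?X g h)"
        unfolding presented_prop_simps by blast
      finally show ?thesis .
    qed
    fix k
    have r: "ten ?X f (Idn ?X k) = (\<Union>s\<in>f. tm_class S E (s || TId k))"
      for f by (simp only: presented_prop_simps UN_tm_class_simps)
    have l: "ten ?X (Idn ?X k) f = (\<Union>s\<in>f. tm_class S E (TId k || s))" for f
    proof -
      have "ten ?X (Idn ?X k) f = (\<Union>s\<in>f. \<Union>x\<in>tm_class S E (TId k). tm_class S E (x || s))"
        unfolding presented_prop_simps by blast
      then show ?thesis by (simp only: UN_tm_class_simps)
    qed
    show "ten ?X (seq ?X f g) (Idn ?X k) = seq ?X (ten ?X f (Idn ?X k)) (ten ?X g (Idn ?X k))"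
    proof -
      have "ten ?X (seq ?X f g) (Idn ?X k) = (\<Union>s\<in>f. \<Union>t\<in>g. \<Union>x\<in>tm_class S E (s ;; t). tm_class S E (x
          || TId k))"
        unfolding r unfolding presented_prop_simps by (rule UN_flatten(1))
      also have "\<dots> = (\<Union>s\<in>f. \<Union>t\<in>g. \<Union>x\<in>tm_class S E (s || TId k). \<Union>y\<in>tm_class S E (t || TId k).
          tm_class S E (x ;; y))"
        by (simp only: UN_tm_class_simps whisker_right_class)
      also have "\<dots> = seq ?X (ten ?X f (Idn ?X k)) (ten ?X g (Idn ?X k))"
        unfolding r unfolding presented_prop_simps by (rule UN_flatten(2)[symmetric])
      finally show ?thesis .
    qed
    show "ten ?X (Idn ?X k) (seq ?X f g) = seq ?X (ten ?X (Idn ?X k) f) (ten ?X (Idn ?X k) g)"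
    proof -
      have "ten ?X (Idn ?X k) (seq ?X f g) = (\<Union>s\<in>f. \<Union>t\<in>g. \<Union>x\<in>tm_class S E (s ;; t). tm_class S E
          (TId k || x))"
        unfolding l unfolding presented_prop_simps by (rule UN_flatten(1))
      also have "\<dots> = (\<Union>s\<in>f. \<Union>t\<in>g. \<Union>x\<in>tm_class S E (TId k || s). \<Union>y\<in>tm_class S E (TId k || t).
          tm_class S E (x ;; y))"
        by (simp only: UN_tm_class_simps whisker_left_class)
      also have "\<dots> = seq ?X (ten ?X (Idn ?X k) f) (ten ?X (Idn ?X k) g)"
        unfolding l unfolding presented_prop_simps by (rule UN_flatten(2)[symmetric])
      finally show ?thesis .
    qed
  next
    fix n m
    show "ten ?X (Idn ?X n) (Idn ?X m) = Idn ?X (n + m)"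
      using tm_class_eq[OF tm_eq.ten_id] by (simp only: ten_tm_class presented_prop_simps(3))
    show "parr S E (Idn ?X n)" "pdom S (Idn ?X n) = n" "pcod S (Idn ?X n) = n"
      using parr_tm_class[OF typed.intros(2)[of S n]] by (simp_all only: presented_prop_simps)
    show "parr S E (Symm ?X n m)" "pdom S (Symm ?X n m) = n + m" "pcod S (Symm ?X n m) = m + n"
      using parr_tm_class[OF typed.intros(3)[of S n m]] by (simp_all only: presented_prop_simps)
    show "seq ?X (Symm ?X n m) (Symm ?X m n) = Idn ?X (n + m)"
      using tm_class_eq[OF tm_eq.sym_inverse] by (simp only: seq_tm_class presented_prop_simps(3,4))
    show "Symm ?X n 0 = Idn ?X n"
      using tm_class_eq[OF tm_eq.sym_unit] by (simp only: presented_prop_simps(3,4))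
    fix k
    show "Symm ?X n (m + k) = seq ?X (ten ?X (Symm ?X n m) (Idn ?X k)) (ten ?X (Idn ?X m) (Symm ?X n k))"
      using tm_class_eq[OF tm_eq.sym_hexagon] by (simp only: seq_tm_class ten_tm_class
          presented_prop_simps(3,4))
  next
    fix f g assume f: "parr S E f" and g: "parr S E g"
    obtain s where s: "f = tm_class S E s" "typed S s (pdom S f) (pcod S f)" using f by (rule parrE)
    obtain t where t: "g = tm_class S E t" "typed S t (pdom S g) (pcod S g)" using g by (rule parrE)
    have "ten ?X f g = tm_class S E (s || t)" by (simp only: s(1) t(1) ten_tm_class)
    then show "parr S E (ten ?X f g)" "pdom S (ten ?X f g) = pdom S f + pdom S g" "pcod S (ten ?X f
        g) = pcod S f + pcod S g"
      using parr_tm_class[OF typed.intros(5)[OF s(2) t(2)]] by simp_all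
    have "tm_class S E ((s || t) ;; TSym (pcod S f) (pcod S g)) = tm_class S E (TSym (pdom S f)
        (pdom S g) ;; (t || s))"
      using tm_class_eq[OF tm_eq.sym_natural[OF s(2) t(2)]] .
    then show "seq ?X (ten ?X f g) (Symm ?X (pcod S f) (pcod S g)) = seq ?X (Symm ?X (pdom S f)
        (pdom S g)) (ten ?X g f)"
      unfolding presented_prop_simps(4) by (metis s(1) t(1) seq_tm_class ten_tm_class)
    assume c: "pcod S f = pdom S g"
    have "seq ?X f g = tm_class S E (s ;; t)" by (simp only: s(1) t(1) seq_tm_class)
    then show "parr S E (seq ?X f g)" "pdom S (seq ?X f g) = pdom S f" "pcod S (seq ?X f g) = pcod S g"
      using parr_tm_class[OF typed.intros(4)[OF s(2) t(2)[folded c]]] by simp_all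
    fix f' g' assume f': "parr S E f'" and g': "parr S E g'" and c': "pcod S f' = pdom S g'"
    obtain s' where s': "f' = tm_class S E s'" "typed S s' (pdom S f') (pcod S f')" using f' by
        (rule parrE)
    obtain t' where t': "g' = tm_class S E t'" "typed S t' (pdom S g') (pcod S g')" using g' by
        (rule parrE)
    have "tm_class S E ((s ;; t) || (s' ;; t')) = tm_class S E ((s || s') ;; (t || t'))"
      using tm_class_eq[OF tm_eq.interchange[OF s(2) t(2)[folded c] s'(2) t'(2)[folded c']]] .
    then show "ten ?X (seq ?X f g) (seq ?X f' g') = seq ?X (ten ?X f f') (ten ?X g g')"
      by (metis s(1) t(1) s'(1) t'(1) seq_tm_class ten_tm_class)
  next
    fix f n assume f: "parr S E f"
    obtain s where s: "f = tm_class S E s" "typed S s (pdom S f) (pcod S f)" using f by (rule parrE)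
    show "seq ?X (Idn ?X n) f = f" if "pdom S f = n"
      unfolding that[symmetric] presented_prop_simps(3) using tm_class_eq[OF tm_eq.seq_id_left[OF
          s(2)]] by (metis s(1) seq_tm_class)
    show "seq ?X f (Idn ?X n) = f" if "pcod S f = n"
      unfolding that[symmetric] presented_prop_simps(3) using tm_class_eq[OF tm_eq.seq_id_right[OF
          s(2)]] by (metis s(1) seq_tm_class)
    show "ten ?X (Idn ?X 0) f = f"
      unfolding presented_prop_simps(3) using tm_class_eq[OF tm_eq.ten_unit_left[OF s(2)]] by (metis
          s(1) ten_tm_class)
    show "ten ?X f (Idn ?X 0) = f"
      unfolding presented_prop_simps(3) using tm_class_eq[OF tm_eq.ten_unit_right[OF s(2)]] by
          (metis s(1) ten_tm_class)
  qed
qed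

section \<open>Double-pushout rewriting of bent arrows\<close>

text \<open>A recursive form of \<open>typed\<close>, by which the simplifier decides that the two
  sides of a Frobenius equation are well-typed.\<close>

primrec wt :: "'g signature \<Rightarrow> 'g tm \<Rightarrow> bool" where
  "wt S (Gen g) \<longleftrightarrow> g \<in> gens S"
| "wt S (TId n) \<longleftrightarrow> True"
| "wt S (TSym n m) \<longleftrightarrow> True"
| "wt S (s ;; t) \<longleftrightarrow> wt S s \<and> wt S t \<and> tcod S s = tdom S t"
| "wt S (s || t) \<longleftrightarrow> wt S s \<and> wt S t"

lemma wt_typed: "wt S t \<Longrightarrow> typed S t (tdom S t) (tcod S t)"
proof (induction t)
  case (TSeq s t)
  then show ?case using typed.intros(4)[of S s "tdom S s" "tcod S s" t "tcod S t"] by simp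
qed (auto intro: typed.intros)

abbreviation fclass :: "'g signature \<Rightarrow> ('g + frob) tm \<Rightarrow> 'g sfrob_arrow" where
  "fclass S \<equiv> tm_class (fsig S) feqs"

lemma SFrob_class:
  "seq (SFrob S) (fclass S s) (fclass S t) = fclass S (s ;; t)"
  "ten (SFrob S) (fclass S s) (fclass S t) = fclass S (s || t)"
  "Idn (SFrob S) n = fclass S (TId n)" "Symm (SFrob S) n m = fclass S (TSym n m)"
  "frob_arrow S x = fclass S (Gen (Inr x))"
  by (simp_all only: SFrob_def seq_tm_class ten_tm_class presented_prop_simps(3,4) frob_arrow_def)

lemma fclass_frob_eq:
  assumes "(s, t) \<in> frob_eqs" "wt (fsig S) (map_tm Inr s)" "wt (fsig S) (map_tm Inr t)"
    "tdom (fsig S) (map_tm Inr s) = tdom (fsig S) (map_tm Inr t)" "tcod (fsig S) (map_tm Inr s) =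
        tcod (fsig S) (map_tm Inr t)"
  shows "fclass S (map_tm Inr s) = fclass S (map_tm Inr t)"
proof (rule tm_class_eq, rule tm_eq.axiom)
  show "(map_tm Inr s, map_tm Inr t) \<in> feqs"
    using assms(1) by (auto simp: sum_eqs_def image_iff Bex_def map_prod_def split: prod.splits)
  show "typed (fsig S) (map_tm Inr s) (tdom (fsig S) (map_tm Inr s)) (tcod (fsig S) (map_tm Inr s))"
    using assms(2) by (rule wt_typed)
  show "typed (fsig S) (map_tm Inr t) (tdom (fsig S) (map_tm Inr s)) (tcod (fsig S) (map_tm Inr s))"
    unfolding assms(4,5) using assms(3) by (rule wt_typed)
qed

lemma frob_eqs_mem:
  "((Gen Mu || TId 1) ;; Gen Mu, (TId 1 || Gen Mu) ;; Gen Mu) \<in> frob_eqs"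
  "((Gen Eta || TId 1) ;; Gen Mu, TId 1) \<in> frob_eqs"
  "((TId 1 || Gen Eta) ;; Gen Mu, TId 1) \<in> frob_eqs"
  "(TSym 1 1 ;; Gen Mu, Gen Mu) \<in> frob_eqs"
  "(Gen Delta ;; (Gen Delta || TId 1), Gen Delta ;; (TId 1 || Gen Delta)) \<in> frob_eqs"
  "(Gen Delta ;; (Gen Eps || TId 1), TId 1) \<in> frob_eqs"
  "(Gen Delta ;; (TId 1 || Gen Eps), TId 1) \<in> frob_eqs"
  "(Gen Delta ;; TSym 1 1, Gen Delta) \<in> frob_eqs"
  "((Gen Delta || TId 1) ;; (TId 1 || Gen Mu), Gen Mu ;; Gen Delta) \<in> frob_eqs"
  "((TId 1 || Gen Delta) ;; (Gen Mu || TId 1), Gen Mu ;; Gen Delta) \<in> frob_eqs"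
  "(Gen Delta ;; Gen Mu, TId 1) \<in> frob_eqs"
  by (simp_all add: frob_eqs_def)

lemma fsig_simps [simp]:
  "Inl g \<in> gens (fsig S) \<longleftrightarrow> g \<in> gens S" "Inr x \<in> gens (fsig S)" "ar (fsig S) (Inl g) = ar S g" "coar
      (fsig S) (Inl g) = coar S g"
  "ar (fsig S) (Inr x) = ar frob_sig x" "coar (fsig S) (Inr x) = coar frob_sig x"
  by (auto simp: sum_sig_def frob_sig_def)

lemma frob_sig_simps [simp]:
  "ar frob_sig Mu = 2" "coar frob_sig Mu = 1" "ar frob_sig Eta = 0" "coar frob_sig Eta = 1"
  "ar frob_sig Delta = 1" "coar frob_sig Delta = 2" "ar frob_sig Eps = 1" "coar frob_sig Eps = 0"
  by (simp_all add: frob_sig_def)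

text \<open>By \<open>wgt_sound\<close> the entries at indices of the right lengths do not depend on
  the chosen representative.\<close>

definition cwgt :: "'g signature \<Rightarrow> 'g hypergraph \<Rightarrow> 'g sfrob_arrow \<Rightarrow> nat list \<Rightarrow> nat list \<Rightarrow> nat" where
  "cwgt S K A = wgt S K (SOME t. t \<in> A)"

lemma cwgt_fclass:
  assumes "typed (fsig S) t n m" "hypergraph S K" "a \<in> vec K n" "b \<in> vec K m"
  shows "cwgt S K (fclass S t) a b = wgt S K t a b"
  using wgt_sound[OF some_in_tm_class[OF assms(1), of feqs], of K a b] assms
  by (simp add: cwgt_def hypergraph_def)

lemma Phi_eq_Sem:
  assumes "parr (fsig S) feqs A"
  shows "Phi S A = Sem S (pdom (fsig S) A) (pcod (fsig S) A) (\<lambda>K. cwgt S K A)" "Phi S A \<noteq> {}"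
proof -
  obtain t where t: "A = fclass S t" "typed (fsig S) t (pdom (fsig S) A) (pcod (fsig S) A)"
    using assms by (rule parrE)
  show "Phi S A = Sem S (pdom (fsig S) A) (pcod (fsig S) A) (\<lambda>K. cwgt S K A)" "Phi S A \<noteq> {}"
    using Phi_Sem[OF t(2)] cwgt_fclass[OF t(2)] unfolding t(1)[symmetric] by (auto simp: Sem_def)
qed

text \<open>Connects the abstract development with the presentation: the Frobenius laws are axioms
  of \<open>feqs\<close>, the matrix laws are the defining equations of \<open>wgt\<close> on
  representatives, and \<open>arr_induct\<close> is rule induction on typing derivations.\<close>

theorem frobenius_wgt_SFrob:
  "frobenius_wgt (parr (fsig S) feqs) (pdom (fsig S)) (pcod (fsig S)) (seq (SFrob S)) (ten (SFrob S))
     (Idn (SFrob S)) (Symm (SFrob S)) (frob_arrow S Mu) (frob_arrow S Eta) (frob_arrow S Delta)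
         (frob_arrow S Eps)
     S (\<lambda>g. fclass S (Gen (Inl g))) (cwgt S)"
proof -
  interpret smc "parr (fsig S) feqs" "pdom (fsig S)" "pcod (fsig S)" "seq (SFrob S)" "ten (SFrob S)"
    "Idn (SFrob S)" "Symm (SFrob S)"
    unfolding SFrob_def by (rule smc_presented_prop)
  have g: "typed (fsig S) (Gen (Inl g)) (ar S g) (coar S g)" if "g \<in> gens S" for g
    using wt_typed[of "fsig S" "Gen (Inl g)"] that by auto
  have fr: "typed (fsig S) (Gen (Inr x)) (ar frob_sig x) (coar frob_sig x)" for x
    using wt_typed[of "fsig S" "Gen (Inr x)"] by auto
  note fr' = fr[of Mu] fr[of Eta] fr[of Delta] fr[of Eps]
  have [simp]: "finite (nodes K)" if "hypergraph S K" for K :: "'a hypergraph"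
    using that by (simp add: hypergraph_def)
  show ?thesis
  proof
    show "parr (fsig S) feqs (frob_arrow S Mu)" "pdom (fsig S) (frob_arrow S Mu) = 2" "pcod (fsig S)
        (frob_arrow S Mu) = 1"
      "parr (fsig S) feqs (frob_arrow S Eta)" "pdom (fsig S) (frob_arrow S Eta) = 0" "pcod (fsig S)
          (frob_arrow S Eta) = 1"
      "parr (fsig S) feqs (frob_arrow S Delta)" "pdom (fsig S) (frob_arrow S Delta) = 1" "pcod (fsig
          S) (frob_arrow S Delta) = 2"
      "parr (fsig S) feqs (frob_arrow S Eps)" "pdom (fsig S) (frob_arrow S Eps) = 1" "pcod (fsig S)
          (frob_arrow S Eps) = 0"
      using parr_tm_class[OF fr'(1), of feqs] parr_tm_class[OF fr'(2), of feqs] parr_tm_class[OF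
          fr'(3), of feqs]
        parr_tm_class[OF fr'(4), of feqs]
      by (simp_all add: SFrob_class)
    \<comment> \<open>The typing conditions form one conjunction, which the simplifier evaluates for
      each of the concrete equations.\<close>
    have ax: "(s, t) \<in> frob_eqs \<Longrightarrow> wt (fsig S) (map_tm Inr s) \<and> wt (fsig S) (map_tm Inr t) \<and>
        tdom (fsig S) (map_tm Inr s) = tdom (fsig S) (map_tm Inr t) \<and>
        tcod (fsig S) (map_tm Inr s) = tcod (fsig S) (map_tm Inr t) \<Longrightarrow>
        fclass S (map_tm Inr s) = fclass S (map_tm Inr t)" for s t
      using fclass_frob_eq by blast
    show "seq (SFrob S) (ten (SFrob S) (frob_arrow S Eta) (Idn (SFrob S) 1)) (frob_arrow S Mu) = Idn
        (SFrob S) 1"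
      using ax[of "(Gen Eta || TId 1) ;; Gen Mu" "TId 1"]
      by (simp add: SFrob_class frob_eqs_mem del: One_nat_def)
    show "seq (SFrob S) (ten (SFrob S) (Idn (SFrob S) 1) (frob_arrow S Eta)) (frob_arrow S Mu) = Idn
        (SFrob S) 1"
      using ax[of "(TId 1 || Gen Eta) ;; Gen Mu" "TId 1"]
      by (simp add: SFrob_class frob_eqs_mem del: One_nat_def)
    show "seq (SFrob S) (Symm (SFrob S) 1 1) (frob_arrow S Mu) = frob_arrow S Mu"
      using ax[of "TSym 1 1 ;; Gen Mu" "Gen Mu"]
      by (simp add: SFrob_class frob_eqs_mem del: One_nat_def)
    show "seq (SFrob S) (frob_arrow S Delta) (ten (SFrob S) (frob_arrow S Delta) (Idn (SFrob S) 1)) =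
        seq (SFrob S) (frob_arrow S Delta) (ten (SFrob S) (Idn (SFrob S) 1) (frob_arrow S Delta))"
      using ax[of "Gen Delta ;; (Gen Delta || TId 1)" "Gen Delta ;; (TId 1 || Gen Delta)"]
      by (simp add: SFrob_class frob_eqs_mem del: One_nat_def)
    show "seq (SFrob S) (frob_arrow S Delta) (ten (SFrob S) (frob_arrow S Eps) (Idn (SFrob S) 1)) =
        Idn (SFrob S) 1"
      using ax[of "Gen Delta ;; (Gen Eps || TId 1)" "TId 1"]
      by (simp add: SFrob_class frob_eqs_mem del: One_nat_def)
    show "seq (SFrob S) (frob_arrow S Delta) (ten (SFrob S) (Idn (SFrob S) 1) (frob_arrow S Eps)) =
        Idn (SFrob S) 1"
      using ax[of "Gen Delta ;; (TId 1 || Gen Eps)" "TId 1"]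
      by (simp add: SFrob_class frob_eqs_mem del: One_nat_def)
    show "seq (SFrob S) (frob_arrow S Delta) (Symm (SFrob S) 1 1) = frob_arrow S Delta"
      using ax[of "Gen Delta ;; TSym 1 1" "Gen Delta"]
      by (simp add: SFrob_class frob_eqs_mem del: One_nat_def)
    show "seq (SFrob S) (ten (SFrob S) (frob_arrow S Delta) (Idn (SFrob S) 1)) (ten (SFrob S) (Idn
        (SFrob S) 1) (frob_arrow S Mu)) =
        seq (SFrob S) (frob_arrow S Mu) (frob_arrow S Delta)"
      using ax[of "(Gen Delta || TId 1) ;; (TId 1 || Gen Mu)" "Gen Mu ;; Gen Delta"]
      by (simp add: SFrob_class frob_eqs_mem del: One_nat_def)
    show "seq (SFrob S) (ten (SFrob S) (Idn (SFrob S) 1) (frob_arrow S Delta)) (ten (SFrob S)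
        (frob_arrow S Mu) (Idn (SFrob S) 1)) =
        seq (SFrob S) (frob_arrow S Mu) (frob_arrow S Delta)"
      using ax[of "(TId 1 || Gen Delta) ;; (Gen Mu || TId 1)" "Gen Mu ;; Gen Delta"]
      by (simp add: SFrob_class frob_eqs_mem del: One_nat_def)
    show "seq (SFrob S) (frob_arrow S Delta) (frob_arrow S Mu) = Idn (SFrob S) 1"
      using ax[of "Gen Delta ;; Gen Mu" "TId 1"]
      by (simp add: SFrob_class frob_eqs_mem del: One_nat_def)
  next
    fix g assume "g \<in> gens S"
    from parr_tm_class[OF g[OF this], of feqs]
    show "parr (fsig S) feqs (fclass S (Gen (Inl g)))" "pdom (fsig S) (fclass S (Gen (Inl g))) = ar S g"
      "pcod (fsig S) (fclass S (Gen (Inl g))) = coar S g" .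
  next
    fix K :: "'a hypergraph" and A B a b
    assume K: "hypergraph S K" and A: "parr (fsig S) feqs A" and B: "parr (fsig S) feqs B"
    obtain s where s: "A = fclass S s" "typed (fsig S) s (pdom (fsig S) A) (pcod (fsig S) A)" using
        A by (rule parrE)
    obtain t where t: "B = fclass S t" "typed (fsig S) t (pdom (fsig S) B) (pcod (fsig S) B)" using
        B by (rule parrE)
    note st = typed_tdom_tcod[OF s(2)] typed_tdom_tcod[OF t(2)]
    show "cwgt S K (seq (SFrob S) A B) a b = (\<Sum>c\<in>vec K (pcod (fsig S) A). cwgt S K A a c * cwgt S K
        B c b)"
      if "pcod (fsig S) A = pdom (fsig S) B" "a \<in> vec K (pdom (fsig S) A)" "b \<in> vec K (pcod (fsig S) B)"
    proof -
      have "cwgt S K (seq (SFrob S) A B) a b = wgt S K (s ;; t) a b"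
        using cwgt_fclass[OF typed.intros(4)[OF s(2) t(2)[folded that(1)]] K that(2,3)] s(1) t(1) by
            (metis SFrob_class(1))
      also have "\<dots> = (\<Sum>c\<in>vec K (pcod (fsig S) A). cwgt S K A a c * cwgt S K B c b)"
        using cwgt_fclass[OF s(2) K that(2), folded s(1)] cwgt_fclass[OF t(2) K _ that(3), folded
            t(1)] st that(1)
        by simp
      finally show ?thesis .
    qed
    fix a' b'
    assume v: "a \<in> vec K (pdom (fsig S) A)" "b \<in> vec K (pcod (fsig S) A)" "a' \<in> vec K (pdom (fsig S)
        B)" "b' \<in> vec K (pcod (fsig S) B)"
    have v': "a @ a' \<in> vec K (pdom (fsig S) A + pdom (fsig S) B)" "b @ b' \<in> vec K (pcod (fsig S) A +
        pcod (fsig S) B)"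
      using v by (auto simp: in_vec_add)
    have "cwgt S K (ten (SFrob S) A B) (a @ a') (b @ b') = wgt S K (s || t) (a @ a') (b @ b')"
      using cwgt_fclass[OF typed.intros(5)[OF s(2) t(2)] K v'] s(1) t(1) by (metis SFrob_class(2))
    also have "\<dots> = cwgt S K A a b * cwgt S K B a' b'"
      using cwgt_fclass[OF s(2) K v(1,2), folded s(1)] cwgt_fclass[OF t(2) K v(3,4), folded t(1)] st v
      by (simp add: vec_length)
    finally show "cwgt S K (ten (SFrob S) A B) (a @ a') (b @ b') = cwgt S K A a b * cwgt S K B a' b'" .
  next
    fix K :: "'a hypergraph" and a n b assume "hypergraph S K" "a \<in> vec K n" "b \<in> vec K n"
    then show "cwgt S K (Idn (SFrob S) n) a b = of_bool (a = b)"
      using cwgt_fclass[OF typed.intros(2)[of "fsig S" n], of K a b] by (simp add: SFrob_class)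
  next
    fix K :: "'a hypergraph" and a n a' m b assume *: "hypergraph S K" "a \<in> vec K n" "a' \<in> vec K m"
        "b \<in> vec K (m + n)"
    then have "a @ a' \<in> vec K (n + m)" by (auto simp: in_vec_add)
    with * show "cwgt S K (Symm (SFrob S) n m) (a @ a') b = of_bool (b = a' @ a)"
      using cwgt_fclass[OF typed.intros(3)[of "fsig S" n m], of K "a @ a'" b] by (simp add:
          SFrob_class vec_length)
  next
    fix K :: "'a hypergraph" and x y z assume "hypergraph S K" "x \<in> nodes K" "y \<in> nodes K" "z \<in> nodes K"
    then show "cwgt S K (frob_arrow S Mu) [x, y] [z] = of_bool (x = z \<and> y = z)"
      "cwgt S K (frob_arrow S Delta) [x] [y, z] = of_bool (y = x \<and> z = x)"
      using cwgt_fclass[OF fr'(1), of K "[x, y]" "[z]"] cwgt_fclass[OF fr'(3), of K "[x]" "[y, z]"]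
      by (auto simp: SFrob_class numeral_2_eq_2)
  next
    fix K :: "'a hypergraph" and z assume "hypergraph S K" "z \<in> nodes K"
    then show "cwgt S K (frob_arrow S Eta) [] [z] = 1" "cwgt S K (frob_arrow S Eps) [z] [] = 1"
      using cwgt_fclass[OF fr'(2), of K "[]" "[z]"] cwgt_fclass[OF fr'(4), of K "[z]" "[]"]
      by (auto simp: SFrob_class)
  next
    fix K :: "'a hypergraph" and gg a b assume "hypergraph S K" "gg \<in> gens S" "a \<in> vec K (ar S gg)"
        "b \<in> vec K (coar S gg)"
    then show "cwgt S K (fclass S (Gen (Inl gg))) a b = card {y \<in> edges K. lab K y = gg \<and> srcs K y =
        a \<and> tgts K y = b}"
      using cwgt_fclass[OF g] by simp
  next
    fix A and P :: "'a sfrob_arrow \<Rightarrow> bool"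
    assume A: "parr (fsig S) feqs A" and gen: "\<And>g. g \<in> gens S \<Longrightarrow> P (fclass S (Gen (Inl g)))"
      and fP: "P (frob_arrow S Mu)" "P (frob_arrow S Eta)" "P (frob_arrow S Delta)" "P (frob_arrow S
          Eps)"
      and idP: "\<And>n. P (Idn (SFrob S) n)" and symP: "\<And>n m. P (Symm (SFrob S) n m)"
      and seqP: "\<And>A B. parr (fsig S) feqs A \<Longrightarrow> parr (fsig S) feqs B \<Longrightarrow> pcod (fsig S) A = pdom (fsig S) B \<Longrightarrow>
        P A \<Longrightarrow> P B \<Longrightarrow> P (seq (SFrob S) A B)"
      and tenP: "\<And>A B. parr (fsig S) feqs A \<Longrightarrow> parr (fsig S) feqs B \<Longrightarrow> P A \<Longrightarrow> P B \<Longrightarrow> P (ten (SFrob S) A B)"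
    have "P (fclass S t)" if "typed (fsig S) t n m" for t n m
      using that
    proof (induction rule: typed.induct)
      case (1 x)
      show ?case
      proof (cases x)
        case (Inl g)
        with 1 gen show ?thesis by auto
      next
        case (Inr f)
        with fP show ?thesis by (cases f) (simp_all add: SFrob_class)
      qed
    next
      case (2 n)
      show ?case using idP[of n] by (simp add: SFrob_class)
    next
      case (3 n m)
      show ?case using symP[of n m] by (simp add: SFrob_class)
    next
      case (4 s n k t m)
      then show ?case
        using seqP[of "fclass S s" "fclass S t"] parr_tm_class[OF 4(1), of feqs] parr_tm_class[OF
            4(2), of feqs]
        by (simp add: SFrob_class)
    next
      case (5 s n m t n' m')
      then show ?case
        using tenP[of "fclass S s" "fclass S t"] parr_tm_class[OF 5(1), of feqs] parr_tm_class[OF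
            5(2), of feqs]
        by (simp add: SFrob_class)
    qed
    then show "P A" using A unfolding parr_def by blast
  qed
qed

text \<open>The link to double pushouts: a pushout square of representatives of two arrows is itself
  a representative of their composite.\<close>

lemma seq_in_Phi:
  assumes A: "parr (fsig S) feqs A" and B: "parr (fsig S) feqs B" and AB: "pcod (fsig S) A = pdom
      (fsig S) B"
    and "Cospan n l G r k \<in> Phi S A" "Cospan k l' G' r' m \<in> Phi S B" "pushout S (discrete k) G G' r
        l' P h i"
  shows "Cospan n (l \<then> h) P (r' \<then> i) m \<in> Phi S (seq (SFrob S) A B)"
proof -
  obtain s where s: "A = fclass S s" "typed (fsig S) s (pdom (fsig S) A) (pcod (fsig S) A)" using A
      by (rule parrE)
  obtain t where t: "B = fclass S t" "typed (fsig S) t (pdom (fsig S) B) (pcod (fsig S) B)" using B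
      by (rule parrE)
  have m: "Cospan n l G r k \<in> Sem S (pdom (fsig S) A) (pcod (fsig S) A) (\<lambda>K. wgt S K s)"
      "Cospan k l' G' r' m \<in> Sem S (pdom (fsig S) B) (pcod (fsig S) B) (\<lambda>K. wgt S K t)"
    using assms(4,5) Phi_Sem(1)[OF s(2)] Phi_Sem(1)[OF t(2)] s(1) t(1) by simp_all
  have nk: "n = pdom (fsig S) A" "k = pcod (fsig S) A" "m = pcod (fsig S) B"
    using Sem_Cospan_iff[OF m(1)] Sem_Cospan_iff[OF m(2)] by auto
  have "Cospan n (l \<then> h) P (r' \<then> i) m \<in> Sem S n m (\<lambda>K. wgt S K (s ;; t))"
    using m assms(6) typed_tdom_tcod[OF s(2)] AB unfolding nk[symmetric] by (intro seq_in_Sem) simp_all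
  moreover have "typed (fsig S) (s ;; t) n m"
    using typed.intros(4)[OF s(2) t(2)[folded AB]] nk by simp
  ultimately show ?thesis
    using Phi_Sem(1)[of S "s ;; t" n m] SFrob_class(1)[of S s t] s(1) t(1) by simp
qed

theorem theorem4p6:
  fixes S :: "'g signature"
    and \<R> :: "('g sfrob_arrow \<times> 'g sfrob_arrow) set"
    and d e :: "'g sfrob_arrow"
    and n m :: nat
  assumes "rewriting_system (SFrob S) \<R>"
    and "d \<in> Hom (SFrob S) n m"
    and "e \<in> Hom (SFrob S) n m"
  shows "rewrite_step (SFrob S) \<R> n m d e \<longleftrightarrow>
    dpo_step S (dpo_rules (map_prod (Phi S) (Phi S) ` bend_system S \<R>))
      (Phi S (bend S n d)) (Phi S (bend S n e))"
proof -
  let ?arr = "parr (fsig S) feqs" and ?dm = "pdom (fsig S)" and ?cd = "pcod (fsig S)"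
  interpret SF: frobenius_wgt ?arr ?dm ?cd "seq (SFrob S)" "ten (SFrob S)" "Idn (SFrob S)" "Symm
      (SFrob S)"
    "frob_arrow S Mu" "frob_arrow S Eta" "frob_arrow S Delta" "frob_arrow S Eps" S "\<lambda>g. fclass S
        (Gen (Inl g))" "cwgt S"
    by (rule frobenius_wgt_SFrob)
  have Hom: "A \<in> Hom (SFrob S) p q \<longleftrightarrow> ?arr A \<and> ?dm A = p \<and> ?cd A = q" for A p q
    unfolding SFrob_def by (rule Hom_iff)
  \<comment> \<open>Bending in the presented PROP is the parallel bending for which contexts were
    treated.\<close>
  have cap: "cap S k = SF.cap_par k" for k
    by (induction k rule: SF.cap_par.induct) simp_all
  have bend: "bend S k A = SF.bend_par k A" for k A
    by (simp add: bend_def SF.bend_par_def cap)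
  note d = assms(2)[unfolded Hom] and e = assms(3)[unfolded Hom]
  have bt: "?arr (bend S i l)" "?dm (bend S i l) = 0" "?cd (bend S i l) = i + j" if "l \<in> Hom (SFrob
      S) i j" for l i j
    using that SF.bend_par_typ[of l i] unfolding Hom bend by auto
  have Phi_typ: "n' = ?dm A \<and> m' = ?cd A" if "Cospan n' u G p m' \<in> Phi S A" "?arr A" for A n' m' u G p
    using that Phi_eq_Sem(1)[OF that(2)] Sem_Cospan_iff by metis
  show ?thesis
  proof
    assume "rewrite_step (SFrob S) \<R> n m d e"
    then obtain l r i j k c1 c2 where lr: "(l, r) \<in> \<R>" "l \<in> Hom (SFrob S) i j" "r \<in> Hom (SFrob S) i j"
      and c1: "c1 \<in> Hom (SFrob S) n (k + i)" and c2: "c2 \<in> Hom (SFrob S) (k + j) m"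
      and de: "d = seq (SFrob S) (seq (SFrob S) c1 (ten (SFrob S) (Idn (SFrob S) k) l)) c2"
        "e = seq (SFrob S) (seq (SFrob S) c1 (ten (SFrob S) (Idn (SFrob S) k) r)) c2"
      unfolding rewrite_step_def by blast
    \<comment> \<open>The arrow \<open>c\<close> is fixed before \<open>l\<close> and
      \<open>r\<close> are inserted, so it serves both sides of the rule.\<close>
    obtain c where c: "?arr c" "?dm c = i + j" "?cd c = n + m"
      and bc: "\<And>l. ?arr l \<Longrightarrow> ?dm l = i \<Longrightarrow> ?cd l = j \<Longrightarrow>
        SF.bend_par n (seq (SFrob S) c1 (seq (SFrob S) (ten (SFrob S) (Idn (SFrob S) k) l) c2)) =
            seq (SFrob S) (SF.bend_par i l) c"
      using SF.bend_of_context[of c1 n k i c2 j m] c1 c2 unfolding Hom by metis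
    have bd: "bend S n d = seq (SFrob S) (bend S i l) c" "bend S n e = seq (SFrob S) (bend S i r) c"
      using bc lr(2,3) unfolding de bend Hom by (simp_all add: SF.sq_assoc)
    obtain u L a where L: "Cospan 0 u L a (i + j) \<in> Phi S (bend S i l)" "hom S (discrete (i + j)) L a"
      using Phi_eq_Sem[OF bt(1)[OF lr(2)]] bt[OF lr(2)] by (metis SemD_Cospan all_not_in_conv)
    obtain v R b where R: "Cospan 0 v R b (i + j) \<in> Phi S (bend S i r)" "hom S (discrete (i + j)) R b"
      using Phi_eq_Sem[OF bt(1)[OF lr(3)]] bt[OF lr(3)] by (metis SemD_Cospan all_not_in_conv)
    \<comment> \<open>Any representative of \<open>c\<close> can be taken as the common pushout
      complement of both squares.\<close>
    obtain c0 C s where C: "Cospan (i + j) c0 C s (n + m) \<in> Phi S c" "hom S (discrete (i + j)) C c0"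
        "hom S (discrete (n + m)) C s"
      using Phi_eq_Sem[OF c(1)] c by (metis SemD_Cospan all_not_in_conv)
    obtain G f g where G: "pushout S (discrete (i + j)) L C a c0 G f g"
      using pushout_exists[OF L(2) C(2)] .
    obtain H h q where H: "pushout S (discrete (i + j)) R C b c0 H h q"
      using pushout_exists[OF R(2) C(2)] .
    have D: "Cospan 0 (u \<then> f) G (s \<then> g) (n + m) \<in> Phi S (bend S n d)"
      unfolding bd using L C G c bt[OF lr(2)] by (intro seq_in_Phi) auto
    have E: "Cospan 0 (v \<then> h) H (s \<then> q) (n + m) \<in> Phi S (bend S n e)"
      unfolding bd using R C H c bt[OF lr(3)] by (intro seq_in_Phi) auto
    have "(bend S i l, bend S i r) \<in> bend_system S \<R>"
      using lr unfolding bend_system_def by blast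
    then have "(Phi S (bend S i l), Phi S (bend S i r)) \<in> map_prod (Phi S) (Phi S) ` bend_system S \<R>"
      by (rule map_prod_imageI)
    then have rule: "DPO_Rule L a (i + j) b R \<in> dpo_rules (map_prod (Phi S) (Phi S) ` bend_system S \<R>)"
      using L R unfolding dpo_rules_def by blast
    have legs: "leg_eq (n + m) (s \<then> g) (s \<then> g)" "leg_eq (n + m) (s \<then> q) (s \<then> q)"
      by (simp_all add: leg_eq_def)
    show "dpo_step S (dpo_rules (map_prod (Phi S) (Phi S) ` bend_system S \<R>))
      (Phi S (bend S n d)) (Phi S (bend S n e))"
      unfolding dpo_step_def by (intro exI conjI) (fact D E rule C(2,3) G H legs)+
  next
    assume "dpo_step S (dpo_rules (map_prod (Phi S) (Phi S) ` bend_system S \<R>))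
      (Phi S (bend S n d)) (Phi S (bend S n e))"
    then obtain u G p v H q m' L a jj b R C c0 s f g h k where
      D: "Cospan 0 u G p m' \<in> Phi S (bend S n d)" and E: "Cospan 0 v H q m' \<in> Phi S (bend S n e)"
      and rule: "DPO_Rule L a jj b R \<in> dpo_rules (map_prod (Phi S) (Phi S) ` bend_system S \<R>)"
      and C: "hom S (discrete jj) C c0" "hom S (discrete m') C s"
      and po: "pushout S (discrete jj) L C a c0 G f g" "pushout S (discrete jj) R C b c0 H h k"
      and legs: "leg_eq m' (s \<then> g) p" "leg_eq m' (s \<then> k) q"
      unfolding dpo_step_def by blast
    from rule obtain u' v' l r i j where lr: "(l, r) \<in> \<R>" "l \<in> Hom (SFrob S) i j" "r \<in> Hom (SFrob S) i j"
      and L: "Cospan 0 u' L a jj \<in> Phi S (bend S i l)" and R: "Cospan 0 v' R b jj \<in> Phi S (bend S i r)"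
      unfolding dpo_rules_def bend_system_def by auto
    have m': "m' = n + m" using Phi_typ[OF D] bt[OF assms(2)] by simp
    have jj: "jj = i + j" using Phi_typ[OF L] bt[OF lr(2)] by simp
    \<comment> \<open>Fullness turns the given pushout complement into an arrow of the PROP.\<close>
    obtain c where c: "?arr c" "?dm c = i + j" "?cd c = n + m"
      and cw: "\<And>K a b. hypergraph S K \<Longrightarrow> a \<in> vec K (i + j) \<Longrightarrow> b \<in> vec K (n + m) \<Longrightarrow>
        card (homs S K (Cospan (i + j) c0 C s (n + m)) a b) = cwgt S K c a b"
      using SF.full[of "i + j" C c0 "n + m" s] C unfolding m' jj by metis
    \<comment> \<open>Membership in \<open>Phi S c\<close> is a matter of matrices only, so the
      counts provided by fullness suffice.\<close>
    have Cc: "Cospan jj c0 C s m' \<in> Phi S c"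
      unfolding Phi_eq_Sem(1)[OF c(1)] using C cw unfolding m' jj c(2,3) by (intro SemI)
    \<comment> \<open>Stated for an arbitrary rule side, since it is needed once for each of the two
      squares with the same \<open>c\<close>.\<close>
    have key: "bend S n x = seq (SFrob S) (bend S i y) c"
      if x: "x \<in> Hom (SFrob S) n m" and y: "y \<in> Hom (SFrob S) i j" and X: "Cospan 0 u G p m' \<in> Phi S
          (bend S n x)"
        and Y: "Cospan 0 u' L a jj \<in> Phi S (bend S i y)" and po: "pushout S (discrete jj) L C a c0 G f g"
        and leg: "leg_eq m' (s \<then> g) p" for x y u G p u' L a f g
    proof (rule SF.complete[OF bt[OF x]])
      let ?Z = "seq (SFrob S) (bend S i y) c"
      show Z: "?arr ?Z" "?dm ?Z = 0" "?cd ?Z = n + m"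
        using bt[OF y] c by (simp_all add: SF.smc_ty)
      have YC: "Cospan 0 (u' \<then> f) G (s \<then> g) m' \<in> Phi S ?Z"
        using bt[OF y] c Y Cc po by (intro seq_in_Phi) auto
      fix K a' b' assume K: "hypergraph S K" and ab: "a' \<in> vec K 0" "b' \<in> vec K (n + m)"
      \<comment> \<open>The left legs start at 0 and impose no condition; the right legs agree by
        \<open>leg_eq\<close>.\<close>
      have "homs S K (Cospan 0 (u' \<then> f) G (s \<then> g) m') a' b' = homs S K (Cospan 0 u G p m') a' b'"
        using leg by (auto simp: leg_eq_def)
      moreover have "card (homs S K (Cospan 0 u G p m') a' b') = cwgt S K (bend S n x) a' b'"
        using X K ab bt[OF x] unfolding Phi_eq_Sem(1)[OF bt(1)[OF x]] by (simp add: Sem_def del: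
            homs.simps)
      moreover have "card (homs S K (Cospan 0 (u' \<then> f) G (s \<then> g) m') a' b') = cwgt S K ?Z a' b'"
        using YC K ab Z unfolding Phi_eq_Sem(1)[OF Z(1)] by (simp add: Sem_def del: homs.simps)
      ultimately show "cwgt S K (bend S n x) a' b' = cwgt S K ?Z a' b'" by simp
    qed
    have bd: "SF.bend_par n d = seq (SFrob S) (SF.bend_par i l) c"
      using key[OF assms(2) lr(2) D L po(1) legs(1)] by (simp only: bend)
    have be: "SF.bend_par n e = seq (SFrob S) (SF.bend_par i r) c"
      using key[OF assms(3) lr(3) E R po(2) legs(2)] by (simp only: bend)
    \<comment> \<open>One context is obtained for both sides of the rule, with \<open>n + i\<close>
      bypassing wires in the role of \<open>k\<close>.\<close>
    obtain c1 c2 where c12: "?arr c1" "?dm c1 = n" "?cd c1 = (n + i) + i" "?arr c2" "?dm c2 = (n +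
        i) + j" "?cd c2 = m"
      and cx: "\<And>d l. ?arr d \<Longrightarrow> ?dm d = n \<Longrightarrow> ?cd d = m \<Longrightarrow> ?arr l \<Longrightarrow> ?dm l = i \<Longrightarrow> ?cd l = j \<Longrightarrow>
        SF.bend_par n d = seq (SFrob S) (SF.bend_par i l) c \<Longrightarrow>
        d = seq (SFrob S) c1 (seq (SFrob S) (ten (SFrob S) (Idn (SFrob S) (n + i)) l) c2)"
      by (rule SF.context_of_bend[OF c]) (rule that)
    have "d = seq (SFrob S) (seq (SFrob S) c1 (ten (SFrob S) (Idn (SFrob S) (n + i)) l)) c2"
      unfolding SF.sq_assoc using d lr(2)[unfolded Hom] by (intro cx bd) auto
    moreover have "e = seq (SFrob S) (seq (SFrob S) c1 (ten (SFrob S) (Idn (SFrob S) (n + i)) r)) c2"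
      unfolding SF.sq_assoc using e lr(3)[unfolded Hom] by (intro cx be) auto
    moreover have "c1 \<in> Hom (SFrob S) n ((n + i) + i)" "c2 \<in> Hom (SFrob S) ((n + i) + j) m"
      using c12 unfolding Hom by auto
    ultimately show "rewrite_step (SFrob S) \<R> n m d e"
      unfolding rewrite_step_def using lr by blast
  qed
qed

end
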